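(* Let $d\ge 1$ and let $f\in L^1([-\pi,\pi]^d)$ be such that, for every multi-index $\mathbf{n}=(n_1,\dots,n_d)$ of positive integers, the multilevel Toeplitz matrix $T_{\mathbf{n}}(f)$ is real, i.e. $T_{\mathbf{n}}(f)\in\mathbb{R}^{d_{\mathbf{n}}\times d_{\mathbf{n}}}$ with $d_{\mathbf{n}}=n_1\cdots n_d$. Let $Y_{\mathbf{n}}=Y_{n_1}\otimes\cdots\otimes Y_{n_d}$, where $Y_{m}$ is the $m\times m$ exchange matrix (entries $1$ on the main anti-diagonal and $0$ elsewhere). Then the sequence $\{Y_{\mathbf{n}}T_{\mathbf{n}}(f)\}_{\mathbf{n}}$ is distributed in the sense of the eigenvalues as $(g,[-\pi,\pi]^d)$, where $$g(\boldsymbol{\theta})=\begin{bmatrix}0 & f(\boldsymbol{\theta})\\ f^\ast(\boldsymbol{\theta}) & 0\end{bmatrix}$$ (whose eigenvalues are $\pm|f(\boldsymbol{\theta})|$). Explicitly, for every continuous function $F:\mathbb{C}\to\mathbb{C}$ with compact support, $$\lim_{\mathbf{n}\to\infty}\frac{1}{d_{\mathbf{n}}}\sum_{j=1}^{d_{\mathbf{n}}}F\big(\lambda_j(Y_{\mathbf{n}}T_{\mathbf{n}}(f))\big)=\frac{1}{(2\pi)^d}\int_{[-\pi,\pi]^d}\frac{\operatorname{tr}\big(F(g(\boldsymbol{\theta}))\big)}{2}\,d\boldsymbol{\theta}=\frac{1}{(2\pi)^d}\int_{[-\pi,\pi]^d}\frac{F(|f(\boldsymbol{\theta})|)+F(-|f(\boldsymbol{\theta})|)}{2}\,d\boldsymbol{\theta},$$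 where $\lambda_j(\cdot)$, $j=1,\dots,d_{\mathbf{n}}$, denote the eigenvalues.
   Context: Multilevel Toeplitz matrices: for $f\in L^1([-\pi,\pi]^d)$ with Fourier coefficients $t_{\mathbf{k}}=\frac{1}{(2\pi)^d}\int_{[-\pi,\pi]^d}f(\boldsymbol{\theta})e^{-\mathrm{i}\langle\mathbf{k},\boldsymbol{\theta}\rangle}d\boldsymbol{\theta}$, $\mathbf{k}\in\mathbb{Z}^d$, $\langle\mathbf{k},\boldsymbol{\theta}\rangle=\sum_\ell k_\ell\theta_\ell$, one sets $T_{\mathbf{n}}(f)=\sum_{|k_1|<n_1}\cdots\sum_{|k_d|<n_d}J^{(k_1)}_{n_1}\otimes\cdots\otimes J^{(k_d)}_{n_d}\,t_{\mathbf{k}}$, where $J^{(\ell)}_n$ is the $n\times n$ matrix with $(i,j)$ entry $1$ if $i-j=\ell$ and $0$ otherwise. The notation $\mathbf{n}\to\infty$ means $\min_k n_k\to\infty$. $f^\ast$ denotes the complex conjugate of $f$, $|f|=(ff^\ast)^{1/2}$, and $F(g(\boldsymbol{\theta}))$ for the Hermitian matrix $g(\boldsymbol\theta)$ is defined through its eigenvalues (so $\operatorname{tr}F(g)=F(|f|)+F(-|f|)$). Note $Y_{\mathbf{n}}T_{\mathbf{n}}(f)$ is real symmetric. *)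

theory Defs
  imports "HOL-Analysis.Analysis" "HOL-Computational_Algebra.Polynomial"
begin

text \<open>Multi-indices are functions from a finite index type 'd (the levels, d = CARD('d))
  to nat; frequency variables live in real^'d.\<close>

definition pibox :: "(real ^ 'd) set" where
  "pibox = cbox (- (\<chi> l. pi)) (\<chi> l. pi)"

definition fourier_coeff :: "(real ^ 'd \<Rightarrow> complex) \<Rightarrow> ('d::finite \<Rightarrow> int) \<Rightarrow> complex" where
  "fourier_coeff f k = integral pibox
     (\<lambda>\<theta>. f \<theta> * exp (- \<i> * complex_of_real (\<Sum>l\<in>UNIV. of_int (k l) * \<theta> $ l)))
     / complex_of_real ((2 * pi) ^ CARD('d))"

definition mindex :: "('d::finite \<Rightarrow> nat) \<Rightarrow> ('d \<Rightarrow> nat) set" where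
  "mindex n = {i. \<forall>l. i l < n l}"

text \<open>Matrices indexed by multi-indices (entries outside mindex n are irrelevant).
  The Kronecker product J^(k_1) x ... x J^(k_d) has entry 1 at (i,j) iff i_l - j_l = k_l for all l.\<close>
definition toeplitz :: "(real ^ 'd \<Rightarrow> complex) \<Rightarrow> ('d::finite \<Rightarrow> nat)
    \<Rightarrow> ('d \<Rightarrow> nat) \<Rightarrow> ('d \<Rightarrow> nat) \<Rightarrow> complex" where
  "toeplitz f n i j =
     (\<Sum>k\<in>{k::'d \<Rightarrow> int. \<forall>l. \<bar>k l\<bar> < int (n l)}.
        (\<Prod>l\<in>UNIV. if int (i l) - int (j l) = k l then 1 else 0) * fourier_coeff f k)"

text \<open>Multilevel exchange matrix Y_n = Y_{n_1} x ... x Y_{n_d} (0-based indices).\<close>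
definition exchange :: "('d::finite \<Rightarrow> nat) \<Rightarrow> ('d \<Rightarrow> nat) \<Rightarrow> ('d \<Rightarrow> nat) \<Rightarrow> complex" where
  "exchange n i j = (\<Prod>l\<in>UNIV. if i l + j l = n l - 1 then 1 else 0)"

definition mmult :: "('i set) \<Rightarrow> ('i \<Rightarrow> 'i \<Rightarrow> complex) \<Rightarrow> ('i \<Rightarrow> 'i \<Rightarrow> complex)
    \<Rightarrow> 'i \<Rightarrow> 'i \<Rightarrow> complex" where
  "mmult I A B i j = (\<Sum>k\<in>I. A i k * B k j)"

text \<open>Characteristic polynomial det(X*Id - M) of a matrix indexed by a finite set I
  (Leibniz formula).\<close>
definition charpoly :: "'i set \<Rightarrow> ('i \<Rightarrow> 'i \<Rightarrow> complex) \<Rightarrow> complex poly" where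
  "charpoly I M = (\<Sum>p\<in>{p. p permutes I}. of_int (sign p) *
      (\<Prod>i\<in>I. if p i = i then [:- M i i, 1:] else [:- M i (p i):]))"

definition eig_sum :: "'i set \<Rightarrow> ('i \<Rightarrow> 'i \<Rightarrow> complex) \<Rightarrow> (complex \<Rightarrow> complex) \<Rightarrow> complex" where
  "eig_sum I M F = (\<Sum>z\<in>{z. poly (charpoly I M) z = 0}. of_nat (order z (charpoly I M)) * F z)"

end

theory Submission
  imports Defs "Jordan_Normal_Form.Spectral_Radius"
begin

text \<open>
  The matrix \<open>Y T\<close> is the real symmetric Hankel matrix with entries \<open>t (n - 1 - i - j)\<close>.

  If the symbol is a trigonometric polynomial \<open>p\<close> with real coefficients, the rows of the \<open>m\<close>-th power
  of this matrix that are far from the boundary carry the Fourier coefficients of \<open>P m\<close>, where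
  \<open>P 0 = 1\<close> and \<open>P (m + 1) = p * cnj (P m)\<close>; they sit along diagonals for even \<open>m\<close> and along
  anti-diagonals for odd \<open>m\<close>. So normalised traces of even powers converge to the mean of \<open>\<bar>p\<bar> ^ m\<close> and
  those of odd powers to \<open>0\<close>, and the Weierstrass theorem gives all continuous test functions.

  For \<open>f\<close> in \<open>L\<^sup>1\<close>, let \<open>p\<close> be a trigonometric polynomial with real coefficients close to \<open>f\<close> in \<open>L\<^sup>1\<close>.
  If \<open>\<phi> x - \<phi> y = (x - y) * (\<Sum>s. a s x * b s y)\<close> with bounded \<open>a s\<close> and \<open>b s\<close>, then
  \<open>tr \<phi>(A) - tr \<phi>(B)\<close> equals \<open>tr ((A - B) C)\<close> with \<open>\<parallel>C\<parallel>\<close> bounded by a constant depending only on \<open>\<phi>\<close>. As the Hankel matrix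
  of \<open>f - p\<close> is an average, with weight \<open>f - p\<close>, of rank one matrices with unimodular entries, this trace is at most
  a constant times \<open>\<parallel>f - p\<parallel>\<^sub>1\<close> times the dimension. Such \<open>\<phi>\<close> form an algebra containing \<open>1 / (1 + x\<^sup>2)\<close>
  and \<open>x / (1 + x\<^sup>2)\<close>, so by Stone-Weierstrass they approximate every compactly supported
  continuous function uniformly on the real line.
\<close>

section \<open>Orthogonal diagonalization of real symmetric matrices\<close>

no_notation Finite_Cartesian_Product.vec_nth (infixl \<open>$\<close> 90)
no_notation inner (infix \<open>\<bullet>\<close> 70)

text \<open>For \<open>f\<close> merely in L1 the matrices need not have bounded norm, nor |f|
  finite moments, so the moment method is confined to polynomial symbols. Closeness in L1 controls
  the matrix difference only in a trace-norm sense. Comparing sorted eigenvalues would call for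
  majorization inequalities and singular values; an exact formula for the difference of two spectral
  sums is used instead. It pairs \<open>A - B\<close> with a matrix \<open>C\<close> which, for a
  product kernel \<open>a x * b y\<close>, is just a(A) b(B) and hence visibly bounded. The trace
  norm is replaced by testing against all \<open>C\<close> whose form z^T C z is bounded on
  unimodular vectors. The form carries no conjugation because a Hankel index depends on i + j. Real
  coefficients enter twice: they make the matrix symmetric, with real spectrum and an orthonormal
  eigenbasis, and they make conjugation of \<open>P m\<close> a reflection of frequencies, which is
  what the exchange matrix does to indices. Even moments of |p| together with vanishing odd moments
  are the moments of |p| with a fair random sign; this is the origin of the pair +-|f|.\<close>

lemma real_symmetric_eigenvector:
  fixes A :: "real mat"
  assumes A: "A \<in> carrier_mat n n" and sym: "transpose_mat A = A" and n: "n > 0"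
  obtains v e where "v \<in> carrier_vec n" "v \<noteq> 0\<^sub>v n" "A *\<^sub>v v = e \<cdot>\<^sub>v v"
proof -
  let ?C = "map_mat complex_of_real A"
  have C: "?C \<in> carrier_mat n n" using A by simp
  obtain z where "eigenvalue ?C z"
    using spectrum_non_empty[OF C n] by (auto simp: spectrum_def)
  then obtain x where x: "x \<in> carrier_vec n" "x \<noteq> 0\<^sub>v n" "?C *\<^sub>v x = z \<cdot>\<^sub>v x"
    using A by (auto simp: eigenvalue_def eigenvector_def)
  define a where "a = map_vec Re x"
  define b where "b = map_vec Im x"
  have ab: "a \<in> carrier_vec n" "b \<in> carrier_vec n" using x by (auto simp: a_def b_def)
  have Cx: "(\<Sum>j<n. complex_of_real (A $$ (i,j)) * x $ j) = z * x $ i" if "i < n" for i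
  proof -
    have "(?C *\<^sub>v x) $ i = (\<Sum>j<n. complex_of_real (A $$ (i,j)) * x $ j)"
      using that A x(1) by (simp add: scalar_prod_def atLeast0LessThan)
    then show ?thesis using x that by auto
  qed
  have re: "(\<Sum>j<n. A $$ (i,j) * Re (x $ j)) = Re z * Re (x $ i) - Im z * Im (x $ i)" if "i < n" for i
    using arg_cong[OF Cx[OF that], of Re] by simp
  have im: "(\<Sum>j<n. A $$ (i,j) * Im (x $ j)) = Re z * Im (x $ i) + Im z * Re (x $ i)" if "i < n" for i
    using arg_cong[OF Cx[OF that], of Im] by simp
  have symA: "A $$ (i,j) = A $$ (j,i)" if "i < n" "j < n" for i j
    using that A arg_cong[OF sym, of "\<lambda>M. M $$ (j,i)"] by simp
  \<comment> \<open>With x = a + i b, symmetry gives b^T A a = a^T A b. Inserting the real and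
    imaginary parts of A x = z x on the two sides leaves Im z * |x|^2 = 0.\<close>
  have "(\<Sum>i<n. Im (x $ i) * (\<Sum>j<n. A $$ (i,j) * Re (x $ j)))
      = (\<Sum>i<n. \<Sum>j<n. Im (x $ i) * A $$ (i,j) * Re (x $ j))"
    by (simp add: sum_distrib_left mult.assoc)
  also have "\<dots> = (\<Sum>j<n. \<Sum>i<n. Im (x $ i) * A $$ (i,j) * Re (x $ j))"
    by (rule sum.swap)
  also have "\<dots> = (\<Sum>j<n. Re (x $ j) * (\<Sum>i<n. A $$ (j,i) * Im (x $ i)))"
    by (simp add: sum_distrib_left mult_ac symA)
  finally have "(\<Sum>i<n. Im (x $ i) * (Re z * Re (x $ i) - Im z * Im (x $ i)))
      = (\<Sum>j<n. Re (x $ j) * (Re z * Im (x $ j) + Im z * Re (x $ j)))"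
    by (simp add: re im)
  then have "Im z * (\<Sum>i<n. (Re (x $ i))\<^sup>2 + (Im (x $ i))\<^sup>2) = 0"
    by (simp add: algebra_simps sum.distrib sum_subtractf sum_distrib_left power2_eq_square)
  moreover have "(\<Sum>i<n. (Re (x $ i))\<^sup>2 + (Im (x $ i))\<^sup>2) \<noteq> 0"
  proof
    assume "(\<Sum>i<n. (Re (x $ i))\<^sup>2 + (Im (x $ i))\<^sup>2) = 0"
    then have "\<forall>i<n. (Re (x $ i))\<^sup>2 + (Im (x $ i))\<^sup>2 = 0"
      by (subst (asm) sum_nonneg_eq_0_iff) auto
    then have "\<forall>i<n. x $ i = 0" by (simp add: complex_eq_iff sum_power2_eq_zero_iff)
    then have "x = 0\<^sub>v n" using x(1) by (intro eq_vecI) auto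
    with x show False by simp
  qed
  ultimately have Im: "Im z = 0" by simp
  have Aa: "A *\<^sub>v a = Re z \<cdot>\<^sub>v a" and Ab: "A *\<^sub>v b = Re z \<cdot>\<^sub>v b"
    using A x(1) re im Im by (auto intro!: eq_vecI simp: a_def b_def scalar_prod_def atLeast0LessThan)
  have "a \<noteq> 0\<^sub>v n \<or> b \<noteq> 0\<^sub>v n"
  proof (rule ccontr)
    assume "\<not> ?thesis"
    then have "a $ i = 0" "b $ i = 0" if "i < n" for i using that by auto
    then have "x $ i = 0" if "i < n" for i
      using x(1) that unfolding a_def b_def by (auto simp: complex_eq_iff)
    then have "x = 0\<^sub>v n" using x(1) by (intro eq_vecI) auto
    with x show False by simp
  qed
  then show thesis using that ab Aa Ab by blast
qed

text \<open>The reflection in the hyperplane orthogonal to w = v - e_0 exchanges the unit vectors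
  e_0 and v. It degenerates for v = e_0, where the identity serves.\<close>

lemma householder:
  fixes v :: "real vec"
  assumes v: "v \<in> carrier_vec n" and n: "n > 0" and unit: "(\<Sum>i<n. (v $ i)\<^sup>2) = 1"
  obtains Q where "Q \<in> carrier_mat n n" "transpose_mat Q = Q" "Q * Q = 1\<^sub>m n" "col Q 0 = v"
proof (cases "v = unit_vec n 0")
  case True
  then show thesis using n by (intro that[of "1\<^sub>m n"]) auto
next
  case False
  define w where "w = (\<lambda>i. v $ i - (if i = 0 then 1 else 0))"
  have ww: "(\<Sum>i<n. (w i)\<^sup>2) = - 2 * w 0"
  proof -
    have "(\<Sum>i<n. (w i)\<^sup>2) = (\<Sum>i<n. (v $ i)\<^sup>2 + (if i = 0 then 1 - 2 * v $ 0 else 0))"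
      by (intro sum.cong) (auto simp: w_def power2_eq_square algebra_simps)
    also have "\<dots> = 2 - 2 * v $ 0" using n unit by (simp add: sum.distrib)
    finally show ?thesis by (simp add: w_def)
  qed
  have w0: "w 0 \<noteq> 0"
  proof
    assume "w 0 = 0"
    then have "\<forall>i<n. w i = 0" using ww by (simp add: sum_nonneg_eq_0_iff)
    then have "v = unit_vec n 0" using v by (intro eq_vecI) (auto simp: w_def unit_vec_def split: if_splits)
    with False show False by simp
  qed
  \<comment> \<open>Both vectors being unit, |w|^2 = -2 w_0, so this is the usual factor 2 / |w|^2;
    column 0 then equals e_0 + w = v.\<close>
  define c where "c = - 1 / w 0"
  have cw: "c * (\<Sum>i<n. (w i)\<^sup>2) = 2" using w0 by (simp add: ww c_def)
  define Q where "Q = mat n n (\<lambda>(i,j). (if i = j then 1 else 0) - c * w i * w j)"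
  have Q: "Q \<in> carrier_mat n n" by (simp add: Q_def)
  show thesis
  proof (rule that[OF Q])
    show "transpose_mat Q = Q" by (rule eq_matI) (auto simp: Q_def)
    show "Q * Q = 1\<^sub>m n"
    proof (rule eq_matI)
      fix i j assume ij: "i < dim_row (1\<^sub>m n)" "j < dim_col (1\<^sub>m n)"
      then have ij': "i < n" "j < n" by auto
      have "(Q * Q) $$ (i,j) = (\<Sum>k<n. ((if i = k then 1 else 0) - c * w i * w k) * ((if k = j then 1 else 0) - c * w k * w j))"
        using ij' by (simp add: Q_def scalar_prod_def atLeast0LessThan)
      also have "\<dots> = (\<Sum>k<n. (if k = i then (if i = j then 1 else 0) - c * w i * w j else 0)
           + (if k = j then - c * w i * w j else 0) + c * w i * w j * (c * (w k)\<^sup>2))"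
        by (intro sum.cong) (auto simp: algebra_simps power2_eq_square)
      also have "\<dots> = (if i = j then 1 else 0) - 2 * (c * w i * w j) + c * w i * w j * (c * (\<Sum>k<n. (w k)\<^sup>2))"
        using ij' by (simp only: sum.distrib sum_distrib_left) simp
      also have "\<dots> = (if i = j then 1 else 0)" by (simp add: cw)
      finally show "(Q * Q) $$ (i,j) = 1\<^sub>m n $$ (i,j)" using ij' by simp
    qed (auto simp: Q_def)
    show "col Q 0 = v"
      using v n w0 by (intro eq_vecI) (auto simp: Q_def w_def c_def)
  qed
qed

text \<open>Deflation: a reflection \<open>Q\<close> moves e_0 to a unit eigenvector, so
  \<open>Q * A * Q\<close> has a multiple of e_0 as first column and, by symmetry, as first row. The
  remaining block is symmetric of size \<open>n\<close>; its diagonalization is padded by a one by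
  one block.\<close>

theorem real_symmetric_diagonalization:
  fixes A :: "real mat"
  assumes "A \<in> carrier_mat n n" "transpose_mat A = A"
  shows "\<exists>P D. P \<in> carrier_mat n n \<and> D \<in> carrier_mat n n \<and> diagonal_mat D \<and>
    P * transpose_mat P = 1\<^sub>m n \<and> transpose_mat P * P = 1\<^sub>m n \<and> A = P * D * transpose_mat P"
  using assms
proof (induction n arbitrary: A)
  case 0
  then show ?case
    by (intro exI[of _ A]) (auto simp: diagonal_mat_def intro!: eq_matI)
next
  case (Suc n)
  note A = Suc.prems(1) and sym = Suc.prems(2)
  obtain v e where v: "v \<in> carrier_vec (Suc n)" "v \<noteq> 0\<^sub>v (Suc n)" "A *\<^sub>v v = e \<cdot>\<^sub>v v"
    using real_symmetric_eigenvector[OF A sym] by auto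
  define s where "s = (\<Sum>i<Suc n. (v $ i)\<^sup>2)"
  have "s \<noteq> 0"
  proof
    assume "s = 0"
    then have "\<forall>i<Suc n. v $ i = 0" unfolding s_def by (subst (asm) sum_nonneg_eq_0_iff) auto
    then have "v = 0\<^sub>v (Suc n)" using v(1) by (intro eq_vecI) auto
    with v show False by simp
  qed
  then have s: "s > 0" using sum_nonneg[of "{..<Suc n}" "\<lambda>i. (v $ i)\<^sup>2"] by (simp add: s_def)
  define u where "u = (1 / sqrt s) \<cdot>\<^sub>v v"
  have u: "u \<in> carrier_vec (Suc n)" using v by (simp add: u_def)
  have Au: "A *\<^sub>v u = e \<cdot>\<^sub>v u"
    using v A by (simp add: u_def mult_mat_vec smult_smult_assoc mult.commute)
  have "(\<Sum>i<Suc n. (u $ i)\<^sup>2) = (\<Sum>i<Suc n. (v $ i)\<^sup>2 / s)"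
    using v s by (intro sum.cong) (auto simp: u_def power_divide)
  also have "\<dots> = 1" using s by (simp add: s_def sum_divide_distrib[symmetric])
  finally obtain Q where Q: "Q \<in> carrier_mat (Suc n) (Suc n)" "transpose_mat Q = Q"
      "Q * Q = 1\<^sub>m (Suc n)" "col Q 0 = u"
    using householder[OF u] by auto
  define B where "B = Q * A * Q"
  have B: "B \<in> carrier_mat (Suc n) (Suc n)" using A Q by (simp add: B_def)
  have symB: "transpose_mat B = B"
  proof -
    have "transpose_mat B = transpose_mat Q * transpose_mat (Q * A)"
      unfolding B_def using A Q by (intro transpose_mult) auto
    also have "transpose_mat (Q * A) = transpose_mat A * transpose_mat Q"
      using A Q by (intro transpose_mult) auto
    also have "transpose_mat Q * (transpose_mat A * transpose_mat Q) = B"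
      using A Q unfolding B_def sym by (simp add: assoc_mult_mat[of _ "Suc n" "Suc n" _ "Suc n" _ "Suc n"])
    finally show ?thesis .
  qed
  have "col B 0 = Q * A *\<^sub>v u" using A Q unfolding B_def by (subst col_mult2) auto
  also have "\<dots> = Q *\<^sub>v (A *\<^sub>v u)" using A Q u by (simp add: assoc_mult_mat_vec)
  also have "\<dots> = e \<cdot>\<^sub>v (Q *\<^sub>v u)" using Q u by (simp add: Au mult_mat_vec)
  also have "Q *\<^sub>v u = col (Q * Q) 0" using Q by (subst col_mult2) auto
  also have "\<dots> = unit_vec (Suc n) 0" using Q by simp
  finally have colB: "col B 0 = e \<cdot>\<^sub>v unit_vec (Suc n) 0" .
  have B0: "B $$ (i,0) = (if i = 0 then e else 0)" if "i < Suc n" for i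
    using arg_cong[OF colB, of "\<lambda>x. x $ i"] that B by (auto simp: unit_vec_def)
  have B0': "B $$ (0,i) = (if i = 0 then e else 0)" if "i < Suc n" for i
    using arg_cong[OF symB, of "\<lambda>x. x $$ (i,0)"] that B B0[OF that] by (simp del: index_transpose_mat add: index_transpose_mat(1))
  define C where "C = mat n n (\<lambda>(i,j). B $$ (Suc i, Suc j))"
  have C: "C \<in> carrier_mat n n" by (simp add: C_def)
  have "B $$ (j, i) = B $$ (i,j)" if "i < Suc n" "j < Suc n" for i j
    using arg_cong[OF symB, of "\<lambda>x. x $$ (i,j)"] that B by simp
  then have "transpose_mat C = C" by (intro eq_matI) (auto simp: C_def)
  from Suc.IH[OF C this] obtain P D where P: "P \<in> carrier_mat n n" and D: "D \<in> carrier_mat n n" "diagonal_mat D"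
    and PP: "P * transpose_mat P = 1\<^sub>m n" "transpose_mat P * P = 1\<^sub>m n" and C_eq: "C = P * D * transpose_mat P" by blast
  let ?E = "mat 1 1 (\<lambda>_. e)"
  let ?P = "four_block_mat (1\<^sub>m 1) (0\<^sub>m 1 n) (0\<^sub>m n 1) P"
  let ?D = "four_block_mat ?E (0\<^sub>m 1 n) (0\<^sub>m n 1) D"
  have B_block: "B = four_block_mat ?E (0\<^sub>m 1 n) (0\<^sub>m n 1) C"
    using B by (intro eq_matI) (auto simp: B0 B0' C_def four_block_mat_def Let_def)
  have tP: "transpose_mat ?P = four_block_mat (1\<^sub>m 1) (0\<^sub>m 1 n) (0\<^sub>m n 1) (transpose_mat P)"
    using P by (subst transpose_four_block_mat[of _ 1 1 _ n _ n]) auto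
  have P1: "?P * transpose_mat ?P = 1\<^sub>m (Suc n)" "transpose_mat ?P * ?P = 1\<^sub>m (Suc n)"
    unfolding tP using P PP
    by (subst mult_four_block_mat[of _ 1 1 _ n _ n _ _ 1 _ n]; auto intro!: eq_matI)+
  have B_eq: "B = ?P * ?D * transpose_mat ?P"
    unfolding tP using P D
    by (subst mult_four_block_mat[of _ 1 1 _ n _ n _ _ 1 _ n], auto)
       (subst mult_four_block_mat[of _ 1 1 _ n _ n _ _ 1 _ n], auto simp: B_block C_eq)
  have Pc: "?P \<in> carrier_mat (Suc n) (Suc n)" using P by auto
  have Dc: "?D \<in> carrier_mat (Suc n) (Suc n)" using D by auto
  have tPc: "transpose_mat ?P \<in> carrier_mat (Suc n) (Suc n)" using Pc by simp
  have "Q * B * Q = (Q * Q) * A * (Q * Q)"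
    using Q(1) A by (simp add: B_def assoc_mult_mat[of _ "Suc n" "Suc n" _ "Suc n" _ "Suc n"])
  then have A_eq: "A = Q * B * Q" using Q A by simp
  let ?R = "Q * ?P"
  have R: "?R \<in> carrier_mat (Suc n) (Suc n)" using Q Pc by simp
  have tR: "transpose_mat ?R = transpose_mat ?P * Q"
    using Q Pc by (simp add: transpose_mult[of _ "Suc n" "Suc n" _ "Suc n"])
  note assoc = assoc_mult_mat[of _ "Suc n" "Suc n" _ "Suc n" _ "Suc n"]
  have "?R * transpose_mat ?R = Q * (?P * transpose_mat ?P) * Q"
    unfolding tR using Q(1) Pc tPc by (simp add: assoc)
  then have 1: "?R * transpose_mat ?R = 1\<^sub>m (Suc n)" using P1 Q by simp
  have "transpose_mat ?R * ?R = transpose_mat ?P * (Q * Q) * ?P"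
    unfolding tR using Q(1) Pc tPc by (simp add: assoc)
  then have 2: "transpose_mat ?R * ?R = 1\<^sub>m (Suc n)"
    unfolding Q(3) right_mult_one_mat[OF tPc] by (simp only: P1(2))
  have 3: "A = ?R * ?D * transpose_mat ?R"
    unfolding tR A_eq B_eq using Q(1) Pc tPc Dc by (simp add: assoc)
  have 4: "diagonal_mat ?D"
    using D by (auto simp: diagonal_mat_def four_block_mat_def Let_def)
  show ?case using R Dc 1 2 3 4 by blast
qed


section \<open>Spectral sums read off the Leibniz characteristic polynomial\<close>

lemma charpoly_reindex:
  assumes h: "bij_betw h {0..<n} I"
  shows "charpoly I M = char_poly (mat n n (\<lambda>(i,j). M (h i) (h j)))"
proof -
  let ?N = "mat n n (\<lambda>(i,j). M (h i) (h j))"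
  have inj: "inj_on h {0..<n}" and im: "h ` {0..<n} = I" using h by (auto simp: bij_betw_def)
  \<comment> \<open>Conjugation with \<open>h\<close> carries the permutations of
    \<open>{0..<n}\<close> bijectively to those of \<open>I\<close> and keeps signs, so the two
    Leibniz sums agree term by term.\<close>
  have "map_permutation {0..<n} h = (\<lambda>\<pi> x. if x \<in> I then h (\<pi> (inv_into {0..<n} h x)) else x)"
    by (auto simp: fun_eq_iff map_permutation_def restrict_id_def im)
  then have bij: "bij_betw (map_permutation {0..<n} h) {p. p permutes {0..<n}} {p. p permutes I}"
    using bij_betw_permutations[OF h] by simp
  have "charpoly I M = (\<Sum>p\<in>{p. p permutes {0..<n}}. of_int (sign (map_permutation {0..<n} h p)) *
      (\<Prod>i\<in>I. if map_permutation {0..<n} h p i = i then [:- M i i, 1:] else [:- M i (map_permutation {0..<n} h p i):]))"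
    unfolding charpoly_def by (rule sum.reindex_bij_betw[OF bij, symmetric])
  also have "\<dots> = (\<Sum>p\<in>{p. p permutes {0..<n}}. signof p * (\<Prod>i = 0..<n. char_poly_matrix ?N $$ (i, p i)))"
  proof (intro sum.cong refl)
    fix p assume "p \<in> {p. p permutes {0..<n}}"
    then have p: "p permutes {0..<n}" by simp
    have sg: "sign (map_permutation {0..<n} h p) = sign p"
      using p inj by (intro sign_map_permutation) auto
    have "(\<Prod>i\<in>I. if map_permutation {0..<n} h p i = i then [:- M i i, 1:] else [:- M i (map_permutation {0..<n} h p i):])
       = (\<Prod>i=0..<n. if map_permutation {0..<n} h p (h i) = h i then [:- M (h i) (h i), 1:]
             else [:- M (h i) (map_permutation {0..<n} h p (h i)):])"
      by (rule prod.reindex_bij_betw[OF h, symmetric])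
    also have "\<dots> = (\<Prod>i = 0..<n. char_poly_matrix ?N $$ (i, p i))"
    proof (intro prod.cong refl)
      fix i assume i: "i \<in> {0..<n}"
      have pi: "p i \<in> {0..<n}" using p i by (simp only: permutes_in_image)
      have 1: "map_permutation {0..<n} h p (h i) = h (p i)" by (rule map_permutation_apply[OF inj i])
      have 2: "h (p i) = h i \<longleftrightarrow> p i = i" using inj i pi by (auto dest: inj_onD)
      show "(if map_permutation {0..<n} h p (h i) = h i then [:- M (h i) (h i), 1:]
             else [:- M (h i) (map_permutation {0..<n} h p (h i)):]) = char_poly_matrix ?N $$ (i, p i)"
        unfolding 1 2 using i pi by (auto simp: char_poly_matrix_def)
    qed
    finally show "of_int (sign (map_permutation {0..<n} h p)) *
      (\<Prod>i\<in>I. if map_permutation {0..<n} h p i = i then [:- M i i, 1:] else [:- M i (map_permutation {0..<n} h p i):])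
      = signof p * (\<Prod>i = 0..<n. char_poly_matrix ?N $$ (i, p i))"
      by (simp only: sg)
  qed
  also have "\<dots> = char_poly ?N"
    unfolding char_poly_def by (subst det_def'[of _ n]) auto
  finally show ?thesis .
qed

text \<open>The order of a root z is the number of k with \<open>\<mu> k = z\<close>, so grouping
  the indices by that value absorbs the multiplicities.\<close>

lemma eig_sum_linear_factors:
  assumes I: "finite I" and cp: "charpoly I M = (\<Prod>k\<in>I. [:- \<mu> k, 1:])"
  shows "eig_sum I M F = (\<Sum>k\<in>I. F (\<mu> k))"
proof -
  have nz: "charpoly I M \<noteq> 0" using I by (simp add: cp)
  have pr: "proots (charpoly I M) = (\<Sum>k\<in>I. {#\<mu> k#})"
    unfolding cp by (subst proots_prod) auto
  have ord: "order z (charpoly I M) = card {k\<in>I. \<mu> k = z}" for z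
  proof -
    have "order z (charpoly I M) = count (\<Sum>k\<in>I. {#\<mu> k#}) z" using nz by (simp flip: pr)
    also have "\<dots> = (\<Sum>k\<in>I. if \<mu> k = z then 1 else 0)" unfolding count_sum by (intro sum.cong) auto
    finally show ?thesis using I by (simp add: sum.If_cases Int_def)
  qed
  have roots: "{z. poly (charpoly I M) z = 0} = \<mu> ` I"
    using I by (auto simp: cp poly_prod)
  have "eig_sum I M F = (\<Sum>z\<in>\<mu> ` I. \<Sum>k\<in>{k\<in>I. \<mu> k = z}. F (\<mu> k))"
    unfolding eig_sum_def roots ord by (intro sum.cong) auto
  also have "\<dots> = (\<Sum>k\<in>I. F (\<mu> k))" by (rule sum.image_gen[OF I, symmetric])
  finally show ?thesis .
qed

text \<open>\<open>u k\<close> is the eigenvector for \<open>\<mu> k\<close>. The orthogonality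
  relation summed over coordinates gives Parseval for combinations of eigenvectors, the one summed
  over \<open>k\<close> gives it for the expansion of an arbitrary vector. Indexing the eigenvectors
  by \<open>I\<close> itself lets two eigenbases be compared by a square array.\<close>

definition eigenbasis :: "'i set \<Rightarrow> ('i \<Rightarrow> 'i \<Rightarrow> real) \<Rightarrow> ('i \<Rightarrow> real) \<Rightarrow> ('i \<Rightarrow> 'i \<Rightarrow> real) \<Rightarrow> bool" where
  "eigenbasis I A \<mu> u \<longleftrightarrow> finite I \<and>
     (\<forall>k\<in>I. \<forall>l\<in>I. (\<Sum>i\<in>I. u k i * u l i) = (if k = l then 1 else 0)) \<and>
     (\<forall>i\<in>I. \<forall>j\<in>I. (\<Sum>k\<in>I. u k i * u k j) = (if i = j then 1 else 0)) \<and>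
     (\<forall>k\<in>I. \<forall>i\<in>I. (\<Sum>j\<in>I. A i j * u k j) = \<mu> k * u k i)"

text \<open>The same \<open>\<mu>\<close> diagonalizes the matrix and factors its characteristic
  polynomial, so algebraic multiplicity becomes mere repetition over the index
  \<open>k\<close>.\<close>

theorem real_symmetric_eigenbasis:
  fixes A :: "'i \<Rightarrow> 'i \<Rightarrow> real"
  assumes I: "finite I" and sym: "\<And>i j. i \<in> I \<Longrightarrow> j \<in> I \<Longrightarrow> A i j = A j i"
  obtains \<mu> u where "eigenbasis I A \<mu> u"
    "\<And>F. eig_sum I (\<lambda>i j. complex_of_real (A i j)) F = (\<Sum>k\<in>I. F (complex_of_real (\<mu> k)))"
proof -
  obtain h where h: "bij_betw h {0..<card I} I" using ex_bij_betw_nat_finite[OF I] by blast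
  define n where "n = card I"
  have h: "bij_betw h {0..<n} I" using h by (simp add: n_def)
  define g where "g = inv_into {0..<n} h"
  have g: "bij_betw g I {0..<n}" unfolding g_def by (rule bij_betw_inv_into[OF h])
  have gh: "g (h a) = a" if "a \<in> {0..<n}" for a using bij_betw_inv_into_left[OF h that] by (simp add: g_def)
  have hI: "h a \<in> I" if "a < n" for a using h that by (auto simp: bij_betw_def)
  have gI: "g i < n" if "i \<in> I" for i using g that by (auto simp: bij_betw_def)
  have ginj: "g i = g j \<longleftrightarrow> i = j" if "i \<in> I" "j \<in> I" for i j
    using g that by (auto simp: bij_betw_def dest: inj_onD)
  have hg: "h (g i) = i" if "i \<in> I" for i using bij_betw_inv_into_right[OF h that] by (simp add: g_def)
  define B where "B = mat n n (\<lambda>(a,b). A (h a) (h b))"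
  have B: "B \<in> carrier_mat n n" by (simp add: B_def)
  have "transpose_mat B = B" by (rule eq_matI) (auto simp: B_def sym hI)
  from real_symmetric_diagonalization[OF B this] obtain P D where P: "P \<in> carrier_mat n n"
    and D: "D \<in> carrier_mat n n" "diagonal_mat D" and PP: "P * transpose_mat P = 1\<^sub>m n" "transpose_mat P * P = 1\<^sub>m n"
    and B_eq: "B = P * D * transpose_mat P" by blast
  define \<mu> where "\<mu> = (\<lambda>k. D $$ (g k, g k))"
  define u where "u = (\<lambda>k i. P $$ (g i, g k))"
  have sum_g: "(\<Sum>i\<in>I. f (g i)) = (\<Sum>a<n. f a)" for f :: "nat \<Rightarrow> real"
    using sum.reindex_bij_betw[OF g, of f] by (simp add: atLeast0LessThan)
  have o1: "(\<Sum>i\<in>I. u k i * u l i) = (if k = l then 1 else 0)" if "k \<in> I" "l \<in> I" for k l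
  proof -
    have "(\<Sum>i\<in>I. u k i * u l i) = (\<Sum>a<n. P $$ (a, g k) * P $$ (a, g l))"
      unfolding u_def by (rule sum_g)
    also have "\<dots> = (transpose_mat P * P) $$ (g k, g l)"
      using P gI that by (simp add: scalar_prod_def atLeast0LessThan)
    finally show ?thesis using that gI ginj by (simp add: PP)
  qed
  have o2: "(\<Sum>k\<in>I. u k i * u k j) = (if i = j then 1 else 0)" if "i \<in> I" "j \<in> I" for i j
  proof -
    have "(\<Sum>k\<in>I. u k i * u k j) = (\<Sum>a<n. P $$ (g i, a) * P $$ (g j, a))"
      unfolding u_def by (rule sum_g)
    also have "\<dots> = (P * transpose_mat P) $$ (g i, g j)"
      using P gI that by (simp add: scalar_prod_def atLeast0LessThan)
    finally show ?thesis using that gI ginj by (simp add: PP)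
  qed
  have BP: "B * P = P * D"
  proof -
    have "B * P = P * D * (transpose_mat P * P)"
      unfolding B_eq using P D by (simp add: assoc_mult_mat[of _ n n _ n _ n])
    then show ?thesis unfolding PP using P D by simp
  qed
  have ev: "(\<Sum>j\<in>I. A i j * u k j) = \<mu> k * u k i" if "k \<in> I" "i \<in> I" for k i
  proof -
    have "(\<Sum>j\<in>I. A i j * u k j) = (\<Sum>j\<in>I. A (h (g i)) (h (g j)) * P $$ (g j, g k))"
      using that by (intro sum.cong) (auto simp: u_def hg)
    also have "\<dots> = (\<Sum>a<n. A (h (g i)) (h a) * P $$ (a, g k))" by (rule sum_g)
    also have "\<dots> = (B * P) $$ (g i, g k)"
      using P gI that by (simp add: B_def scalar_prod_def atLeast0LessThan)
    also have "\<dots> = (\<Sum>a<n. P $$ (g i, a) * D $$ (a, g k))"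
      unfolding BP using P D gI that by (simp add: scalar_prod_def atLeast0LessThan)
    also have "\<dots> = (\<Sum>a<n. if a = g k then P $$ (g i, g k) * D $$ (g k, g k) else 0)"
      using D gI that by (intro sum.cong) (auto simp: diagonal_mat_def)
    also have "\<dots> = \<mu> k * u k i" using gI that by (simp add: \<mu>_def u_def)
    finally show ?thesis .
  qed
  have "charpoly I (\<lambda>i j. complex_of_real (A i j)) = char_poly (map_mat complex_of_real B)"
    unfolding charpoly_reindex[OF h] by (rule arg_cong[of _ _ char_poly]) (auto simp: B_def)
  also have "\<dots> = map_poly complex_of_real (char_poly B)" by (rule of_real_hom.char_poly_hom[OF B])
  also have "char_poly B = char_poly D"
    using B P D PP B_eq by (intro char_poly_similar similar_matI[of _ _ P "transpose_mat P" n]) auto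
  also have "\<dots> = (\<Prod>a\<leftarrow>diag_mat D. [:- a, 1:])"
    using D by (intro char_poly_upper_triangular[of _ n]) (auto simp: upper_triangular_def diagonal_mat_def)
  also have "\<dots> = (\<Prod>a<n. [:- D $$ (a,a), 1:])"
    using D by (simp add: diag_mat_def comp_def interv_sum_list_conv_sum_set_nat prod.list_conv_set_nth atLeast0LessThan)
  also have "map_poly complex_of_real (\<Prod>a<n. [:- D $$ (a,a), 1:]) = (\<Prod>a<n. [:- complex_of_real (D $$ (a,a)), 1:])"
  proof -
    interpret mp: map_poly_comm_ring_hom complex_of_real ..
    show ?thesis by (simp add: mp.hom_prod)
  qed
  also have "\<dots> = (\<Prod>k\<in>I. [:- complex_of_real (\<mu> k), 1:])"
    using prod.reindex_bij_betw[OF g, of "\<lambda>a. [:- complex_of_real (D $$ (a,a)), 1:]"] by (simp add: \<mu>_def atLeast0LessThan)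
  finally have "eig_sum I (\<lambda>i j. complex_of_real (A i j)) F = (\<Sum>k\<in>I. F (complex_of_real (\<mu> k)))" for F
    using eig_sum_linear_factors[OF I, of "\<lambda>i j. complex_of_real (A i j)" "\<lambda>k. complex_of_real (\<mu> k)"] by simp
  moreover have "eigenbasis I A \<mu> u" using I o1 o2 ev by (simp add: eigenbasis_def)
  ultimately show thesis using that by blast
qed

section \<open>Perturbation of spectral sums\<close>

lemma parseval_real:
  fixes M :: "'i \<Rightarrow> 'i \<Rightarrow> real"
  assumes I: "finite I"
    and M: "\<And>k l. k \<in> I \<Longrightarrow> l \<in> I \<Longrightarrow> (\<Sum>i\<in>I. M k i * M l i) = (if k = l then 1 else 0)"
  shows "(\<Sum>i\<in>I. (\<Sum>k\<in>I. M k i * \<alpha> k)\<^sup>2) = (\<Sum>k\<in>I. (\<alpha> k)\<^sup>2)"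
proof -
  have "(\<Sum>i\<in>I. (\<Sum>k\<in>I. M k i * \<alpha> k)\<^sup>2) = (\<Sum>i\<in>I. \<Sum>k\<in>I. \<Sum>l\<in>I. \<alpha> k * \<alpha> l * (M k i * M l i))"
    by (simp add: power2_eq_square sum_product mult_ac)
  also have "\<dots> = (\<Sum>k\<in>I. \<Sum>l\<in>I. \<Sum>i\<in>I. \<alpha> k * \<alpha> l * (M k i * M l i))"
    by (subst sum.swap, subst (2) sum.swap) (rule refl)
  also have "\<dots> = (\<Sum>k\<in>I. \<Sum>l\<in>I. if k = l then \<alpha> k * \<alpha> l else 0)"
    by (intro sum.cong) (auto simp: sum_distrib_left[symmetric] M)
  also have "\<dots> = (\<Sum>k\<in>I. (\<alpha> k)\<^sup>2)" using I by (simp add: power2_eq_square)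
  finally show ?thesis .
qed

lemma parseval_complex:
  fixes M :: "'i \<Rightarrow> 'i \<Rightarrow> real"
  assumes I: "finite I"
    and M: "\<And>k l. k \<in> I \<Longrightarrow> l \<in> I \<Longrightarrow> (\<Sum>i\<in>I. M k i * M l i) = (if k = l then 1 else 0)"
  shows "(\<Sum>i\<in>I. (cmod (\<Sum>k\<in>I. of_real (M k i) * \<alpha> k))\<^sup>2) = (\<Sum>k\<in>I. (cmod (\<alpha> k))\<^sup>2)"
  using parseval_real[OF I M, of "\<lambda>k. Re (\<alpha> k)"] parseval_real[OF I M, of "\<lambda>k. Im (\<alpha> k)"]
  by (simp add: cmod_power2 sum.distrib)

lemma sum_swap_pairs:
  fixes F :: "'a \<Rightarrow> 'b \<Rightarrow> 'c \<Rightarrow> 'd \<Rightarrow> 'e::comm_monoid_add"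
  shows "(\<Sum>k\<in>A. \<Sum>l\<in>B. \<Sum>i\<in>C. \<Sum>j\<in>D. F k l i j) = (\<Sum>i\<in>C. \<Sum>j\<in>D. \<Sum>k\<in>A. \<Sum>l\<in>B. F k l i j)"
proof -
  have "(\<Sum>k\<in>A. \<Sum>l\<in>B. \<Sum>i\<in>C. \<Sum>j\<in>D. F k l i j) = (\<Sum>k\<in>A. \<Sum>i\<in>C. \<Sum>l\<in>B. \<Sum>j\<in>D. F k l i j)"
    by (rule sum.cong[OF refl], rule sum.swap)
  also have "\<dots> = (\<Sum>i\<in>C. \<Sum>k\<in>A. \<Sum>l\<in>B. \<Sum>j\<in>D. F k l i j)" by (rule sum.swap)
  also have "\<dots> = (\<Sum>i\<in>C. \<Sum>k\<in>A. \<Sum>j\<in>D. \<Sum>l\<in>B. F k l i j)"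
    by (rule sum.cong[OF refl], rule sum.cong[OF refl], rule sum.swap)
  also have "\<dots> = (\<Sum>i\<in>C. \<Sum>j\<in>D. \<Sum>k\<in>A. \<Sum>l\<in>B. F k l i j)"
    by (rule sum.cong[OF refl], rule sum.swap)
  finally show ?thesis .
qed

text \<open>Such kernels are bounded Schur multipliers for an elementary reason: between eigenbases
  of \<open>A\<close> and \<open>B\<close> the product \<open>a x * b y\<close> becomes the matrix
  a(A) b(B). The inductive form avoids carrying the number of summands.\<close>

inductive separable_kernel :: "(real \<Rightarrow> real \<Rightarrow> real) \<Rightarrow> bool" where
  prod: "\<lbrakk>\<And>x. \<bar>a x\<bar> \<le> K; \<And>y. \<bar>b y\<bar> \<le> L\<rbrakk> \<Longrightarrow> separable_kernel (\<lambda>x y. a x * b y)"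
| add: "\<lbrakk>separable_kernel \<Phi>; separable_kernel \<Psi>\<rbrakk> \<Longrightarrow> separable_kernel (\<lambda>x y. \<Phi> x y + \<Psi> x y)"

lemma separable_kernel_mult:
  assumes "separable_kernel \<Phi>" "\<And>x. \<bar>c x\<bar> \<le> K" "\<And>y. \<bar>d y\<bar> \<le> L"
  shows "separable_kernel (\<lambda>x y. c x * \<Phi> x y * d y)"
  using assms(1)
proof induction
  case (prod a K' b L')
  have "\<bar>c x * a x\<bar> \<le> K * K'" for x
    unfolding abs_mult using prod(1)[of x] assms(2)[of x] by (intro mult_mono) auto
  moreover have "\<bar>b y * d y\<bar> \<le> L' * L" for y
    unfolding abs_mult using prod(2)[of y] assms(3)[of y] by (intro mult_mono) auto
  ultimately have "separable_kernel (\<lambda>x y. (c x * a x) * (b y * d y))"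
    by (rule separable_kernel.prod)
  then show ?case by (simp add: mult_ac)
next
  case (add \<Phi> \<Psi>)
  then show ?case using separable_kernel.add[OF add.IH] by (simp add: algebra_simps)
qed

text \<open>For a product kernel the double sum is the bilinear product of a(A) z and b(B) z:
  \<open>x\<close> and \<open>y\<close> hold the coordinates of \<open>z\<close> in the two bases,
  \<open>\<xi>\<close> is a(A) z and \<open>\<eta>\<close> is b(B) z, and Parseval bounds both. The
  constant depends on the kernel only, not on the size of \<open>I\<close> or on the
  matrices.\<close>

lemma separable_kernel_bound:
  assumes "separable_kernel \<Phi>"
  shows "\<exists>K. (\<forall>x y. \<bar>\<Phi> x y\<bar> \<le> K) \<and>
    (\<forall>(I :: 'i set) A B \<mu> u \<nu> w z. eigenbasis I A \<mu> u \<longrightarrow> eigenbasis I B \<nu> w \<longrightarrow>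
      cmod (\<Sum>k\<in>I. \<Sum>l\<in>I. of_real (\<Phi> (\<mu> k) (\<nu> l)) * of_real (\<Sum>i\<in>I. u k i * w l i) *
         (\<Sum>i\<in>I. of_real (u k i) * z i) * (\<Sum>j\<in>I. of_real (w l j) * z j)) \<le> K * (\<Sum>i\<in>I. (cmod (z i))\<^sup>2))"
  using assms
proof induction
  case (prod a K b L)
  have K: "0 \<le> K" "0 \<le> L" using prod(1)[of 0] prod(2)[of 0] by auto
  show ?case
  proof (intro exI conjI allI impI)
    fix x y
    have "\<bar>a x * b y\<bar> \<le> K * L" unfolding abs_mult using prod K by (intro mult_mono) auto
    \<comment> \<open>The arithmetic-geometric mean inequality takes the place of Cauchy-Schwarz in
      the second conjunct; the pointwise bound is weakened to the same constant so that one constant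
      serves both.\<close>
    also have "\<dots> \<le> (K\<^sup>2 + L\<^sup>2) / 2" using sum_squares_bound[of K L] by simp
    finally show "\<bar>a x * b y\<bar> \<le> (K\<^sup>2 + L\<^sup>2) / 2" .
  next
    fix I :: "'i set" and A B \<mu> u \<nu> w and z :: "'i \<Rightarrow> complex"
    assume EA: "eigenbasis I A \<mu> u" and EB: "eigenbasis I B \<nu> w"
    then have I: "finite I" by (simp add: eigenbasis_def)
    define x where "x = (\<lambda>k. \<Sum>i\<in>I. of_real (u k i) * z i)"
    define y where "y = (\<lambda>l. \<Sum>i\<in>I. of_real (w l i) * z i)"
    define \<xi> where "\<xi> = (\<lambda>i. \<Sum>k\<in>I. of_real (u k i) * (of_real (a (\<mu> k)) * x k))"
    define \<eta> where "\<eta> = (\<lambda>i. \<Sum>l\<in>I. of_real (w l i) * (of_real (b (\<nu> l)) * y l))"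
    have nx: "(\<Sum>k\<in>I. (cmod (x k))\<^sup>2) = (\<Sum>i\<in>I. (cmod (z i))\<^sup>2)"
      unfolding x_def using EA parseval_complex[OF I, of "\<lambda>i k. u k i" z] by (simp add: eigenbasis_def)
    have ny: "(\<Sum>k\<in>I. (cmod (y k))\<^sup>2) = (\<Sum>i\<in>I. (cmod (z i))\<^sup>2)"
      unfolding y_def using EB parseval_complex[OF I, of "\<lambda>i k. w k i" z] by (simp add: eigenbasis_def)
    have "(\<Sum>i\<in>I. (cmod (\<xi> i))\<^sup>2) = (\<Sum>k\<in>I. (cmod (of_real (a (\<mu> k)) * x k))\<^sup>2)"
      unfolding \<xi>_def using EA by (intro parseval_complex[OF I]) (simp add: eigenbasis_def)
    also have "\<dots> \<le> (\<Sum>k\<in>I. K\<^sup>2 * (cmod (x k))\<^sup>2)"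
      unfolding norm_mult power_mult_distrib norm_of_real
      using K prod(1) by (intro sum_mono mult_right_mono power_mono) auto
    finally have n\<xi>: "(\<Sum>i\<in>I. (cmod (\<xi> i))\<^sup>2) \<le> K\<^sup>2 * (\<Sum>i\<in>I. (cmod (z i))\<^sup>2)"
      by (simp add: sum_distrib_left[symmetric] nx)
    have "(\<Sum>i\<in>I. (cmod (\<eta> i))\<^sup>2) = (\<Sum>k\<in>I. (cmod (of_real (b (\<nu> k)) * y k))\<^sup>2)"
      unfolding \<eta>_def using EB by (intro parseval_complex[OF I]) (simp add: eigenbasis_def)
    also have "\<dots> \<le> (\<Sum>k\<in>I. L\<^sup>2 * (cmod (y k))\<^sup>2)"
      unfolding norm_mult power_mult_distrib norm_of_real
      using K prod(2) by (intro sum_mono mult_right_mono power_mono) auto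
    finally have n\<eta>: "(\<Sum>i\<in>I. (cmod (\<eta> i))\<^sup>2) \<le> L\<^sup>2 * (\<Sum>i\<in>I. (cmod (z i))\<^sup>2)"
      by (simp add: sum_distrib_left[symmetric] ny)
    have "(\<Sum>k\<in>I. \<Sum>l\<in>I. of_real (a (\<mu> k) * b (\<nu> l)) * of_real (\<Sum>i\<in>I. u k i * w l i) * x k * y l)
        = (\<Sum>k\<in>I. \<Sum>l\<in>I. \<Sum>i\<in>I. (of_real (u k i) * (of_real (a (\<mu> k)) * x k)) * (of_real (w l i) * (of_real (b (\<nu> l)) * y l)))"
      by (simp add: sum_distrib_left sum_distrib_right mult_ac)
    also have "\<dots> = (\<Sum>i\<in>I. \<Sum>k\<in>I. \<Sum>l\<in>I. (of_real (u k i) * (of_real (a (\<mu> k)) * x k)) * (of_real (w l i) * (of_real (b (\<nu> l)) * y l)))"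
      by (subst (2) sum.swap, subst sum.swap) (rule refl)
    also have "\<dots> = (\<Sum>i\<in>I. \<xi> i * \<eta> i)" unfolding \<xi>_def \<eta>_def by (simp only: sum_product)
    also have "cmod \<dots> \<le> (\<Sum>i\<in>I. cmod (\<xi> i) * cmod (\<eta> i))"
      by (rule order_trans[OF norm_sum]) (simp add: norm_mult)
    also have "\<dots> \<le> (\<Sum>i\<in>I. ((cmod (\<xi> i))\<^sup>2 + (cmod (\<eta> i))\<^sup>2) / 2)"
      using sum_squares_bound[of "cmod (\<xi> _)" "cmod (\<eta> _)"] by (intro sum_mono) (simp add: mult_ac)
    also have "\<dots> = ((\<Sum>i\<in>I. (cmod (\<xi> i))\<^sup>2) + (\<Sum>i\<in>I. (cmod (\<eta> i))\<^sup>2)) / 2"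
      by (simp add: sum_divide_distrib[symmetric] sum.distrib)
    also have "\<dots> \<le> (K\<^sup>2 + L\<^sup>2) / 2 * (\<Sum>i\<in>I. (cmod (z i))\<^sup>2)"
      using n\<xi> n\<eta> by (simp add: algebra_simps)
    finally show "cmod (\<Sum>k\<in>I. \<Sum>l\<in>I. of_real (a (\<mu> k) * b (\<nu> l)) * of_real (\<Sum>i\<in>I. u k i * w l i) *
        (\<Sum>i\<in>I. of_real (u k i) * z i) * (\<Sum>j\<in>I. of_real (w l j) * z j))
        \<le> (K\<^sup>2 + L\<^sup>2) / 2 * (\<Sum>i\<in>I. (cmod (z i))\<^sup>2)" by (simp only: x_def y_def)
  qed
next
  case (add \<Phi> \<Psi>)
  obtain K where K: "\<forall>x y. \<bar>\<Phi> x y\<bar> \<le> K"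
    "\<forall>(I :: 'i set) A B \<mu> u \<nu> w z. eigenbasis I A \<mu> u \<longrightarrow> eigenbasis I B \<nu> w \<longrightarrow>
      cmod (\<Sum>k\<in>I. \<Sum>l\<in>I. of_real (\<Phi> (\<mu> k) (\<nu> l)) * of_real (\<Sum>i\<in>I. u k i * w l i) *
         (\<Sum>i\<in>I. of_real (u k i) * z i) * (\<Sum>j\<in>I. of_real (w l j) * z j)) \<le> K * (\<Sum>i\<in>I. (cmod (z i))\<^sup>2)"
    using add.IH(1) by blast
  obtain L where L: "\<forall>x y. \<bar>\<Psi> x y\<bar> \<le> L"
    "\<forall>(I :: 'i set) A B \<mu> u \<nu> w z. eigenbasis I A \<mu> u \<longrightarrow> eigenbasis I B \<nu> w \<longrightarrow>
      cmod (\<Sum>k\<in>I. \<Sum>l\<in>I. of_real (\<Psi> (\<mu> k) (\<nu> l)) * of_real (\<Sum>i\<in>I. u k i * w l i) *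
         (\<Sum>i\<in>I. of_real (u k i) * z i) * (\<Sum>j\<in>I. of_real (w l j) * z j)) \<le> L * (\<Sum>i\<in>I. (cmod (z i))\<^sup>2)"
    using add.IH(2) by blast
  show ?case
  proof (intro exI[of _ "K + L"] conjI allI impI)
    show "\<bar>\<Phi> x y + \<Psi> x y\<bar> \<le> K + L" for x y
      using K(1)[rule_format, of x y] L(1)[rule_format, of x y] by linarith
  next
    fix I :: "'i set" and A B \<mu> u \<nu> w and z :: "'i \<Rightarrow> complex"
    assume E: "eigenbasis I A \<mu> u" "eigenbasis I B \<nu> w"
    show "cmod (\<Sum>k\<in>I. \<Sum>l\<in>I. of_real (\<Phi> (\<mu> k) (\<nu> l) + \<Psi> (\<mu> k) (\<nu> l)) * of_real (\<Sum>i\<in>I. u k i * w l i) *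
         (\<Sum>i\<in>I. of_real (u k i) * z i) * (\<Sum>j\<in>I. of_real (w l j) * z j)) \<le> (K + L) * (\<Sum>i\<in>I. (cmod (z i))\<^sup>2)"
      unfolding of_real_add distrib_right sum.distrib
      by (rule order_trans[OF norm_triangle_ineq add_mono[OF K(2)[rule_format, OF E] L(2)[rule_format, OF E]]])
  qed
qed

text \<open>The divided difference of \<open>\<phi>\<close> has to be a separable kernel.
  Boundedness is recorded because in the Leibniz rule for a product the kernel of each factor is
  multiplied by the other function.\<close>

definition separable_quotient :: "(real \<Rightarrow> real) \<Rightarrow> bool" where
  "separable_quotient \<phi> \<longleftrightarrow> (\<exists>B. \<forall>x. \<bar>\<phi> x\<bar> \<le> B) \<and>
     (\<exists>\<Phi>. separable_kernel \<Phi> \<and> (\<forall>x y. \<phi> x - \<phi> y = (x - y) * \<Phi> x y))"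

lemma separable_quotient_const: "separable_quotient (\<lambda>x. c)"
proof -
  have "separable_kernel (\<lambda>x y. 0 * 0)"
    by (rule separable_kernel.prod[where a = "\<lambda>_. 0" and b = "\<lambda>_. 0" and K = 0 and L = 0]) auto
  then show ?thesis unfolding separable_quotient_def by (intro conjI exI[of _ "\<bar>c\<bar>"] exI[of _ "\<lambda>x y. 0"]) auto
qed

lemma separable_quotient_add:
  assumes "separable_quotient \<phi>" "separable_quotient \<psi>"
  shows "separable_quotient (\<lambda>x. \<phi> x + \<psi> x)"
proof -
  obtain B \<Phi> where 1: "\<And>x. \<bar>\<phi> x\<bar> \<le> B" "separable_kernel \<Phi>" "\<And>x y. \<phi> x - \<phi> y = (x - y) * \<Phi> x y"
    using assms(1) by (auto simp: separable_quotient_def)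
  obtain C \<Psi> where 2: "\<And>x. \<bar>\<psi> x\<bar> \<le> C" "separable_kernel \<Psi>" "\<And>x y. \<psi> x - \<psi> y = (x - y) * \<Psi> x y"
    using assms(2) by (auto simp: separable_quotient_def)
  show ?thesis unfolding separable_quotient_def
  proof (intro conjI exI allI)
    show "\<bar>\<phi> x + \<psi> x\<bar> \<le> B + C" for x using 1(1)[of x] 2(1)[of x] by linarith
    show "separable_kernel (\<lambda>x y. \<Phi> x y + \<Psi> x y)" by (intro separable_kernel.add 1 2)
    show "\<phi> x + \<psi> x - (\<phi> y + \<psi> y) = (x - y) * (\<Phi> x y + \<Psi> x y)" for x y
      using 1(3)[of x y] 2(3)[of x y] by (simp add: distrib_left)
  qed
qed

lemma separable_quotient_mult:
  assumes "separable_quotient \<phi>" "separable_quotient \<psi>"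
  shows "separable_quotient (\<lambda>x. \<phi> x * \<psi> x)"
proof -
  obtain B \<Phi> where 1: "\<And>x. \<bar>\<phi> x\<bar> \<le> B" "separable_kernel \<Phi>" "\<And>x y. \<phi> x - \<phi> y = (x - y) * \<Phi> x y"
    using assms(1) by (auto simp: separable_quotient_def)
  obtain C \<Psi> where 2: "\<And>x. \<bar>\<psi> x\<bar> \<le> C" "separable_kernel \<Psi>" "\<And>x y. \<psi> x - \<psi> y = (x - y) * \<Psi> x y"
    using assms(2) by (auto simp: separable_quotient_def)
  show ?thesis unfolding separable_quotient_def
  proof (intro conjI exI allI)
    show "\<bar>\<phi> x * \<psi> x\<bar> \<le> B * C" for x
      unfolding abs_mult using 1(1)[of x] 2(1)[of x] by (intro mult_mono) auto
    show "separable_kernel (\<lambda>x y. 1 * \<Phi> x y * \<psi> y + \<phi> x * \<Psi> x y * 1)"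
      by (intro separable_kernel.add separable_kernel_mult[OF 1(2), where K = 1 and L = C]
          separable_kernel_mult[OF 2(2), where K = B and L = 1]) (auto simp: 1 2)
    have "\<phi> x * \<psi> x - \<phi> y * \<psi> y = (\<phi> x - \<phi> y) * \<psi> y + \<phi> x * (\<psi> x - \<psi> y)" for x y
      by (simp add: algebra_simps)
    then show "\<phi> x * \<psi> x - \<phi> y * \<psi> y = (x - y) * (1 * \<Phi> x y * \<psi> y + \<phi> x * \<Psi> x y * 1)" for x y
      unfolding 1(3) 2(3) by (simp add: algebra_simps)
  qed
qed

lemma inverse_1_plus_square_bounds:
  "\<bar>1 / (1 + x\<^sup>2)\<bar> \<le> (1::real)" "\<bar>x / (1 + x\<^sup>2)\<bar> \<le> (1::real)"
proof -
  have "0 < 1 + x\<^sup>2" by (simp add: add_pos_nonneg)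
  moreover have "\<bar>x\<bar> \<le> 1 + x\<^sup>2" using sum_squares_bound[of "\<bar>x\<bar>" 1] by simp
  ultimately show "\<bar>1 / (1 + x\<^sup>2)\<bar> \<le> 1" "\<bar>x / (1 + x\<^sup>2)\<bar> \<le> 1" by simp_all
qed

text \<open>With \<open>a\<close> and \<open>b\<close> these two functions, 1 / (x + i) = b x - i a
  x. The kernels come from the imaginary and real parts of the resolvent identity 1 / (x + i) - 1 /
  (y + i) = - (x - y) / ((x + i) (y + i)).\<close>

lemma separable_quotient_generators:
  "separable_quotient (\<lambda>x. 1 / (1 + x\<^sup>2))" "separable_quotient (\<lambda>x. x / (1 + x\<^sup>2))"
proof -
  define a where "a = (\<lambda>x::real. 1 / (1 + x\<^sup>2))"
  define b where "b = (\<lambda>x::real. x / (1 + x\<^sup>2))"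
  have ab: "\<bar>a x\<bar> \<le> 1" "\<bar>b x\<bar> \<le> 1" "\<bar>- a x\<bar> \<le> 1" "\<bar>- b x\<bar> \<le> 1" for x
    unfolding abs_minus_cancel unfolding a_def b_def by (rule inverse_1_plus_square_bounds)+
  have nz: "1 + x\<^sup>2 \<noteq> 0" for x :: real by (simp add: add_nonneg_eq_0_iff)
  have "separable_kernel (\<lambda>x y. - b x * a y + - a x * b y)"
    by (intro separable_kernel.add separable_kernel.prod[where K = 1 and L = 1] ab)
  moreover have "a x - a y = (x - y) * (- b x * a y + - a x * b y)" for x y
    using nz[of x] nz[of y] by (simp add: a_def b_def divide_simps) (simp add: algebra_simps power2_eq_square)
  ultimately show "separable_quotient (\<lambda>x. 1 / (1 + x\<^sup>2))"
    unfolding separable_quotient_def a_def[symmetric] using ab by blast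
  have "separable_kernel (\<lambda>x y. a x * a y + - b x * b y)"
    by (intro separable_kernel.add separable_kernel.prod[where K = 1 and L = 1] ab)
  moreover have "b x - b y = (x - y) * (a x * a y + - b x * b y)" for x y
    using nz[of x] nz[of y] by (simp add: a_def b_def divide_simps) (simp add: algebra_simps power2_eq_square)
  ultimately show "separable_quotient (\<lambda>x. x / (1 + x\<^sup>2))"
    unfolding separable_quotient_def b_def[symmetric] using ab by blast
qed

lemma separable_quotient_continuous:
  assumes "separable_quotient \<phi>" shows "continuous_on UNIV \<phi>"
proof -
  obtain \<Phi> where \<Phi>: "separable_kernel \<Phi>" "\<And>x y. \<phi> x - \<phi> y = (x - y) * \<Phi> x y"
    using assms by (auto simp: separable_quotient_def)
  obtain K where K: "\<And>x y. \<bar>\<Phi> x y\<bar> \<le> K" using separable_kernel_bound[OF \<Phi>(1)] by blast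
  have "K-lipschitz_on UNIV \<phi>"
  proof (rule lipschitz_onI)
    show "dist (\<phi> x) (\<phi> y) \<le> K * dist x y" for x y
      using mult_right_mono[OF K[of x y], of "\<bar>x - y\<bar>"] by (simp add: dist_real_def \<Phi>(2) abs_mult mult.commute)
    show "0 \<le> K" using K[of 0 0] by linarith
  qed
  then show ?thesis by (rule lipschitz_on_continuous_on)
qed

text \<open>With \<open>s k l\<close> the inner product of \<open>u k\<close> and
  \<open>w l\<close>, the squares of \<open>s k l\<close> have row and column sums 1, so the
  difference of spectral sums is the sum of \<open>\<phi> (\<mu> k) - \<phi> (\<nu> l)\<close> with
  these weights. The divided difference extracts \<open>\<mu> k - \<nu> l\<close>, and that factor
  times \<open>s k l\<close> is an entry of \<open>A - B\<close> between the two bases; what remains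
  is the pairing of \<open>A - B\<close> with \<open>C\<close>. The last premise is a dual form of a
  trace-norm bound, phrased so that it can be checked by integrating over frequencies. The factor
  \<open>card I\<close> is the squared length of a unimodular vector.\<close>

theorem separable_quotient_perturbation:
  assumes "separable_quotient \<phi>"
  obtains K where "K \<ge> 0" "\<And>x y. \<bar>\<phi> x - \<phi> y\<bar> \<le> K * \<bar>x - y\<bar>"
    "\<And>(I :: 'i set) A B \<mu> u \<nu> w \<delta>. \<lbrakk>eigenbasis I A \<mu> u; eigenbasis I B \<nu> w;
        \<And>i j. i \<in> I \<Longrightarrow> j \<in> I \<Longrightarrow> A i j = A j i;
        \<And>C \<kappa>. (\<And>z. (\<And>i. cmod (z i) = 1) \<Longrightarrow> cmod (\<Sum>i\<in>I. \<Sum>j\<in>I. of_real (C i j) * z i * z j) \<le> \<kappa>) \<Longrightarrow>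
           \<bar>\<Sum>i\<in>I. \<Sum>j\<in>I. (A i j - B i j) * C i j\<bar> \<le> \<kappa> * \<delta>\<rbrakk> \<Longrightarrow>
      \<bar>(\<Sum>k\<in>I. \<phi> (\<mu> k)) - (\<Sum>k\<in>I. \<phi> (\<nu> k))\<bar> \<le> K * real (card I) * \<delta>"
proof -
  obtain \<Phi> where \<Phi>: "separable_kernel \<Phi>" "\<And>x y. \<phi> x - \<phi> y = (x - y) * \<Phi> x y"
    using assms by (auto simp: separable_quotient_def)
  obtain K where K: "\<And>x y. \<bar>\<Phi> x y\<bar> \<le> K"
    "\<And>(I :: 'i set) A B \<mu> u \<nu> w z. eigenbasis I A \<mu> u \<Longrightarrow> eigenbasis I B \<nu> w \<Longrightarrow>
      cmod (\<Sum>k\<in>I. \<Sum>l\<in>I. of_real (\<Phi> (\<mu> k) (\<nu> l)) * of_real (\<Sum>i\<in>I. u k i * w l i) *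
         (\<Sum>i\<in>I. of_real (u k i) * z i) * (\<Sum>j\<in>I. of_real (w l j) * z j)) \<le> K * (\<Sum>i\<in>I. (cmod (z i))\<^sup>2)"
    using separable_kernel_bound[OF \<Phi>(1), where 'i = 'i] by blast
  show thesis
  proof (rule that[of K])
    show "0 \<le> K" using K(1)[of 0 0] by linarith
    show "\<bar>\<phi> x - \<phi> y\<bar> \<le> K * \<bar>x - y\<bar>" for x y
      using mult_right_mono[OF K(1)[of x y], of "\<bar>x - y\<bar>"] by (simp add: \<Phi>(2) abs_mult mult.commute)
  next
    fix I :: "'i set" and A B \<mu> u \<nu> w \<delta>
    assume EA: "eigenbasis I A \<mu> u" and EB: "eigenbasis I B \<nu> w"
      and sym: "\<And>i j. i \<in> I \<Longrightarrow> j \<in> I \<Longrightarrow> A i j = A j i"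
      and tr: "\<And>C \<kappa>. (\<And>z. (\<And>i. cmod (z i) = 1) \<Longrightarrow> cmod (\<Sum>i\<in>I. \<Sum>j\<in>I. of_real (C i j) * z i * z j) \<le> \<kappa>) \<Longrightarrow>
           \<bar>\<Sum>i\<in>I. \<Sum>j\<in>I. (A i j - B i j) * C i j\<bar> \<le> \<kappa> * \<delta>"
    have I: "finite I" using EA by (simp add: eigenbasis_def)
    define s where "s = (\<lambda>k l. \<Sum>i\<in>I. u k i * w l i)"
    define C where "C = (\<lambda>i j. \<Sum>k\<in>I. \<Sum>l\<in>I. \<Phi> (\<mu> k) (\<nu> l) * s k l * u k i * w l j)"
    have s1: "(\<Sum>l\<in>I. (s k l)\<^sup>2) = 1" if "k \<in> I" for k
    proof -
      have "(\<Sum>l\<in>I. (s k l)\<^sup>2) = (\<Sum>i\<in>I. (u k i)\<^sup>2)"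
        using EB parseval_real[OF I, of "\<lambda>i l. w l i" "u k"] by (simp add: s_def eigenbasis_def mult.commute)
      also have "\<dots> = 1" using EA that by (simp add: eigenbasis_def power2_eq_square)
      finally show ?thesis .
    qed
    have s2: "(\<Sum>k\<in>I. (s k l)\<^sup>2) = 1" if "l \<in> I" for l
    proof -
      have "(\<Sum>k\<in>I. (s k l)\<^sup>2) = (\<Sum>i\<in>I. (w l i)\<^sup>2)"
        using EA parseval_real[OF I, of "\<lambda>i k. u k i" "w l"] by (simp add: s_def eigenbasis_def)
      also have "\<dots> = 1" using EB that by (simp add: eigenbasis_def power2_eq_square)
      finally show ?thesis .
    qed
    have D: "(\<mu> k - \<nu> l) * s k l = (\<Sum>i\<in>I. \<Sum>j\<in>I. (A i j - B i j) * u k i * w l j)" if "k \<in> I" "l \<in> I" for k l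
    proof -
      have "(\<Sum>i\<in>I. \<Sum>j\<in>I. A i j * u k i * w l j) = (\<Sum>j\<in>I. \<Sum>i\<in>I. A i j * u k i * w l j)"
        by (rule sum.swap)
      also have "\<dots> = (\<Sum>j\<in>I. w l j * (\<Sum>i\<in>I. A j i * u k i))"
        by (simp add: sum_distrib_left sym mult_ac cong: sum.cong)
      also have "\<dots> = (\<Sum>j\<in>I. \<mu> k * (u k j * w l j))"
        using EA that by (intro sum.cong) (auto simp: eigenbasis_def mult_ac)
      finally have 1: "(\<Sum>i\<in>I. \<Sum>j\<in>I. A i j * u k i * w l j) = \<mu> k * s k l"
        by (simp add: s_def sum_distrib_left)
      have "(\<Sum>i\<in>I. \<Sum>j\<in>I. B i j * u k i * w l j) = (\<Sum>i\<in>I. u k i * (\<Sum>j\<in>I. B i j * w l j))"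
        by (simp add: sum_distrib_left mult_ac)
      also have "\<dots> = (\<Sum>i\<in>I. \<nu> l * (u k i * w l i))"
        using EB that by (intro sum.cong) (auto simp: eigenbasis_def mult_ac)
      finally have "(\<Sum>i\<in>I. \<Sum>j\<in>I. B i j * u k i * w l j) = \<nu> l * s k l"
        by (simp add: s_def sum_distrib_left)
      with 1 show ?thesis by (simp add: left_diff_distrib sum_subtractf)
    qed
    have "(\<Sum>k\<in>I. \<phi> (\<mu> k)) = (\<Sum>k\<in>I. \<Sum>l\<in>I. \<phi> (\<mu> k) * (s k l)\<^sup>2)"
      by (intro sum.cong) (simp_all add: sum_distrib_left[symmetric] s1)
    moreover have "(\<Sum>l\<in>I. \<phi> (\<nu> l)) = (\<Sum>l\<in>I. \<Sum>k\<in>I. \<phi> (\<nu> l) * (s k l)\<^sup>2)"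
      by (intro sum.cong) (simp_all add: sum_distrib_left[symmetric] s2)
    moreover have "\<dots> = (\<Sum>k\<in>I. \<Sum>l\<in>I. \<phi> (\<nu> l) * (s k l)\<^sup>2)" by (rule sum.swap)
    ultimately have "(\<Sum>k\<in>I. \<phi> (\<mu> k)) - (\<Sum>k\<in>I. \<phi> (\<nu> k)) = (\<Sum>k\<in>I. \<Sum>l\<in>I. (\<phi> (\<mu> k) - \<phi> (\<nu> l)) * (s k l)\<^sup>2)"
      by (simp add: left_diff_distrib sum_subtractf)
    also have "\<dots> = (\<Sum>k\<in>I. \<Sum>l\<in>I. \<Phi> (\<mu> k) (\<nu> l) * s k l * ((\<mu> k - \<nu> l) * s k l))"
      by (simp add: \<Phi>(2) power2_eq_square mult_ac)
    also have "\<dots> = (\<Sum>k\<in>I. \<Sum>l\<in>I. \<Sum>i\<in>I. \<Sum>j\<in>I. (A i j - B i j) * (\<Phi> (\<mu> k) (\<nu> l) * s k l * u k i * w l j))"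
      by (intro sum.cong refl, subst D, assumption, assumption) (simp add: sum_distrib_left mult_ac)
    also have "\<dots> = (\<Sum>i\<in>I. \<Sum>j\<in>I. \<Sum>k\<in>I. \<Sum>l\<in>I. (A i j - B i j) * (\<Phi> (\<mu> k) (\<nu> l) * s k l * u k i * w l j))"
      by (rule sum_swap_pairs)
    also have "\<dots> = (\<Sum>i\<in>I. \<Sum>j\<in>I. (A i j - B i j) * C i j)"
      by (simp add: C_def sum_distrib_left)
    finally have eq: "(\<Sum>k\<in>I. \<phi> (\<mu> k)) - (\<Sum>k\<in>I. \<phi> (\<nu> k)) = (\<Sum>i\<in>I. \<Sum>j\<in>I. (A i j - B i j) * C i j)" .
    have "\<bar>\<Sum>i\<in>I. \<Sum>j\<in>I. (A i j - B i j) * C i j\<bar> \<le> K * real (card I) * \<delta>"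
    proof (rule tr)
      fix z :: "'i \<Rightarrow> complex" assume z: "\<And>i. cmod (z i) = 1"
      have "(\<Sum>i\<in>I. \<Sum>j\<in>I. of_real (C i j) * z i * z j)
          = (\<Sum>i\<in>I. \<Sum>j\<in>I. \<Sum>k\<in>I. \<Sum>l\<in>I. of_real (\<Phi> (\<mu> k) (\<nu> l)) * of_real (s k l) * (of_real (u k i) * z i) * (of_real (w l j) * z j))"
        by (simp add: C_def sum_distrib_left sum_distrib_right mult_ac)
      also have "\<dots> = (\<Sum>k\<in>I. \<Sum>l\<in>I. \<Sum>i\<in>I. \<Sum>j\<in>I. of_real (\<Phi> (\<mu> k) (\<nu> l)) * of_real (s k l) * (of_real (u k i) * z i) * (of_real (w l j) * z j))"
        by (rule sum_swap_pairs)
      also have "\<dots> = (\<Sum>k\<in>I. \<Sum>l\<in>I. of_real (\<Phi> (\<mu> k) (\<nu> l)) * of_real (s k l) *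
         (\<Sum>i\<in>I. of_real (u k i) * z i) * (\<Sum>j\<in>I. of_real (w l j) * z j))"
        by (intro sum.cong refl) (simp add: sum_distrib_left sum_distrib_right mult_ac)
      also have "cmod \<dots> \<le> K * (\<Sum>i\<in>I. (cmod (z i))\<^sup>2)"
        unfolding s_def by (rule K(2)[OF EA EB])
      finally show "cmod (\<Sum>i\<in>I. \<Sum>j\<in>I. of_real (C i j) * z i * z j) \<le> K * real (card I)" by (simp add: z)
    qed
    then show "\<bar>(\<Sum>k\<in>I. \<phi> (\<mu> k)) - (\<Sum>k\<in>I. \<phi> (\<nu> k))\<bar> \<le> K * real (card I) * \<delta>" by (simp only: eq)
  qed
qed

section \<open>Density of the functions with separable divided difference\<close>

lemma separable_quotient_polynomial:
  assumes "real_polynomial_function (g :: real \<times> real \<Rightarrow> real)"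
  shows "separable_quotient (\<lambda>x. g (1 / (1 + x\<^sup>2), x / (1 + x\<^sup>2)))"
  using assms
proof induction
  case (linear f)
  have "f (a, b) = a * f (1,0) + b * f (0,1)" for a b
  proof -
    interpret bounded_linear f by (rule linear)
    have "f (a, b) = f (a *\<^sub>R (1,0) + b *\<^sub>R (0,1))" by simp
    also have "\<dots> = a * f (1,0) + b * f (0,1)" by (simp only: add scaleR) simp
    finally show ?thesis .
  qed
  then have "(\<lambda>x. f (1 / (1 + x\<^sup>2), x / (1 + x\<^sup>2))) = (\<lambda>x. 1 / (1 + x\<^sup>2) * f (1,0) + x / (1 + x\<^sup>2) * f (0,1))"
    by (intro ext)
  then show ?case
    by (simp only:) (rule separable_quotient_add separable_quotient_mult separable_quotient_const separable_quotient_generators)+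
next
  case (const c)
  show ?case by (rule separable_quotient_const)
next
  case (add f g)
  show ?case by (rule separable_quotient_add[OF add.IH])
next
  case (mult f g)
  show ?case by (rule separable_quotient_mult[OF mult.IH])
qed

text \<open>The two generators map the real line onto the circle a^2 + b^2 = a without the origin,
  with inverse b / a; the origin plays the point at infinity. A compactly supported
  \<open>\<phi>\<close> therefore extends by 0 to a continuous \<open>G\<close> on the whole circle,
  and uniform approximation of \<open>G\<close> by polynomials on this compact set is uniform
  approximation of \<open>\<phi>\<close> on the whole line.\<close>

theorem separable_quotient_dense:
  fixes \<phi> :: "real \<Rightarrow> real"
  assumes cont: "continuous_on UNIV \<phi>" and supp: "\<And>x. \<bar>x\<bar> > R \<Longrightarrow> \<phi> x = 0" and e: "e > 0"
  obtains g where "separable_quotient g" "\<And>x. \<bar>\<phi> x - g x\<bar> < e"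
proof -
  define S where "S = {p::real\<times>real. (fst p)\<^sup>2 + (snd p)\<^sup>2 = fst p}"
  define G where "G = (\<lambda>p::real\<times>real. if fst p = 0 then 0 else \<phi> (snd p / fst p))"
  \<comment> \<open>On the circle (b / a)^2 = 1 / a - 1, so 0 < a \<le> \<open>\<delta>\<close>
    forces (b / a)^2 \<ge> 1 + R^2, which lies beyond the support of \<open>\<phi>\<close>.\<close>
  define \<delta> where "\<delta> = 1 / (2 + R\<^sup>2)"
  have \<delta>: "\<delta> > 0" by (simp add: \<delta>_def add_pos_nonneg)
  have clS: "closed S" unfolding S_def by (intro closed_Collect_eq continuous_intros)
  have "S \<subseteq> cball 0 1"
  proof
    fix p assume p: "p \<in> S"
    then have "(fst p)\<^sup>2 \<le> fst p" by (simp add: S_def) (metis add_le_cancel_left le_add_same_cancel1 zero_le_power2)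
    then have "fst p \<le> 1" by (cases "fst p > 0") (auto simp: power2_eq_square)
    moreover have "0 \<le> fst p" using p zero_le_power2[of "fst p"] zero_le_power2[of "snd p"]
      unfolding S_def mem_Collect_eq by linarith
    ultimately have "(norm p)\<^sup>2 \<le> 1\<^sup>2" using p by (simp add: S_def norm_prod_def)
    then show "p \<in> cball 0 1" using power2_le_imp_le[of "norm p" 1] by simp
  qed
  then have compS: "compact S" using clS by (meson bounded_cball bounded_subset compact_eq_bounded_closed)
  have "continuous_on (S \<inter> {p. fst p \<ge> \<delta>}) (\<lambda>p. \<phi> (snd p / fst p))"
    using \<delta> by (intro continuous_on_compose2[OF cont] continuous_intros) auto
  then have c1: "continuous_on (S \<inter> {p. fst p \<ge> \<delta>}) G"
    by (rule continuous_on_eq) (use \<delta> in \<open>auto simp: G_def\<close>)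
  have small: "G p = 0" if p: "p \<in> S \<inter> {p. fst p \<le> \<delta>}" for p
  proof (cases "fst p = 0")
    case False
    define a where "a = fst p"
    define b where "b = snd p"
    have ab: "a\<^sup>2 + b\<^sup>2 = a" "a \<le> \<delta>" "a \<noteq> 0" using p False by (auto simp: S_def a_def b_def)
    have a: "a > 0" using ab(1,3) zero_le_power2[of a] zero_le_power2[of b] by linarith
    have "(b / a)\<^sup>2 = 1 / a - 1" using ab a by (simp add: field_simps power2_eq_square)
    also have "1 / a \<ge> 1 / \<delta>" using a \<delta> ab by (simp add: frac_le)
    then have "1 / a - 1 > R\<^sup>2" by (simp add: \<delta>_def)
    finally have "R\<^sup>2 < \<bar>b / a\<bar>\<^sup>2" by (simp only: power2_abs)
    then have "R < \<bar>b / a\<bar>" by (rule power_less_imp_less_base) simp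
    then show ?thesis using supp[of "b / a"] by (simp add: G_def a_def b_def)
  qed (simp add: G_def)
  have c2: "continuous_on (S \<inter> {p. fst p \<le> \<delta>}) G"
    by (rule continuous_on_eq[of _ "\<lambda>_. 0"]) (use small in auto)
  have "continuous_on (S \<inter> {p. fst p \<ge> \<delta>} \<union> S \<inter> {p. fst p \<le> \<delta>}) G"
    by (intro continuous_on_closed_Un c1 c2 closed_Int clS closed_Collect_le continuous_intros)
  moreover have "S \<inter> {p. fst p \<ge> \<delta>} \<union> S \<inter> {p. fst p \<le> \<delta>} = S" by auto
  ultimately have "continuous_on S G" by simp
  then obtain g where g: "real_polynomial_function g" "\<And>p. p \<in> S \<Longrightarrow> \<bar>G p - g p\<bar> < e"
    using Stone_Weierstrass_real_polynomial_function[OF compS _ e] by blast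
  show thesis
  proof (rule that[OF separable_quotient_polynomial[OF g(1)]])
    fix x :: real
    have nz: "1 + x\<^sup>2 \<noteq> 0" by (simp add: add_nonneg_eq_0_iff)
    let ?p = "(1 / (1 + x\<^sup>2), x / (1 + x\<^sup>2))"
    have "(1 / (1 + x\<^sup>2))\<^sup>2 + (x / (1 + x\<^sup>2))\<^sup>2 = (1 + x\<^sup>2) / (1 + x\<^sup>2)\<^sup>2"
      by (simp only: power_divide add_divide_distrib power_one)
    also have "\<dots> = 1 / (1 + x\<^sup>2)" using nz by (simp add: power2_eq_square)
    finally have "?p \<in> S" by (simp add: S_def)
    moreover have "G ?p = \<phi> x" using nz by (simp add: G_def)
    ultimately show "\<bar>\<phi> x - g ?p\<bar> < e" using g(2)[of ?p] by simp
  qed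
qed

section \<open>Trigonometric polynomials\<close>

no_notation vec_index (infixl \<open>$\<close> 100)
no_notation scalar_prod (infix \<open>\<bullet>\<close> 70)
notation vec_nth (infixl \<open>$\<close> 90)
notation inner (infix \<open>\<bullet>\<close> 70)

definition trig_exp :: "('d::finite \<Rightarrow> int) \<Rightarrow> real ^ 'd \<Rightarrow> complex" where
  "trig_exp k \<theta> = exp (\<i> * of_real (\<Sum>l\<in>UNIV. of_int (k l) * \<theta> $ l))"

lemma trig_exp_add: "trig_exp (\<lambda>l. j l + k l) \<theta> = trig_exp j \<theta> * trig_exp k \<theta>"
  by (simp add: trig_exp_def exp_add[symmetric] algebra_simps sum.distrib)

lemma norm_trig_exp [simp]: "norm (trig_exp k \<theta>) = 1"
  by (simp add: trig_exp_def)

lemma trig_exp_0 [simp]: "trig_exp (\<lambda>l. 0) \<theta> = 1"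
  by (simp add: trig_exp_def)

lemma trig_exp_reflect: "trig_exp k (- \<theta>) = cnj (trig_exp k \<theta>)"
  by (simp add: trig_exp_def exp_cnj sum_negf)

lemma trig_exp_uminus: "trig_exp (\<lambda>l. - k l) \<theta> = cnj (trig_exp k \<theta>)"
  by (simp add: trig_exp_def exp_cnj sum_negf)

lemma continuous_trig_exp [continuous_intros]: "continuous_on S (trig_exp k)"
  unfolding trig_exp_def by (intro continuous_intros)

section \<open>Integration over the frequency box\<close>

abbreviation box_measure :: "(real ^ 'd::finite) measure" where
  "box_measure \<equiv> lebesgue_on pibox"

lemma pibox_lebesgue [simp]: "pibox \<in> sets lebesgue"
  by (simp add: pibox_def)

lemma compact_pibox: "compact pibox" by (simp add: pibox_def)

lemma mem_pibox: "\<theta> \<in> pibox \<longleftrightarrow> (\<forall>l. \<bar>\<theta> $ l\<bar> \<le> pi)"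
  by (auto simp: pibox_def mem_box_cart abs_le_iff) (metis minus_le_iff)+

lemma measure_pibox: "measure lebesgue (pibox :: (real ^ 'd::finite) set) = (2 * pi) ^ CARD('d)"
proof -
  have "cbox (- (\<chi> l. pi)) (\<chi> l. pi) \<noteq> ({} :: (real ^ 'd) set)"
    by (auto simp: interval_eq_empty_cart)
  then show ?thesis by (simp add: pibox_def content_cbox_cart)
qed

lemma space_box_measure [simp]: "space box_measure = pibox"
  by (simp add: space_restrict_space)

lemma finite_measure_box: "finite_measure (box_measure :: (real ^ 'd::finite) measure)"
  unfolding pibox_def by (rule finite_measureI) (simp add: emeasure_restrict_space emeasure_lborel_cbox_eq)

lemma measure_box_measure: "measure (box_measure :: (real ^ 'd::finite) measure) pibox = (2 * pi) ^ CARD('d)"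
  by (simp add: measure_restrict_space measure_pibox)

lemma integrable_box_continuous:
  fixes g :: "real ^ 'd::finite \<Rightarrow> 'b::euclidean_space"
  assumes "continuous_on pibox g"
  shows "integrable box_measure g"
  using assms unfolding pibox_def
  by (intro absolutely_integrable_imp_integrable absolutely_integrable_continuous) auto

lemma integrable_box_mult_continuous:
  fixes f g :: "real ^ 'd::finite \<Rightarrow> complex"
  assumes f: "integrable box_measure f" and g: "continuous_on pibox g"
  shows "integrable box_measure (\<lambda>\<theta>. f \<theta> * g \<theta>)"
proof -
  obtain B where B: "\<And>\<theta>. \<theta> \<in> pibox \<Longrightarrow> norm (g \<theta>) \<le> B"
    using compact_imp_bounded[OF compact_continuous_image[OF g compact_pibox]] by (auto simp: bounded_iff)
  have "integrable box_measure (\<lambda>\<theta>. norm (f \<theta>) * B)" using f by simp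
  then show ?thesis
  proof (rule Bochner_Integration.integrable_bound)
    show "(\<lambda>\<theta>. f \<theta> * g \<theta>) \<in> borel_measurable box_measure"
      using f borel_measurable_integrable[OF integrable_box_continuous[OF g]] by simp
    have "norm (f \<theta> * g \<theta>) \<le> norm (norm (f \<theta>) * B)" if "\<theta> \<in> pibox" for \<theta>
      unfolding norm_mult using B[OF that] by (intro mult_mono) auto
    then show "AE \<theta> in box_measure. norm (f \<theta> * g \<theta>) \<le> norm (norm (f \<theta>) * B)"
      by (intro AE_I2) simp
  qed
qed

text \<open>The coefficients are defined by a gauge integral; for integrable \<open>f\<close> this
  passes to the Lebesgue integral, the form needed for norm bounds and uniqueness.\<close>

lemma fourier_coeff_lebesgue:
  fixes f :: "real ^ 'd::finite \<Rightarrow> complex"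
  assumes "integrable box_measure f"
  shows "fourier_coeff f k = (\<integral>\<theta>. f \<theta> * trig_exp (\<lambda>l. - k l) \<theta> \<partial>box_measure) / of_real ((2 * pi) ^ CARD('d))"
proof -
  have "integrable box_measure (\<lambda>\<theta>. f \<theta> * trig_exp (\<lambda>l. - k l) \<theta>)"
    by (intro integrable_box_mult_continuous assms continuous_intros)
  then have "(\<integral>\<theta>. f \<theta> * trig_exp (\<lambda>l. - k l) \<theta> \<partial>box_measure) = integral pibox (\<lambda>\<theta>. f \<theta> * trig_exp (\<lambda>l. - k l) \<theta>)"
    by (intro lebesgue_integral_eq_integral) auto
  then show ?thesis by (simp add: fourier_coeff_def trig_exp_def sum_negf)
qed

text \<open>Along a coordinate \<open>l\<close> with \<open>k l\<close> nonzero, a shift by half a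
  period changes the sign of \<open>trig_exp k\<close>, while the part pushed out of the box
  re-enters by 2 pi periodicity. The integral thus equals its own negative, without iterated
  integration.\<close>

lemma integral_trig_exp:
  fixes k :: "'d::finite \<Rightarrow> int"
  shows "(\<integral>\<theta>. trig_exp k \<theta> \<partial>box_measure) = (if k = (\<lambda>l. 0) then of_real ((2 * pi) ^ CARD('d)) else 0)"
proof (cases "k = (\<lambda>l. 0)")
  case True
  then show ?thesis by (simp add: measure_box_measure scaleR_conv_of_real)
next
  case False
  then obtain l where l: "k l \<noteq> 0" by auto
  \<comment> \<open>The box whose side in direction \<open>l\<close> is [p, q] and whose other sides
    are full.\<close>
  define cb where "cb = (\<lambda>p q. cbox (\<chi> j. if j = l then p else - pi) (\<chi> j::'d. if j = l then q else pi))"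
  have cb_pibox: "cb (- pi) pi = pibox"
    by (auto simp: cb_def mem_pibox mem_box_cart abs_le_iff minus_le_iff)
  have F: "trig_exp k integrable_on cb p q" for p q
    unfolding cb_def by (intro integrable_continuous continuous_intros)
  have split: "integral (cb p q) (trig_exp k) = integral (cb p c) (trig_exp k) + integral (cb c q) (trig_exp k)"
    if "p \<le> c" "c \<le> q" for p c q
  proof -
    have ax: "x \<bullet> axis l 1 = x $ l" for x :: "real ^ 'd" by (simp add: inner_axis)
    have 1: "cb p q \<inter> {x. x \<bullet> axis l 1 \<le> c} = cb p c"
      using that by (fastforce simp: cb_def mem_box_cart ax split: if_splits)
    have 2: "cb p q \<inter> {x. x \<bullet> axis l 1 \<ge> c} = cb c q"
      using that by (fastforce simp: cb_def mem_box_cart ax split: if_splits)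
    show ?thesis
      using integral_split[of "trig_exp k" _ _ "axis l 1" c, OF F[of p q, unfolded cb_def]]
      unfolding 1[unfolded cb_def] 2[unfolded cb_def] by (simp add: axis_in_Basis_iff cb_def)
  qed
  have shift: "integral (cb p q) (\<lambda>x. trig_exp k (x + s *\<^sub>R axis l 1)) = integral (cb (p + s) (q + s)) (trig_exp k)" for p q s
  proof -
    have "(\<chi> j. if j = l then p else - pi) = (\<chi> j. if j = l then p + s else - pi) - s *\<^sub>R axis l 1"
      "(\<chi> j. if j = l then q else pi) = (\<chi> j. if j = l then q + s else pi) - s *\<^sub>R axis l (1::real)"
      by (auto simp: Finite_Cartesian_Product.vec_eq_iff axis_def)
    then show ?thesis unfolding cb_def by (simp only: integral_shift_cbox)
  qed
  have te: "trig_exp k (x + s *\<^sub>R axis l 1) = exp (\<i> * of_real (of_int (k l) * s)) * trig_exp k x" for x s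
  proof -
    have "(\<Sum>j\<in>UNIV. of_int (k j) * (x + s *\<^sub>R axis l 1) $ j)
        = (\<Sum>j\<in>UNIV. of_int (k j) * x $ j + (if j = l then of_int (k l) * s else 0))"
      by (intro sum.cong) (auto simp: axis_def algebra_simps)
    then show ?thesis unfolding trig_exp_def
      by (simp add: sum.distrib algebra_simps exp_add[symmetric])
  qed
  \<comment> \<open>Half a period in direction \<open>l\<close>. As \<open>k l\<close> is a nonzero
    integer, it lies between 0 and pi, so the slab leaving the box is narrower than the box.\<close>
  define s where "s = pi / \<bar>of_int (k l)\<bar>"
  have s: "0 \<le> s" "s \<le> pi"
  proof -
    have "1 \<le> \<bar>of_int (k l) :: real\<bar>" using l by linarith
    then show "0 \<le> s" "s \<le> pi" by (auto simp: s_def divide_le_eq)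
  qed
  have "of_int (k l) * s = pi \<or> of_int (k l) * s = - pi" using l by (auto simp: s_def abs_if)
  then have e1: "exp (\<i> * of_real (of_int (k l) * s)) = - 1"
    by (auto simp: exp_Euler simp flip: of_real_mult)
  have e2: "exp (\<i> * of_real (of_int (k l) * (2 * pi))) = 1"
    using exp_integer_2pi[of "of_int (k l)"] by (simp add: mult_ac)
  define J where "J = integral pibox (trig_exp k)"
  have "- J = integral (cb (- pi) pi) (\<lambda>x. trig_exp k (x + s *\<^sub>R axis l 1))"
    unfolding te e1 J_def cb_pibox by simp
  also have "\<dots> = integral (cb (s - pi) (pi + s)) (trig_exp k)" by (simp only: shift) (simp add: add.commute)
  also have "\<dots> = integral (cb (s - pi) pi) (trig_exp k) + integral (cb pi (pi + s)) (trig_exp k)"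
    using s by (intro split) auto
  also have "integral (cb pi (pi + s)) (trig_exp k) = integral (cb (- pi) (s - pi)) (\<lambda>x. trig_exp k (x + (2 * pi) *\<^sub>R axis l 1))"
    by (simp only: shift) (simp add: add.commute)
  also have "\<dots> = integral (cb (- pi) (s - pi)) (trig_exp k)" unfolding te e2 by simp
  also have "integral (cb (s - pi) pi) (trig_exp k) + \<dots> = J"
    unfolding J_def cb_pibox[symmetric] by (subst split[of "- pi" "s - pi" pi]) (use s in auto)
  finally have "J = 0" by simp
  moreover have "(\<integral>\<theta>. trig_exp k \<theta> \<partial>box_measure) = J"
    unfolding J_def by (intro lebesgue_integral_eq_integral integrable_box_continuous continuous_intros) auto
  ultimately show ?thesis using False by simp
qed

lemma box_measure_reflect:
  fixes g :: "real ^ 'd::finite \<Rightarrow> 'b::euclidean_space"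
  assumes "integrable box_measure g"
  shows "integrable box_measure (\<lambda>\<theta>. g (- \<theta>))" "(\<integral>\<theta>. g (- \<theta>) \<partial>box_measure) = (\<integral>\<theta>. g \<theta> \<partial>box_measure)"
proof -
  have abs: "g absolutely_integrable_on pibox"
    using assms by (simp add: integrable_restrict_space set_integrable_def)
  then have "(\<lambda>\<theta>. g (- \<theta>)) absolutely_integrable_on pibox"
    using integrable_reflect[of g "\<chi> l. pi" "- (\<chi> l. pi)"]
      integrable_reflect[of "\<lambda>\<theta>. norm (g \<theta>)" "\<chi> l. pi" "- (\<chi> l. pi)"]
    unfolding absolutely_integrable_on_def pibox_def by simp
  then show int: "integrable box_measure (\<lambda>\<theta>. g (- \<theta>))"
    by (intro absolutely_integrable_imp_integrable) auto
  have "integral pibox (\<lambda>\<theta>. g (- \<theta>)) = integral pibox g"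
    using integral_reflect[of "\<chi> l. pi" "- (\<chi> l. pi)" g] by (simp add: pibox_def)
  then show "(\<integral>\<theta>. g (- \<theta>) \<partial>box_measure) = (\<integral>\<theta>. g \<theta> \<partial>box_measure)"
    using int assms by (simp add: lebesgue_integral_eq_integral)
qed


section \<open>The algebra of trigonometric polynomials and its uniform closure\<close>

inductive trig_poly :: "(real ^ 'd::finite \<Rightarrow> complex) \<Rightarrow> bool" where
  exp: "trig_poly (\<lambda>\<theta>. c * trig_exp k \<theta>)"
| add: "\<lbrakk>trig_poly p; trig_poly q\<rbrakk> \<Longrightarrow> trig_poly (\<lambda>\<theta>. p \<theta> + q \<theta>)"

lemma trig_poly_const: "trig_poly (\<lambda>\<theta>. c)"
  using trig_poly.exp[of c "\<lambda>l. 0"] by simp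

lemma trig_poly_mult_exp: "trig_poly p \<Longrightarrow> trig_poly (\<lambda>\<theta>. c * trig_exp k \<theta> * p \<theta>)"
proof (induction rule: trig_poly.induct)
  case (exp c' k')
  show ?case using trig_poly.exp[of "c * c'" "\<lambda>l. k l + k' l"] by (simp add: trig_exp_add mult_ac)
next
  case (add p q)
  then show ?case using trig_poly.add[OF add.IH] by (simp add: distrib_left)
qed

lemma trig_poly_mult: "trig_poly p \<Longrightarrow> trig_poly q \<Longrightarrow> trig_poly (\<lambda>\<theta>. p \<theta> * q \<theta>)"
proof (induction rule: trig_poly.induct)
  case (exp c k)
  then show ?case by (rule trig_poly_mult_exp)
next
  case (add p p')
  then show ?case using trig_poly.add[OF add.IH(1) add.IH(2)] by (simp add: distrib_right)
qed

lemma trig_poly_cmult: "trig_poly p \<Longrightarrow> trig_poly (\<lambda>\<theta>. c * p \<theta>)"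
  by (rule trig_poly_mult[OF trig_poly_const])

lemma trig_poly_sum:
  "finite A \<Longrightarrow> (\<And>a. a \<in> A \<Longrightarrow> trig_poly (p a)) \<Longrightarrow> trig_poly (\<lambda>\<theta>. \<Sum>a\<in>A. p a \<theta>)"
  by (induction A rule: finite_induct) (auto intro: trig_poly_const trig_poly.add)

lemma trig_poly_cis: "trig_poly (\<lambda>\<theta>. cis (\<theta> $ l))" "trig_poly (\<lambda>\<theta>. cnj (cis (\<theta> $ l)))"
proof -
  have "(\<Sum>j\<in>UNIV. of_int (if j = l then 1 else 0) * \<theta> $ j) = \<theta> $ l" for \<theta> :: "real ^ 'a"
    by (simp add: if_distrib if_distribR cong: if_cong)
  then have *: "trig_exp (\<lambda>j. if j = l then 1 else 0) \<theta> = cis (\<theta> $ l)" for \<theta> :: "real ^ 'a"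
    by (simp add: trig_exp_def cis_conv_exp)
  then show "trig_poly (\<lambda>\<theta>. cis (\<theta> $ l))"
    using trig_poly.exp[of 1 "\<lambda>j. if j = l then 1 else 0"] by simp
  show "trig_poly (\<lambda>\<theta>. cnj (cis (\<theta> $ l)))"
    using trig_poly.exp[of 1 "\<lambda>j. - (if j = l then 1 else 0)"] by (simp only: trig_exp_uminus * mult_1)
qed

lemma trig_poly_cos_sin:
  "trig_poly (\<lambda>\<theta>. of_real (cos (\<theta> $ l)))" "trig_poly (\<lambda>\<theta>. of_real (sin (\<theta> $ l)))"
proof -
  have "trig_poly (\<lambda>\<theta>. 1/2 * (cis (\<theta> $ l) + cnj (cis (\<theta> $ l))))"
    by (intro trig_poly_cmult trig_poly.add trig_poly_cis)
  moreover have "1/2 * (cis x + cnj (cis x)) = of_real (cos x)" for x by (simp add: complex_eq_iff)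
  ultimately show "trig_poly (\<lambda>\<theta>. of_real (cos (\<theta> $ l)))" by simp
  have "trig_poly (\<lambda>\<theta>. (- \<i>/2) * (cis (\<theta> $ l) + (-1) * cnj (cis (\<theta> $ l))))"
    by (intro trig_poly_cmult trig_poly.add trig_poly_cis)
  moreover have "(- \<i>/2) * (cis x + (-1) * cnj (cis x)) = of_real (sin x)" for x by (simp add: complex_eq_iff)
  ultimately show "trig_poly (\<lambda>\<theta>. of_real (sin (\<theta> $ l)))" by simp
qed

lemma trig_poly_normal_form:
  "trig_poly p \<Longrightarrow> \<exists>K c. finite K \<and> p = (\<lambda>\<theta>. \<Sum>k\<in>K. c k * trig_exp k \<theta>)"
proof (induction rule: trig_poly.induct)
  case (exp c k)
  show ?case by (intro exI[of _ "{k}"] exI[of _ "\<lambda>_. c"]) auto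
next
  case (add p q)
  obtain K c L d where K: "finite K" "p = (\<lambda>\<theta>. \<Sum>k\<in>K. c k * trig_exp k \<theta>)"
    and L: "finite L" "q = (\<lambda>\<theta>. \<Sum>k\<in>L. d k * trig_exp k \<theta>)" using add.IH by blast
  define b where "b = (\<lambda>k. (if k \<in> K then c k else 0) + (if k \<in> L then d k else 0))"
  have "(\<Sum>k\<in>K \<union> L. b k * trig_exp k \<theta>) = p \<theta> + q \<theta>" for \<theta>
  proof -
    have "(\<Sum>k\<in>K \<union> L. b k * trig_exp k \<theta>)
      = (\<Sum>k\<in>K \<union> L. (if k \<in> K then c k else 0) * trig_exp k \<theta>) + (\<Sum>k\<in>K \<union> L. (if k \<in> L then d k else 0) * trig_exp k \<theta>)"
      by (simp add: b_def distrib_right sum.distrib)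
    also have "(\<Sum>k\<in>K \<union> L. (if k \<in> K then c k else 0) * trig_exp k \<theta>) = p \<theta>"
      unfolding K(2) using K(1) L(1) by (intro sum.mono_neutral_cong_right) auto
    also have "(\<Sum>k\<in>K \<union> L. (if k \<in> L then d k else 0) * trig_exp k \<theta>) = q \<theta>"
      unfolding L(2) using K(1) L(1) by (intro sum.mono_neutral_cong_right) auto
    finally show ?thesis .
  qed
  then show ?case using K(1) L(1) by (intro exI[of _ "K \<union> L"] exI[of _ b]) auto
qed

lemma trig_poly_continuous: "trig_poly p \<Longrightarrow> continuous_on S p"
  by (induction rule: trig_poly.induct) (auto intro!: continuous_intros)

text \<open>A real linear functional on \<open>complex ^ 'd\<close> combines real and imaginary
  parts of the coordinates, which become cosines and sines on the torus.\<close>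

lemma trig_poly_torus_polynomial:
  assumes "real_polynomial_function (g :: complex ^ 'd::finite \<Rightarrow> real)"
  shows "trig_poly (\<lambda>\<theta>. of_real (g (\<chi> l. cis (\<theta> $ l))))"
  using assms
proof induction
  case (linear f)
  interpret bounded_linear f by (rule linear)
  have "f (\<chi> l. cis (\<theta> $ l)) = (\<Sum>l\<in>UNIV. cos (\<theta> $ l) * f (axis l 1) + sin (\<theta> $ l) * f (axis l \<i>))" for \<theta> :: "real ^ 'd"
  proof -
    have "(\<chi> l. cis (\<theta> $ l)) = (\<Sum>l\<in>UNIV. cos (\<theta> $ l) *\<^sub>R axis l 1 + sin (\<theta> $ l) *\<^sub>R axis l \<i>)"
      by (simp add: Finite_Cartesian_Product.vec_eq_iff axis_def complex_eq_iff if_distrib if_distribR sum.distrib cong: if_cong)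
    then show ?thesis by (simp only: sum add scaleR) simp
  qed
  moreover have "trig_poly (\<lambda>\<theta>. \<Sum>l\<in>UNIV. of_real (cos (\<theta> $ l)) * of_real (f (axis l 1)) + of_real (sin (\<theta> $ l)) * of_real (f (axis l \<i>)))"
    by (intro trig_poly_sum trig_poly.add trig_poly_mult trig_poly_cos_sin trig_poly_const finite)
  ultimately show ?case by simp
next
  case (const c)
  show ?case by (rule trig_poly_const)
next
  case (add f g)
  then show ?case using trig_poly.add[OF add.IH] by simp
next
  case (mult f g)
  then show ?case using trig_poly_mult[OF mult.IH] by simp
qed

text \<open>The map \<open>P\<close> onto the torus identifies only boundary points of the box,
  where \<open>\<psi>\<close> vanishes. So \<open>\<psi>\<close> factors through the compact image
  as \<open>G\<close>, and Stone-Weierstrass applies there.\<close>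

lemma trig_poly_uniformly_dense_real:
  fixes \<psi> :: "real ^ 'd::finite \<Rightarrow> real"
  assumes cont: "continuous_on pibox \<psi>" and bd: "\<And>\<theta> l. \<theta> \<in> pibox \<Longrightarrow> \<bar>\<theta> $ l\<bar> = pi \<Longrightarrow> \<psi> \<theta> = 0" and e: "e > 0"
  shows "\<exists>q. trig_poly q \<and> (\<forall>\<theta>\<in>pibox. cmod (of_real (\<psi> \<theta>) - q \<theta>) < e)"
proof -
  define P where "P = (\<lambda>\<theta> :: real ^ 'd. (\<chi> l. cis (\<theta> $ l)))"
  define G where "G = (\<lambda>z. \<psi> (inv_into pibox P z))"
  have inj: "\<psi> \<theta> = \<psi> \<theta>'" if "\<theta> \<in> pibox" "\<theta>' \<in> pibox" "P \<theta> = P \<theta>'" for \<theta> \<theta>'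
  \<comment> \<open>If one point lies on the boundary, equal cosines put the other on the boundary
    in the same coordinate and both values are 0; otherwise the argument of each component recovers
    the point.\<close>
  proof (cases "\<exists>l. \<bar>\<theta> $ l\<bar> = pi \<or> \<bar>\<theta>' $ l\<bar> = pi")
    case True
    then obtain l where l: "\<bar>\<theta> $ l\<bar> = pi \<or> \<bar>\<theta>' $ l\<bar> = pi" by blast
    have c: "cos (\<theta> $ l) = cos (\<theta>' $ l)"
      using arg_cong[OF that(3), of "\<lambda>z. Re (z $ l)"] by (simp add: P_def)
    have "cos \<bar>\<theta> $ l\<bar> = cos \<bar>\<theta>' $ l\<bar>" using c by simp
    then have "\<bar>\<theta> $ l\<bar> = \<bar>\<theta>' $ l\<bar>"
      using that(1,2) cos_inj_pi[of "\<bar>\<theta> $ l\<bar>" "\<bar>\<theta>' $ l\<bar>"] by (auto simp: mem_pibox)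
    with l bd[OF that(1), of l] bd[OF that(2), of l] show ?thesis by auto
  next
    case False
    have "\<theta> $ l = \<theta>' $ l" for l
    proof -
      have eq: "cis (\<theta> $ l) = cis (\<theta>' $ l)"
        using arg_cong[OF that(3), of "\<lambda>z. z $ l"] by (simp add: P_def)
      have "\<bar>\<theta> $ l\<bar> < pi" "\<bar>\<theta>' $ l\<bar> < pi" using False that(1,2) by (auto simp: mem_pibox less_le)
      then have "Arg (cis (\<theta> $ l)) = \<theta> $ l" "Arg (cis (\<theta>' $ l)) = \<theta>' $ l" by (auto intro!: Arg_cis)
      with eq show ?thesis by metis
    qed
    then have "\<theta> = \<theta>'" by (simp add: Finite_Cartesian_Product.vec_eq_iff)
    then show ?thesis by simp
  qed
  have GP: "G (P \<theta>) = \<psi> \<theta>" if "\<theta> \<in> pibox" for \<theta>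
    unfolding G_def using that by (intro inj) (auto intro: inv_into_into f_inv_into_f)
  have contP: "continuous_on pibox P" unfolding P_def
    by (intro continuous_on_vec_lambda) (auto simp: cis_conv_exp intro!: continuous_intros)
  have compS: "compact (P ` pibox)" by (rule compact_continuous_image[OF contP compact_pibox])
  \<comment> \<open>\<open>P\<close> is closed on the compact box: the preimage of a closed set
    under \<open>G\<close> is the image under \<open>P\<close> of a compact set.\<close>
  have "continuous_on (P ` pibox) G"
    unfolding continuous_on_closed_vimage[OF compact_imp_closed[OF compS]]
  proof (intro allI impI)
    fix B :: "real set" assume B: "closed B"
    have "G -` B \<inter> P ` pibox = P ` (\<psi> -` B \<inter> pibox)" using GP by auto
    moreover have "closed (\<psi> -` B \<inter> pibox)"
      using B cont continuous_on_closed_vimage[OF compact_imp_closed[OF compact_pibox]] by blast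
    then have "compact (\<psi> -` B \<inter> pibox)" using compact_pibox by (metis closed_Int_compact inf.idem inf.assoc)
    then have "compact (P ` (\<psi> -` B \<inter> pibox))"
      by (intro compact_continuous_image continuous_on_subset[OF contP]) auto
    ultimately show "closed (G -` B \<inter> P ` pibox)" using compact_imp_closed by simp
  qed
  then obtain g where g: "real_polynomial_function g" "\<And>z. z \<in> P ` pibox \<Longrightarrow> \<bar>G z - g z\<bar> < e"
    using Stone_Weierstrass_real_polynomial_function[OF compS _ e] by blast
  show ?thesis
  proof (intro exI conjI ballI)
    show "trig_poly (\<lambda>\<theta>. of_real (g (P \<theta>)))" unfolding P_def by (rule trig_poly_torus_polynomial[OF g(1)])
    show "cmod (of_real (\<psi> \<theta>) - of_real (g (P \<theta>))) < e" if "\<theta> \<in> pibox" for \<theta>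
      using g(2)[of "P \<theta>"] GP[OF that] that by (simp flip: of_real_diff)
  qed
qed

lemma trig_poly_uniformly_dense:
  fixes \<psi> :: "real ^ 'd::finite \<Rightarrow> complex"
  assumes cont: "continuous_on pibox \<psi>" and bd: "\<And>\<theta> l. \<theta> \<in> pibox \<Longrightarrow> \<bar>\<theta> $ l\<bar> = pi \<Longrightarrow> \<psi> \<theta> = 0" and e: "e > 0"
  obtains q where "trig_poly q" "\<And>\<theta>. \<theta> \<in> pibox \<Longrightarrow> cmod (\<psi> \<theta> - q \<theta>) < e"
proof -
  have e2: "e / 2 > 0" using e by simp
  obtain q where q: "trig_poly q" "\<forall>\<theta>\<in>pibox. cmod (of_real (Re (\<psi> \<theta>)) - q \<theta>) < e / 2"
    using trig_poly_uniformly_dense_real[of "\<lambda>\<theta>. Re (\<psi> \<theta>)", OF _ _ e2] cont bd by (auto intro!: continuous_intros)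
  obtain r where r: "trig_poly r" "\<forall>\<theta>\<in>pibox. cmod (of_real (Im (\<psi> \<theta>)) - r \<theta>) < e / 2"
    using trig_poly_uniformly_dense_real[of "\<lambda>\<theta>. Im (\<psi> \<theta>)", OF _ _ e2] cont bd by (auto intro!: continuous_intros)
  show thesis
  proof (rule that)
    show "trig_poly (\<lambda>\<theta>. q \<theta> + \<i> * r \<theta>)" by (intro trig_poly.add trig_poly_cmult q r)
    fix \<theta> :: "real ^ 'd" assume \<theta>: "\<theta> \<in> pibox"
    have "\<psi> \<theta> - (q \<theta> + \<i> * r \<theta>) = (of_real (Re (\<psi> \<theta>)) - q \<theta>) + \<i> * (of_real (Im (\<psi> \<theta>)) - r \<theta>)"
      by (simp add: complex_eq_iff)
    also have "cmod \<dots> \<le> cmod (of_real (Re (\<psi> \<theta>)) - q \<theta>) + cmod (of_real (Im (\<psi> \<theta>)) - r \<theta>)"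
      by (rule norm_triangle_le) (simp add: norm_mult)
    also have "\<dots> < e" using q(2) r(2) \<theta> by (smt (verit) field_sum_of_halves)
    finally show "cmod (\<psi> \<theta> - (q \<theta> + \<i> * r \<theta>)) < e" .
  qed
qed

section \<open>Density in \<open>L\<^sup>1\<close> and uniqueness of Fourier coefficients\<close>

lemma AE_box_interior:
  "AE \<theta> in (box_measure :: (real ^ 'd::finite) measure). \<forall>l. \<bar>\<theta> $ l\<bar> < pi"
proof -
  let ?N = "cbox (- (\<chi> l. pi)) (\<chi> l. pi) - box (- (\<chi> l. pi)) (\<chi> l. pi) :: (real ^ 'd) set"
  have "?N \<in> null_sets lebesgue"
    using negligible_frontier_interval negligible_iff_null_sets by blast
  then have "AE \<theta> in lebesgue. \<theta> \<notin> ?N" by (rule AE_not_in)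
  then have "AE \<theta> in lebesgue. \<theta> \<in> (pibox :: (real ^ 'd) set) \<longrightarrow> (\<forall>l. \<bar>\<theta> $ l\<bar> < pi)"
    by eventually_elim (auto simp: pibox_def mem_box_cart abs_less_iff minus_less_iff)
  then show ?thesis by (subst AE_restrict_space_iff) auto
qed

text \<open>Two weights matter later: the constant 1 for density in L1, and |g| for uniqueness,
  where the error must stay small after multiplication by a merely integrable \<open>g\<close>. A
  cutoff makes \<open>\<phi>\<close> vanish on the boundary at small weighted cost, and the result
  is approximated uniformly.\<close>

lemma trig_poly_weighted_dense:
  fixes \<phi> :: "real ^ 'd::finite \<Rightarrow> complex" and w :: "real ^ 'd \<Rightarrow> real"
  assumes \<phi>: "continuous_on pibox \<phi>" and w: "integrable box_measure w" and w0: "\<And>\<theta>. w \<theta> \<ge> 0" and e: "e > 0"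
  obtains q where "trig_poly q" "integrable box_measure (\<lambda>\<theta>. w \<theta> * cmod (\<phi> \<theta> - q \<theta>))"
    "(\<integral>\<theta>. w \<theta> * cmod (\<phi> \<theta> - q \<theta>) \<partial>box_measure) < e"
proof -
  \<comment> \<open>Cutoffs that vanish on the boundary and eventually equal 1 at each interior
    point, so dominated convergence disposes of the part cut off.\<close>
  define \<chi>' where "\<chi>' = (\<lambda>(m::nat) \<theta> :: real ^ 'd. min 1 (real m * (\<Prod>l\<in>UNIV. pi - \<bar>\<theta> $ l\<bar>)))"
  have \<chi>_cont: "continuous_on S (\<chi>' m)" for S m
    unfolding \<chi>'_def by (intro continuous_intros)
  have \<chi>_01: "0 \<le> \<chi>' m \<theta>" "\<chi>' m \<theta> \<le> 1" if "\<theta> \<in> pibox" for m \<theta>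
    using that by (auto simp: \<chi>'_def mem_pibox intro!: mult_nonneg_nonneg prod_nonneg)
  obtain B where B: "\<And>\<theta>. \<theta> \<in> pibox \<Longrightarrow> cmod (\<phi> \<theta>) \<le> B"
    using compact_imp_bounded[OF compact_continuous_image[OF \<phi> compact_pibox]] by (auto simp: bounded_iff)
  have B0: "B \<ge> 0" using B[of 0] order_trans[OF norm_ge_zero] by (auto simp: mem_pibox)
  have dom: "norm (w \<theta> * cmod (\<phi> \<theta>) * (1 - \<chi>' m \<theta>)) \<le> w \<theta> * B" if \<theta>: "\<theta> \<in> pibox" for \<theta> m
  proof -
    have "w \<theta> * cmod (\<phi> \<theta>) * (1 - \<chi>' m \<theta>) \<le> w \<theta> * B * 1"
      using w0 B0 B[OF \<theta>] \<chi>_01[OF \<theta>, of m] by (intro mult_mono) auto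
    then show ?thesis using w0[of \<theta>] \<chi>_01[OF \<theta>, of m] by (simp add: abs_mult)
  qed
  have meas\<phi>: "\<phi> \<in> borel_measurable box_measure"
    using borel_measurable_integrable[OF integrable_box_continuous[OF \<phi>]] .
  have meas\<chi>: "\<chi>' m \<in> borel_measurable box_measure" for m
    using borel_measurable_integrable[OF integrable_box_continuous[OF \<chi>_cont]] .
  have measw: "w \<in> borel_measurable box_measure" using w by simp
  have "(\<lambda>m. \<integral>\<theta>. w \<theta> * cmod (\<phi> \<theta>) * (1 - \<chi>' m \<theta>) \<partial>box_measure) \<longlonglongrightarrow> (\<integral>\<theta>. 0 \<partial>(box_measure :: (real ^ 'd) measure))"
  proof (rule integral_dominated_convergence[where w = "\<lambda>\<theta>. w \<theta> * B"])
    show "(\<lambda>\<theta>. w \<theta> * cmod (\<phi> \<theta>) * (1 - \<chi>' m \<theta>)) \<in> borel_measurable box_measure" for m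
      using meas\<phi> meas\<chi> measw by measurable
    show "integrable box_measure (\<lambda>\<theta>. w \<theta> * B)" using w by simp
    show "AE \<theta> in box_measure. norm (w \<theta> * cmod (\<phi> \<theta>) * (1 - \<chi>' m \<theta>)) \<le> w \<theta> * B" for m
      by (intro AE_I2 dom) simp
    show "AE \<theta> in box_measure. (\<lambda>m. w \<theta> * cmod (\<phi> \<theta>) * (1 - \<chi>' m \<theta>)) \<longlonglongrightarrow> 0"
      using AE_box_interior
    proof eventually_elim
      case (elim \<theta>)
      define P where "P = (\<Prod>l\<in>UNIV. pi - \<bar>\<theta> $ l\<bar>)"
      have P: "P > 0" unfolding P_def using elim by (intro prod_pos) auto
      obtain N where N: "real N \<ge> 1 / P" using real_arch_simple by blast
      have "\<chi>' m \<theta> = 1" if "m \<ge> N" for m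
      proof -
        have "1 / P \<le> real m" using N that by linarith
        then have "1 \<le> real m * P" using P by (simp add: divide_le_eq)
        then show ?thesis by (simp add: \<chi>'_def P_def)
      qed
      then have "eventually (\<lambda>m. w \<theta> * cmod (\<phi> \<theta>) * (1 - \<chi>' m \<theta>) = 0) sequentially"
        by (intro eventually_sequentiallyI[of N]) auto
      then show ?case by (rule tendsto_eventually)
    qed
  qed simp
  then have "eventually (\<lambda>m. (\<integral>\<theta>. w \<theta> * cmod (\<phi> \<theta>) * (1 - \<chi>' m \<theta>) \<partial>box_measure) < e / 2) sequentially"
    using e by (intro order_tendstoD(2)) auto
  then obtain m where m: "(\<integral>\<theta>. w \<theta> * cmod (\<phi> \<theta>) * (1 - \<chi>' m \<theta>) \<partial>box_measure) < e / 2"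
    by (auto simp: eventually_sequentially)
  define W where "W = (\<integral>\<theta>. w \<theta> \<partial>box_measure)"
  have W: "W \<ge> 0" unfolding W_def by (intro integral_nonneg_AE AE_I2 w0)
  \<comment> \<open>Half of \<open>e\<close> is reserved for the uniform error times the total
    weight \<open>W\<close>; the \<open>+ 1\<close> covers \<open>W = 0\<close>.\<close>
  define \<eta> where "\<eta> = e / (2 * (W + 1))"
  have \<eta>: "\<eta> > 0" using e W by (simp add: \<eta>_def)
  obtain q where q: "trig_poly q" "\<And>\<theta>. \<theta> \<in> pibox \<Longrightarrow> cmod (of_real (\<chi>' m \<theta>) * \<phi> \<theta> - q \<theta>) < \<eta>"
  proof (rule trig_poly_uniformly_dense[of "\<lambda>\<theta>. of_real (\<chi>' m \<theta>) * \<phi> \<theta>"])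
    show "continuous_on pibox (\<lambda>\<theta>. of_real (\<chi>' m \<theta>) * \<phi> \<theta>)" by (intro continuous_intros \<chi>_cont \<phi>)
    show "of_real (\<chi>' m \<theta>) * \<phi> \<theta> = 0" if "\<bar>\<theta> $ l\<bar> = pi" for \<theta> l
    proof -
      have P0: "(\<Prod>l\<in>UNIV. pi - \<bar>\<theta> $ l\<bar>) = 0" using that by (simp add: prod_zero_iff) (metis)
      show ?thesis unfolding \<chi>'_def P0 by simp
    qed
  qed (use \<eta> that in auto)
  have qc: "continuous_on pibox q" by (rule trig_poly_continuous[OF q(1)])
  have measq: "q \<in> borel_measurable box_measure"
    using borel_measurable_integrable[OF integrable_box_continuous[OF qc]] .
  have i1: "integrable box_measure (\<lambda>\<theta>. w \<theta> * cmod (\<phi> \<theta>) * (1 - \<chi>' m \<theta>))"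
  proof (rule Bochner_Integration.integrable_bound[of _ "\<lambda>\<theta>. w \<theta> * B"])
    show "AE \<theta> in box_measure. norm (w \<theta> * cmod (\<phi> \<theta>) * (1 - \<chi>' m \<theta>)) \<le> norm (w \<theta> * B)"
      by (intro AE_I2 order_trans[OF dom]) auto
    show "(\<lambda>\<theta>. w \<theta> * cmod (\<phi> \<theta>) * (1 - \<chi>' m \<theta>)) \<in> borel_measurable box_measure"
      using meas\<phi> meas\<chi> measw by measurable
  qed (use w in simp)
  have i2: "integrable box_measure (\<lambda>\<theta>. w \<theta> * \<eta>)" using w by simp
  have pw: "w \<theta> * cmod (\<phi> \<theta> - q \<theta>) \<le> w \<theta> * cmod (\<phi> \<theta>) * (1 - \<chi>' m \<theta>) + w \<theta> * \<eta>" if \<theta>: "\<theta> \<in> pibox" for \<theta>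
  proof -
    have "\<phi> \<theta> - q \<theta> = of_real (1 - \<chi>' m \<theta>) * \<phi> \<theta> + (of_real (\<chi>' m \<theta>) * \<phi> \<theta> - q \<theta>)"
      by (simp add: algebra_simps)
    also have "cmod \<dots> \<le> (1 - \<chi>' m \<theta>) * cmod (\<phi> \<theta>) + \<eta>"
    proof (rule norm_triangle_le)
      have "cmod (of_real (1 - \<chi>' m \<theta>) * \<phi> \<theta>) = (1 - \<chi>' m \<theta>) * cmod (\<phi> \<theta>)"
        unfolding norm_mult norm_of_real using \<chi>_01[OF \<theta>, of m] by simp
      then show "cmod (of_real (1 - \<chi>' m \<theta>) * \<phi> \<theta>) + cmod (of_real (\<chi>' m \<theta>) * \<phi> \<theta> - q \<theta>) \<le> (1 - \<chi>' m \<theta>) * cmod (\<phi> \<theta>) + \<eta>"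
        using q(2)[OF \<theta>] by linarith
    qed
    finally have "w \<theta> * cmod (\<phi> \<theta> - q \<theta>) \<le> w \<theta> * ((1 - \<chi>' m \<theta>) * cmod (\<phi> \<theta>) + \<eta>)"
      using w0 by (rule mult_left_mono)
    then show ?thesis by (simp add: algebra_simps)
  qed
  have int: "integrable box_measure (\<lambda>\<theta>. w \<theta> * cmod (\<phi> \<theta> - q \<theta>))"
  proof (rule Bochner_Integration.integrable_bound[OF Bochner_Integration.integrable_add[OF i1 i2]])
    show "(\<lambda>\<theta>. w \<theta> * cmod (\<phi> \<theta> - q \<theta>)) \<in> borel_measurable box_measure"
      using meas\<phi> measq measw by measurable
    show "AE \<theta> in box_measure. norm (w \<theta> * cmod (\<phi> \<theta> - q \<theta>)) \<le> norm (w \<theta> * cmod (\<phi> \<theta>) * (1 - \<chi>' m \<theta>) + w \<theta> * \<eta>)"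
      using pw w0 by (intro AE_I2) (auto simp: abs_mult intro: order_trans[OF _ abs_ge_self])
  qed
  have "(\<integral>\<theta>. w \<theta> * cmod (\<phi> \<theta> - q \<theta>) \<partial>box_measure) \<le> (\<integral>\<theta>. w \<theta> * cmod (\<phi> \<theta>) * (1 - \<chi>' m \<theta>) + w \<theta> * \<eta> \<partial>box_measure)"
    using pw by (intro integral_mono int Bochner_Integration.integrable_add i1 i2) auto
  also have "\<dots> = (\<integral>\<theta>. w \<theta> * cmod (\<phi> \<theta>) * (1 - \<chi>' m \<theta>) \<partial>box_measure) + W * \<eta>"
    using i1 i2 by (simp add: W_def)
  also have "W * \<eta> \<le> e / 2" using W e by (simp add: \<eta>_def field_simps)
  finally have "(\<integral>\<theta>. w \<theta> * cmod (\<phi> \<theta> - q \<theta>) \<partial>box_measure) < e" using m by linarith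
  then show thesis using that q(1) int by blast
qed

text \<open>A measurable function is almost everywhere a limit of continuous functions, but these
  need not have a common integrable bound. Truncating \<open>f\<close> at a large level
  \<open>B\<close> costs little, and truncating the continuous functions at the same level makes
  dominated convergence applicable on the finite measure space.\<close>

lemma continuous_L1_dense:
  fixes f :: "real ^ 'd::finite \<Rightarrow> complex"
  assumes f: "integrable box_measure f" and e: "e > 0"
  obtains g where "continuous_on UNIV g" "(\<integral>\<theta>. cmod (f \<theta> - g \<theta>) \<partial>box_measure) < e"
proof -
  \<comment> \<open>The radial retraction onto the disc of radius \<open>B\<close>; with
    \<open>max\<close> it is a single continuous formula.\<close>
  define clip where "clip = (\<lambda>B z. of_real (B / max B (cmod z)) * z :: complex)"
  have clip_cont: "continuous_on UNIV (clip B)" if "B > 0" for B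
    unfolding clip_def using that by (intro continuous_intros) auto
  have clip_le: "cmod (clip B z) \<le> B" "cmod (clip B z) \<le> cmod z" if "B > 0" for B z
    using that by (auto simp: clip_def norm_mult norm_divide field_simps max_def)
  have clip_id: "clip B z = z" if "B > 0" "cmod z \<le> B" for B z
    using that by (simp add: clip_def)
  have mf: "f \<in> borel_measurable box_measure" using f by simp
  have mclip: "(\<lambda>\<theta>. clip B (h \<theta>)) \<in> borel_measurable box_measure" if "B > 0" "h \<in> borel_measurable box_measure"
    for B and h :: "real ^ 'd \<Rightarrow> complex"
    using measurable_compose[OF that(2) borel_measurable_continuous_onI[OF clip_cont[OF that(1)]]] .
  have "(\<lambda>n. \<integral>\<theta>. cmod (f \<theta> - clip (real (Suc n)) (f \<theta>)) \<partial>box_measure) \<longlonglongrightarrow> (\<integral>\<theta>. 0 \<partial>(box_measure :: (real ^ 'd) measure))"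
  proof (rule integral_dominated_convergence[where w = "\<lambda>\<theta>. 2 * cmod (f \<theta>)"])
    show "(\<lambda>\<theta>. cmod (f \<theta> - clip (real (Suc n)) (f \<theta>))) \<in> borel_measurable box_measure" for n
      using mf mclip[of "real (Suc n)" f] by measurable
    show "AE \<theta> in box_measure. norm (cmod (f \<theta> - clip (real (Suc n)) (f \<theta>))) \<le> 2 * cmod (f \<theta>)" for n
    proof (intro AE_I2)
      fix \<theta>
      show "norm (cmod (f \<theta> - clip (real (Suc n)) (f \<theta>))) \<le> 2 * cmod (f \<theta>)"
        using norm_triangle_ineq4[of "f \<theta>" "clip (real (Suc n)) (f \<theta>)"] clip_le(2)[of "real (Suc n)" "f \<theta>"] by simp
    qed
    show "AE \<theta> in box_measure. (\<lambda>n. cmod (f \<theta> - clip (real (Suc n)) (f \<theta>))) \<longlonglongrightarrow> 0"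
    proof (intro AE_I2)
      fix \<theta>
      obtain N where N: "real N \<ge> cmod (f \<theta>)" using real_arch_simple by blast
      have "eventually (\<lambda>n. cmod (f \<theta> - clip (real (Suc n)) (f \<theta>)) = 0) sequentially"
        using N by (intro eventually_sequentiallyI[of N]) (subst clip_id, auto)
      then show "(\<lambda>n. cmod (f \<theta> - clip (real (Suc n)) (f \<theta>))) \<longlonglongrightarrow> 0" by (rule tendsto_eventually)
    qed
  qed (use f in auto)
  then have "eventually (\<lambda>n. (\<integral>\<theta>. cmod (f \<theta> - clip (real (Suc n)) (f \<theta>)) \<partial>box_measure) < e / 2) sequentially"
    using e by (intro order_tendstoD(2)) auto
  then obtain n where n: "(\<integral>\<theta>. cmod (f \<theta> - clip (real (Suc n)) (f \<theta>)) \<partial>box_measure) < e / 2"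
    by (auto simp: eventually_sequentially)
  define B where "B = real (Suc n)"
  have B: "B > 0" by (simp add: B_def)
  have "f measurable_on pibox" using mf by (simp add: measurable_on_iff_borel_measurable)
  then obtain N g where N: "negligible N" and g: "\<And>n. continuous_on UNIV (g n)"
    and lim: "\<And>x. x \<notin> N \<Longrightarrow> (\<lambda>n. g n x) \<longlonglongrightarrow> (if x \<in> pibox then f x else 0)"
    unfolding measurable_on_def by blast
  have cg: "continuous_on UNIV (\<lambda>\<theta>. clip B (g n \<theta>))" for n
    by (rule continuous_on_compose2[OF clip_cont[OF B] g]) auto
  have mg: "(\<lambda>\<theta>. clip B (g n \<theta>)) \<in> borel_measurable box_measure" for n
    using borel_measurable_integrable[OF integrable_box_continuous[OF continuous_on_subset[OF cg]]] by simp
  have AEN: "AE \<theta> in box_measure. \<theta> \<notin> N"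
    using AE_not_in[OF N[unfolded negligible_iff_null_sets]] by (subst AE_restrict_space_iff) auto
  interpret finite_measure "box_measure :: (real ^ 'd) measure" by (rule finite_measure_box)
  have "(\<lambda>n. \<integral>\<theta>. cmod (clip B (f \<theta>) - clip B (g n \<theta>)) \<partial>box_measure) \<longlonglongrightarrow> (\<integral>\<theta>. 0 \<partial>(box_measure :: (real ^ 'd) measure))"
  proof (rule integral_dominated_convergence[where w = "\<lambda>\<theta>. 2 * B"])
    show "(\<lambda>\<theta>. cmod (clip B (f \<theta>) - clip B (g n \<theta>))) \<in> borel_measurable box_measure" for n
      using mg[of n] mclip[OF B mf] by measurable
    show "AE \<theta> in box_measure. norm (cmod (clip B (f \<theta>) - clip B (g n \<theta>))) \<le> 2 * B" for n
    proof (intro AE_I2)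
      fix \<theta>
      show "norm (cmod (clip B (f \<theta>) - clip B (g n \<theta>))) \<le> 2 * B"
        using norm_triangle_ineq4[of "clip B (f \<theta>)" "clip B (g n \<theta>)"] clip_le(1)[OF B, of "f \<theta>"] clip_le(1)[OF B, of "g n \<theta>"] by simp
    qed
    show "AE \<theta> in box_measure. (\<lambda>n. cmod (clip B (f \<theta>) - clip B (g n \<theta>))) \<longlonglongrightarrow> 0"
      using AEN AE_space
    proof eventually_elim
      case (elim \<theta>)
      then have "(\<lambda>n. g n \<theta>) \<longlonglongrightarrow> f \<theta>" using lim[of \<theta>] by simp
      then have "(\<lambda>n. clip B (g n \<theta>)) \<longlonglongrightarrow> clip B (f \<theta>)"
        using continuous_on_tendsto_compose[OF clip_cont[OF B]] by auto
      then have "(\<lambda>n. cmod (clip B (f \<theta>) - clip B (g n \<theta>))) \<longlonglongrightarrow> cmod (clip B (f \<theta>) - clip B (f \<theta>))"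
        by (intro tendsto_intros)
      then show ?case by simp
    qed
  qed auto
  then have "eventually (\<lambda>n. (\<integral>\<theta>. cmod (clip B (f \<theta>) - clip B (g n \<theta>)) \<partial>box_measure) < e / 2) sequentially"
    using e by (intro order_tendstoD(2)) auto
  then obtain k where k: "(\<integral>\<theta>. cmod (clip B (f \<theta>) - clip B (g k \<theta>)) \<partial>box_measure) < e / 2"
    by (auto simp: eventually_sequentially)
  have icf: "integrable box_measure (\<lambda>\<theta>. clip B (f \<theta>))"
    by (rule Bochner_Integration.integrable_bound[OF f mclip[OF B mf]]) (use clip_le(2)[OF B] in auto)
  have icg: "integrable box_measure (\<lambda>\<theta>. clip B (g k \<theta>))"
    by (intro integrable_box_continuous continuous_on_subset[OF cg]) simp
  have "(\<integral>\<theta>. cmod (f \<theta> - clip B (g k \<theta>)) \<partial>box_measure)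
      \<le> (\<integral>\<theta>. cmod (f \<theta> - clip B (f \<theta>)) + cmod (clip B (f \<theta>) - clip B (g k \<theta>)) \<partial>box_measure)"
    using f icf icg by (intro integral_mono) (auto intro: norm_diff_triangle_le)
  also have "\<dots> = (\<integral>\<theta>. cmod (f \<theta> - clip B (f \<theta>)) \<partial>box_measure) + (\<integral>\<theta>. cmod (clip B (f \<theta>) - clip B (g k \<theta>)) \<partial>box_measure)"
    using f icf icg by (intro Bochner_Integration.integral_add) auto
  also have "\<dots> < e" using n k by (simp add: B_def)
  finally show thesis using that[OF cg[of k]] by blast
qed


lemma trig_poly_L1_dense:
  fixes f :: "real ^ 'd::finite \<Rightarrow> complex"
  assumes f: "integrable box_measure f" and e: "e > 0"
  obtains q where "trig_poly q" "(\<integral>\<theta>. cmod (f \<theta> - q \<theta>) \<partial>box_measure) < e"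
proof -
  obtain g where g: "continuous_on UNIV g" "(\<integral>\<theta>. cmod (f \<theta> - g \<theta>) \<partial>box_measure) < e / 2"
    using continuous_L1_dense[OF f, of "e / 2"] e by auto
  interpret finite_measure "box_measure :: (real ^ 'd) measure" by (rule finite_measure_box)
  have gc: "continuous_on pibox g" using g(1) continuous_on_subset by blast
  obtain q where q: "trig_poly q" "integrable box_measure (\<lambda>\<theta>. 1 * cmod (g \<theta> - q \<theta>))"
     "(\<integral>\<theta>. 1 * cmod (g \<theta> - q \<theta>) \<partial>box_measure) < e / 2"
    using trig_poly_weighted_dense[OF gc, of "\<lambda>_. 1" "e / 2"] e by auto
  have ig: "integrable box_measure g" by (rule integrable_box_continuous[OF gc])
  have iq: "integrable box_measure q" by (rule integrable_box_continuous[OF trig_poly_continuous[OF q(1)]])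
  have "(\<integral>\<theta>. cmod (f \<theta> - q \<theta>) \<partial>box_measure) \<le> (\<integral>\<theta>. cmod (f \<theta> - g \<theta>) + cmod (g \<theta> - q \<theta>) \<partial>box_measure)"
    using f ig iq by (intro integral_mono) (auto intro: norm_diff_triangle_le)
  also have "\<dots> = (\<integral>\<theta>. cmod (f \<theta> - g \<theta>) \<partial>box_measure) + (\<integral>\<theta>. cmod (g \<theta> - q \<theta>) \<partial>box_measure)"
    using f ig iq by (intro Bochner_Integration.integral_add) auto
  also have "\<dots> < e" using g(2) q(3) by simp
  finally show thesis using that q(1) by blast
qed

text \<open>The ideal test function is the conjugate sign of \<open>g\<close>. It is replaced by a
  regularized sign of a continuous \<open>h\<close> close to \<open>g\<close>, and that by a
  trigonometric polynomial \<open>q\<close> close to it in the norm weighted by |g|;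
  \<open>q\<close> integrates to 0 against \<open>g\<close>.\<close>

lemma fourier_uniqueness:
  fixes g :: "real ^ 'd::finite \<Rightarrow> complex"
  assumes g: "integrable box_measure g" and zero: "\<And>k. (\<integral>\<theta>. g \<theta> * trig_exp k \<theta> \<partial>box_measure) = 0"
  shows "AE \<theta> in box_measure. g \<theta> = 0"
proof -
  let ?V = "(2 * pi) ^ CARD('d)"
  interpret finite_measure "box_measure :: (real ^ 'd) measure" by (rule finite_measure_box)
  have le: "(\<integral>\<theta>. cmod (g \<theta>) \<partial>box_measure) \<le> e * (3 + ?V)" if e: "e > 0" for e
  proof -
    obtain h where h: "continuous_on UNIV h" "(\<integral>\<theta>. cmod (g \<theta> - h \<theta>) \<partial>box_measure) < e"
      using continuous_L1_dense[OF g e] by blast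
    have hc: "continuous_on pibox h" using h(1) continuous_on_subset by blast
    have ih: "integrable box_measure h" by (rule integrable_box_continuous[OF hc])
    \<comment> \<open>Continuous also where \<open>h\<close> vanishes and of modulus at most 1;
      moreover \<open>h \<theta> * \<phi> \<theta>\<close> is real and at least |h| - e, because
      (|h| - e) (|h| + e) \<le> |h|^2.\<close>
    define \<phi> where "\<phi> = (\<lambda>\<theta>. cnj (h \<theta>) / of_real (cmod (h \<theta>) + e))"
    have ne: "cmod (h \<theta>) + e > 0" for \<theta> using e norm_ge_zero[of "h \<theta>"] by linarith
    have ne': "complex_of_real (cmod (h \<theta>)) + complex_of_real e \<noteq> 0" for \<theta>
      using ne[of \<theta>] by (metis of_real_add of_real_eq_0_iff less_irrefl)
    have \<phi>c: "continuous_on pibox \<phi>" unfolding \<phi>_def using ne' by (intro continuous_intros hc) auto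
    have \<phi>1: "cmod (\<phi> \<theta>) \<le> 1" for \<theta>
      using ne[of \<theta>] e by (simp add: \<phi>_def norm_divide del: of_real_add)
    obtain q where q: "trig_poly q" "integrable box_measure (\<lambda>\<theta>. cmod (g \<theta>) * cmod (\<phi> \<theta> - q \<theta>))"
       "(\<integral>\<theta>. cmod (g \<theta>) * cmod (\<phi> \<theta> - q \<theta>) \<partial>box_measure) < e"
      using trig_poly_weighted_dense[OF \<phi>c, of "\<lambda>\<theta>. cmod (g \<theta>)" e] e g by auto
    have qc: "continuous_on pibox q" by (rule trig_poly_continuous[OF q(1)])
    obtain K c where K: "finite K" "q = (\<lambda>\<theta>. \<Sum>k\<in>K. c k * trig_exp k \<theta>)"
      using trig_poly_normal_form[OF q(1)] by blast
    have ik: "integrable box_measure (\<lambda>\<theta>. g \<theta> * trig_exp k \<theta>)" for k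
      by (intro integrable_box_mult_continuous g continuous_intros)
    have "(\<lambda>\<theta>. g \<theta> * q \<theta>) = (\<lambda>\<theta>. \<Sum>k\<in>K. c k * (g \<theta> * trig_exp k \<theta>))"
      by (simp add: K(2) sum_distrib_left mult_ac)
    then have gq: "(\<integral>\<theta>. g \<theta> * q \<theta> \<partial>box_measure) = 0"
      using ik by (simp add: zero)
    have igq: "integrable box_measure (\<lambda>\<theta>. g \<theta> * q \<theta>)" by (intro integrable_box_mult_continuous g qc)
    have ig\<phi>: "integrable box_measure (\<lambda>\<theta>. g \<theta> * \<phi> \<theta>)" by (intro integrable_box_mult_continuous g \<phi>c)
    have ih\<phi>: "integrable box_measure (\<lambda>\<theta>. h \<theta> * \<phi> \<theta>)" by (intro integrable_box_mult_continuous ih \<phi>c)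
    have "cmod (\<integral>\<theta>. g \<theta> * \<phi> \<theta> \<partial>box_measure) = cmod (\<integral>\<theta>. g \<theta> * \<phi> \<theta> - g \<theta> * q \<theta> \<partial>box_measure)"
      using igq ig\<phi> gq by simp
    also have "\<dots> \<le> (\<integral>\<theta>. cmod (g \<theta> * \<phi> \<theta> - g \<theta> * q \<theta>) \<partial>box_measure)" by (rule integral_norm_bound)
    also have "\<dots> = (\<integral>\<theta>. cmod (g \<theta>) * cmod (\<phi> \<theta> - q \<theta>) \<partial>box_measure)"
      by (simp add: norm_mult[symmetric] right_diff_distrib)
    finally have 1: "cmod (\<integral>\<theta>. g \<theta> * \<phi> \<theta> \<partial>box_measure) < e" using q(3) by linarith
    have "cmod (\<integral>\<theta>. g \<theta> * \<phi> \<theta> - h \<theta> * \<phi> \<theta> \<partial>box_measure) \<le> (\<integral>\<theta>. cmod (g \<theta> * \<phi> \<theta> - h \<theta> * \<phi> \<theta>) \<partial>box_measure)"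
      by (rule integral_norm_bound)
    also have "\<dots> \<le> (\<integral>\<theta>. cmod (g \<theta> - h \<theta>) \<partial>box_measure)"
    proof (rule integral_mono)
      show "cmod (g \<theta> * \<phi> \<theta> - h \<theta> * \<phi> \<theta>) \<le> cmod (g \<theta> - h \<theta>)" for \<theta>
        unfolding left_diff_distrib[symmetric] norm_mult using \<phi>1[of \<theta>] by (rule mult_left_le) simp
    qed (use g ih ig\<phi> ih\<phi> in auto)
    finally have 2: "cmod (\<integral>\<theta>. g \<theta> * \<phi> \<theta> - h \<theta> * \<phi> \<theta> \<partial>box_measure) < e" using h(2) by linarith
    have "cmod (\<integral>\<theta>. h \<theta> * \<phi> \<theta> \<partial>box_measure) \<le> cmod (\<integral>\<theta>. g \<theta> * \<phi> \<theta> \<partial>box_measure) + cmod (\<integral>\<theta>. g \<theta> * \<phi> \<theta> - h \<theta> * \<phi> \<theta> \<partial>box_measure)"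
      using ig\<phi> ih\<phi> norm_triangle_sub[of "\<integral>\<theta>. h \<theta> * \<phi> \<theta> \<partial>box_measure" "\<integral>\<theta>. g \<theta> * \<phi> \<theta> \<partial>box_measure"]
      by (simp add: norm_minus_commute)
    then have 3: "cmod (\<integral>\<theta>. h \<theta> * \<phi> \<theta> \<partial>box_measure) < 2 * e" using 1 2 by linarith
    have h\<phi>: "h \<theta> * \<phi> \<theta> = of_real ((cmod (h \<theta>))\<^sup>2 / (cmod (h \<theta>) + e))" for \<theta>
      by (simp add: \<phi>_def complex_norm_square del: of_real_power)
    have "(\<integral>\<theta>. cmod (h \<theta>) - e \<partial>box_measure) \<le> (\<integral>\<theta>. Re (h \<theta> * \<phi> \<theta>) \<partial>box_measure)"
    proof (rule integral_mono)
      show "cmod (h \<theta>) - e \<le> Re (h \<theta> * \<phi> \<theta>)" for \<theta>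
        unfolding h\<phi> Re_complex_of_real pos_le_divide_eq[OF ne] using e by (simp add: algebra_simps power2_eq_square)
    qed (use ih integrable_Re[OF ih\<phi>] in simp_all)
    also have "\<dots> = Re (\<integral>\<theta>. h \<theta> * \<phi> \<theta> \<partial>box_measure)" by (rule integral_Re[OF ih\<phi>])
    also have "\<dots> < 2 * e" using complex_Re_le_cmod[of "\<integral>\<theta>. h \<theta> * \<phi> \<theta> \<partial>box_measure"] 3 by linarith
    \<comment> \<open>Integrating |h| - e over a box of volume V costs e V. Together with 2 e for
      the pairing and e for the distance from \<open>g\<close> to \<open>h\<close> this makes up the
      constant 3 + V.\<close>
    finally have 4: "(\<integral>\<theta>. cmod (h \<theta>) \<partial>box_measure) < e * (2 + ?V)"
      using ih by (simp add: measure_box_measure algebra_simps)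
    have "(\<integral>\<theta>. cmod (g \<theta>) \<partial>box_measure) \<le> (\<integral>\<theta>. cmod (g \<theta> - h \<theta>) + cmod (h \<theta>) \<partial>box_measure)"
      using g ih by (intro integral_mono) (auto simp: norm_triangle_sub add.commute)
    also have "\<dots> = (\<integral>\<theta>. cmod (g \<theta> - h \<theta>) \<partial>box_measure) + (\<integral>\<theta>. cmod (h \<theta>) \<partial>box_measure)"
      using g ih by (intro Bochner_Integration.integral_add) auto
    finally show ?thesis using 4 h(2) by (simp add: algebra_simps)
  qed
  have V: "3 + ?V > 0" by (simp add: add_pos_nonneg)
  have "(\<integral>\<theta>. cmod (g \<theta>) \<partial>box_measure) \<le> 0"
  proof (rule field_le_epsilon)
    fix e :: real assume "e > 0"
    then show "(\<integral>\<theta>. cmod (g \<theta>) \<partial>box_measure) \<le> 0 + e" using le[of "e / (3 + ?V)"] V by simp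
  qed
  then have "(\<integral>\<theta>. cmod (g \<theta>) \<partial>box_measure) = 0" by (simp add: antisym)
  then have "AE \<theta> in box_measure. cmod (g \<theta>) = 0"
    using g by (subst (asm) integral_nonneg_eq_0_iff_AE) auto
  then show ?thesis by simp
qed

text \<open>The Fourier coefficients of \<open>cnj (f (- \<theta>))\<close> are the conjugates of
  those of \<open>f\<close>, hence here the same; uniqueness concludes.\<close>

lemma real_fourier_coeff_symmetric:
  fixes f :: "real ^ 'd::finite \<Rightarrow> complex"
  assumes f: "integrable box_measure f" and re: "\<And>k. fourier_coeff f k \<in> \<real>"
  shows "AE \<theta> in box_measure. f \<theta> = cnj (f (- \<theta>))"
proof -
  let ?V = "(2 * pi) ^ CARD('d)"
  have ir: "integrable box_measure (\<lambda>\<theta>. cnj (f (- \<theta>)))"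
    using box_measure_reflect(1)[OF f] by simp
  have ik: "integrable box_measure (\<lambda>\<theta>. f \<theta> * trig_exp k \<theta>)" for k
    by (intro integrable_box_mult_continuous f continuous_intros)
  have irk: "integrable box_measure (\<lambda>\<theta>. cnj (f (- \<theta>)) * trig_exp k \<theta>)" for k
    by (intro integrable_box_mult_continuous ir continuous_intros)
  have "(\<integral>\<theta>. (f \<theta> - cnj (f (- \<theta>))) * trig_exp k \<theta> \<partial>box_measure) = 0" for k
  proof -
    define J where "J = (\<integral>\<theta>. f \<theta> * trig_exp k \<theta> \<partial>box_measure)"
    have "fourier_coeff f (\<lambda>l. - k l) = J / of_real ?V"
      by (simp add: fourier_coeff_lebesgue[OF f] J_def)
    moreover have "J = J / of_real ?V * of_real ?V" by simp
    ultimately have "J \<in> \<real>" using re[of "\<lambda>l. - k l"] by (metis Reals_mult Reals_of_real)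
    then have J: "cnj J = J" by (simp add: Reals_cnj_iff)
    have "(\<integral>\<theta>. cnj (f (- \<theta>)) * trig_exp k \<theta> \<partial>box_measure) = (\<integral>\<theta>. cnj (f (- \<theta>) * trig_exp k (- \<theta>)) \<partial>box_measure)"
      by (simp add: trig_exp_reflect)
    also have "\<dots> = cnj (\<integral>\<theta>. f (- \<theta>) * trig_exp k (- \<theta>) \<partial>box_measure)" by (rule Bochner_Integration.integral_cnj)
    also have "(\<integral>\<theta>. f (- \<theta>) * trig_exp k (- \<theta>) \<partial>box_measure) = J"
      unfolding J_def by (rule box_measure_reflect(2)[OF ik])
    finally show ?thesis using ik[of k] irk[of k] J by (simp add: left_diff_distrib J_def)
  qed
  then have "AE \<theta> in box_measure. f \<theta> - cnj (f (- \<theta>)) = 0"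
    by (intro fourier_uniqueness) (use f ir in auto)
  then show ?thesis by simp
qed

text \<open>Taking real parts of the coefficients of \<open>q\<close> amounts to averaging
  \<open>q\<close> with \<open>cnj (q (- \<theta>))\<close>. This involution preserves L1 distances
  and fixes \<open>f\<close> almost everywhere, so the average is no farther from \<open>f\<close>
  than \<open>q\<close> is.\<close>

theorem real_trig_poly_L1_dense:
  fixes f :: "real ^ 'd::finite \<Rightarrow> complex"
  assumes f: "integrable box_measure f" and re: "\<And>k. fourier_coeff f k \<in> \<real>" and e: "e > 0"
  obtains K and c :: "('d \<Rightarrow> int) \<Rightarrow> real" where "finite K"
    "(\<integral>\<theta>. cmod (f \<theta> - (\<Sum>k\<in>K. of_real (c k) * trig_exp k \<theta>)) \<partial>box_measure) < e"
proof -
  obtain q where q: "trig_poly q" "(\<integral>\<theta>. cmod (f \<theta> - q \<theta>) \<partial>box_measure) < e"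
    using trig_poly_L1_dense[OF f e] by blast
  obtain K a where K: "finite K" "q = (\<lambda>\<theta>. \<Sum>k\<in>K. a k * trig_exp k \<theta>)"
    using trig_poly_normal_form[OF q(1)] by blast
  define p where "p = (\<lambda>\<theta>. \<Sum>k\<in>K. of_real (Re (a k)) * trig_exp k \<theta>)"
  have iq: "integrable box_measure q" by (rule integrable_box_continuous[OF trig_poly_continuous[OF q(1)]])
  have ip: "integrable box_measure p" unfolding p_def by (intro integrable_box_continuous continuous_intros)
  have i1: "integrable box_measure (\<lambda>\<theta>. cmod (f \<theta> - q \<theta>))" using f iq by simp
  note i2 = box_measure_reflect[OF i1]
  have pq: "p \<theta> = (q \<theta> + cnj (q (- \<theta>))) / 2" for \<theta>
  proof -
    have "q \<theta> + cnj (q (- \<theta>)) = (\<Sum>k\<in>K. (a k + cnj (a k)) * trig_exp k \<theta>)"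
      by (simp add: K(2) trig_exp_reflect sum.distrib distrib_right)
    also have "\<dots> = 2 * p \<theta>" by (simp add: p_def complex_add_cnj sum_distrib_left mult_ac)
    finally show ?thesis by simp
  qed
  have "AE \<theta> in box_measure. cmod (f \<theta> - p \<theta>) \<le> (cmod (f \<theta> - q \<theta>) + cmod (f (- \<theta>) - q (- \<theta>))) / 2"
    using real_fourier_coeff_symmetric[OF f re]
  proof eventually_elim
    case (elim \<theta>)
    have "f \<theta> - p \<theta> = ((f \<theta> - q \<theta>) + (f \<theta> - cnj (q (- \<theta>)))) / 2" by (simp add: pq field_simps)
    also have "f \<theta> - cnj (q (- \<theta>)) = cnj (f (- \<theta>) - q (- \<theta>))" using elim by simp
    also have "cmod (((f \<theta> - q \<theta>) + cnj (f (- \<theta>) - q (- \<theta>))) / 2) \<le> (cmod (f \<theta> - q \<theta>) + cmod (f (- \<theta>) - q (- \<theta>))) / 2"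
      using norm_triangle_ineq[of "f \<theta> - q \<theta>" "cnj (f (- \<theta>) - q (- \<theta>))"]
      by (simp only: norm_divide complex_mod_cnj) simp
    finally show ?case .
  qed
  then have "(\<integral>\<theta>. cmod (f \<theta> - p \<theta>) \<partial>box_measure) \<le> (\<integral>\<theta>. (cmod (f \<theta> - q \<theta>) + cmod (f (- \<theta>) - q (- \<theta>))) / 2 \<partial>box_measure)"
    using f ip i1 i2 by (intro integral_mono_AE) auto
  also have "\<dots> = (\<integral>\<theta>. cmod (f \<theta> - q \<theta>) \<partial>box_measure)"
    using i1 i2 by simp
  finally show thesis using that[OF K(1), of "\<lambda>k. Re (a k)"] q(2) by (simp add: p_def)
qed

section \<open>Hankel matrices of trigonometric polynomials\<close>

definition multi_at_top :: "('d \<Rightarrow> nat) filter" where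
  "multi_at_top = (INF N. principal {n. \<forall>l. N \<le> n l})"

lemma eventually_multi_at_top:
  "eventually P (multi_at_top :: ('d \<Rightarrow> nat) filter) \<longleftrightarrow> (\<exists>N. \<forall>n. (\<forall>l. N \<le> n l) \<longrightarrow> P n)"
proof -
  have "eventually P (multi_at_top :: ('d \<Rightarrow> nat) filter) \<longleftrightarrow> (\<exists>N\<in>UNIV. eventually P (principal {n. \<forall>l. N \<le> n l}))"
    unfolding multi_at_top_def
  proof (rule eventually_INF_base)
    fix M N :: nat
    show "\<exists>x\<in>UNIV. principal {n :: 'd \<Rightarrow> nat. \<forall>l. x \<le> n l} \<le> inf (principal {n. \<forall>l. M \<le> n l}) (principal {n. \<forall>l. N \<le> n l})"
      by (intro bexI[of _ "max M N"]) auto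
  qed auto
  then show ?thesis by (auto simp: eventually_principal)
qed

lemma filterlim_multi_at_top: "filterlim (\<lambda>n. n l) at_top (multi_at_top :: ('d \<Rightarrow> nat) filter)"
  unfolding filterlim_at_top eventually_multi_at_top by blast

text \<open>The epsilon argument common to three passages: from polynomial to continuous test
  functions, from trigonometric polynomials to \<open>f\<close>, and from separable quotients to
  compactly supported test functions.\<close>

lemma tendsto_uniform_approx:
  fixes f :: "'a \<Rightarrow> real"
  assumes "\<And>e. e > 0 \<Longrightarrow> \<exists>g L'. (g \<longlongrightarrow> L') F \<and> eventually (\<lambda>x. \<bar>f x - g x\<bar> \<le> e) F \<and> \<bar>L - L'\<bar> \<le> e"
  shows "(f \<longlongrightarrow> L) F"
proof (rule tendstoI)
  fix e :: real assume e: "e > 0"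
  obtain g L' where g: "(g \<longlongrightarrow> L') F" "eventually (\<lambda>x. \<bar>f x - g x\<bar> \<le> e / 4) F" "\<bar>L - L'\<bar> \<le> e / 4"
    using assms[of "e / 4"] e by auto
  have "eventually (\<lambda>x. dist (g x) L' < e / 4) F" using g(1) e by (intro tendstoD) auto
  with g(2) show "eventually (\<lambda>x. dist (f x) L < e) F"
  proof eventually_elim
    case (elim x)
    then show ?case using g(3) e unfolding dist_real_def by linarith
  qed
qed

lemma mindex_PiE: "mindex n = PiE UNIV (\<lambda>l. {..<n l})"
  by (auto simp: mindex_def PiE_def)

lemma finite_mindex [simp]: "finite (mindex n)"
  unfolding mindex_PiE by (intro finite_PiE) auto

lemma card_mindex: "card (mindex n) = (\<Prod>l\<in>UNIV. n l)"
  unfolding mindex_PiE by (subst card_PiE) auto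

definition ibox :: "nat \<Rightarrow> ('d::finite \<Rightarrow> int) set" where
  "ibox r = {k. \<forall>l. \<bar>k l\<bar> \<le> int r}"

lemma finite_ibox [simp]: "finite (ibox r :: ('d::finite \<Rightarrow> int) set)"
proof -
  have "(ibox r :: ('d \<Rightarrow> int) set) = PiE UNIV (\<lambda>l. {- int r..int r})" 
    by (auto simp: ibox_def PiE_def Pi_def abs_le_iff minus_le_iff)
  then show ?thesis by (simp add: finite_PiE)
qed

text \<open>The indices at distance at least \<open>r\<close> from every face. The condition is
  invariant under the reflection i -> n - 1 - i, so it suits even and odd powers of a Hankel matrix
  alike.\<close>

definition deep :: "nat \<Rightarrow> ('d::finite \<Rightarrow> nat) \<Rightarrow> ('d \<Rightarrow> nat) set" where
  "deep r n = {i. \<forall>l. r \<le> i l \<and> i l + r < n l}"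

lemma deep_PiE: "deep r n = PiE UNIV (\<lambda>l. {r..<n l - r})"
  by (auto simp: deep_def PiE_def Pi_def less_diff_conv)

lemma deep_subset: "deep r n \<subseteq> mindex n"
  by (auto simp: deep_def mindex_def) (metis add_lessD1)

lemma card_deep_tendsto:
  "((\<lambda>n :: 'd::finite \<Rightarrow> nat. real (card (deep r n)) / real (\<Prod>l\<in>UNIV. n l)) \<longlongrightarrow> 1) multi_at_top"
proof -
  have "(\<lambda>m. 1 - real (2 * r) / real m) \<longlonglongrightarrow> 1 - 0"
    by (intro tendsto_intros lim_const_over_n)
  moreover have "eventually (\<lambda>m. 1 - real (2 * r) / real m = real (m - r - r) / real m) sequentially"
    by (intro eventually_sequentiallyI[of "2 * r + 1"]) (auto simp: field_simps of_nat_diff)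
  ultimately have "(\<lambda>m. real (m - r - r) / real m) \<longlonglongrightarrow> 1"
    by (auto intro: Lim_transform_eventually)
  then have "((\<lambda>n :: 'd \<Rightarrow> nat. real (n l - r - r) / real (n l)) \<longlongrightarrow> 1) multi_at_top" for l
    by (rule filterlim_compose[OF _ filterlim_multi_at_top])
  then have "((\<lambda>n :: 'd \<Rightarrow> nat. \<Prod>l\<in>UNIV. real (n l - r - r) / real (n l)) \<longlongrightarrow> (\<Prod>l\<in>(UNIV :: 'd set). 1)) multi_at_top"
    by (intro tendsto_prod)
  moreover have "(\<Prod>l\<in>UNIV. real (n l - r - r) / real (n l)) = real (card (deep r n)) / real (\<Prod>l\<in>UNIV. n l)" for n :: "'d \<Rightarrow> nat"
    unfolding deep_PiE by (subst card_PiE) (auto simp: prod_dividef)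
  ultimately show ?thesis by simp
qed

lemma inverse_card_tendsto:
  "((\<lambda>n :: 'd::finite \<Rightarrow> nat. 1 / real (\<Prod>l\<in>UNIV. n l)) \<longlongrightarrow> 0) multi_at_top"
proof -
  have "((\<lambda>n :: 'd \<Rightarrow> nat. 1 / real (n l)) \<longlongrightarrow> 0) multi_at_top" for l
    by (rule filterlim_compose[OF lim_1_over_n filterlim_multi_at_top])
  then have "((\<lambda>n :: 'd \<Rightarrow> nat. \<Prod>l\<in>UNIV. 1 / real (n l)) \<longlongrightarrow> (\<Prod>l\<in>(UNIV :: 'd set). 0)) multi_at_top"
    by (intro tendsto_prod)
  moreover have "(\<Prod>l\<in>(UNIV :: 'd set). 0 :: real) = 0" by (rule prod_zero) auto
  ultimately have "((\<lambda>n :: 'd \<Rightarrow> nat. \<Prod>l\<in>UNIV. 1 / real (n l)) \<longlongrightarrow> 0) multi_at_top" by (simp only:)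
  then show ?thesis by (simp add: prod_dividef)
qed

section \<open>Powers and eigenvalues of symmetric matrices\<close>

fun mpow :: "'i set \<Rightarrow> ('i \<Rightarrow> 'i \<Rightarrow> real) \<Rightarrow> nat \<Rightarrow> 'i \<Rightarrow> 'i \<Rightarrow> real" where
  "mpow I A 0 i j = (if i = j then 1 else 0)"
| "mpow I A (Suc m) i j = (\<Sum>k\<in>I. mpow I A m i k * A k j)"

lemma mpow_eigenbasis:
  assumes E: "eigenbasis I A \<mu> u" and sym: "\<And>i j. i \<in> I \<Longrightarrow> j \<in> I \<Longrightarrow> A i j = A j i"
  shows "i \<in> I \<Longrightarrow> j \<in> I \<Longrightarrow> mpow I A m i j = (\<Sum>k\<in>I. \<mu> k ^ m * u k i * u k j)"
proof (induction m arbitrary: i j)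
  case 0
  then show ?case using E by (simp add: eigenbasis_def)
next
  case (Suc m)
  have "mpow I A (Suc m) i j = (\<Sum>h\<in>I. \<Sum>k\<in>I. \<mu> k ^ m * u k i * u k h * A h j)"
    using Suc by (simp add: sum_distrib_right)
  also have "\<dots> = (\<Sum>k\<in>I. \<mu> k ^ m * u k i * (\<Sum>h\<in>I. A j h * u k h))"
    using Suc.prems by (subst sum.swap) (auto intro!: sum.cong simp: sum_distrib_left mult_ac sym)
  also have "\<dots> = (\<Sum>k\<in>I. \<mu> k ^ Suc m * u k i * u k j)"
    using E Suc.prems by (intro sum.cong) (auto simp: eigenbasis_def mult_ac)
  finally show ?case .
qed

lemma trace_mpow:
  assumes E: "eigenbasis I A \<mu> u" and sym: "\<And>i j. i \<in> I \<Longrightarrow> j \<in> I \<Longrightarrow> A i j = A j i"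
  shows "(\<Sum>i\<in>I. mpow I A m i i) = (\<Sum>k\<in>I. \<mu> k ^ m)"
proof -
  have "(\<Sum>i\<in>I. mpow I A m i i) = (\<Sum>i\<in>I. \<Sum>k\<in>I. \<mu> k ^ m * (u k i * u k i))"
    by (intro sum.cong) (auto simp: mpow_eigenbasis[OF E sym] mult_ac)
  also have "\<dots> = (\<Sum>k\<in>I. \<mu> k ^ m * (\<Sum>i\<in>I. u k i * u k i))"
    by (subst sum.swap) (simp add: sum_distrib_left)
  also have "\<dots> = (\<Sum>k\<in>I. \<mu> k ^ m)" using E by (simp add: eigenbasis_def)
  finally show ?thesis .
qed

text \<open>Read the eigenvector equation at a coordinate where the modulus of \<open>u k\<close> is
  largest.\<close>

lemma eigenvalue_bound:
  assumes E: "eigenbasis I A \<mu> u" and row: "\<And>i. i \<in> I \<Longrightarrow> (\<Sum>j\<in>I. \<bar>A i j\<bar>) \<le> S" and k: "k \<in> I"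
  shows "\<bar>\<mu> k\<bar> \<le> S"
proof -
  have I: "finite I" using E by (simp add: eigenbasis_def)
  have "Max ((\<lambda>j. \<bar>u k j\<bar>) ` I) \<in> (\<lambda>j. \<bar>u k j\<bar>) ` I" using I k by (intro Max_in) auto
  then obtain i where i1: "i \<in> I" "Max ((\<lambda>j. \<bar>u k j\<bar>) ` I) = \<bar>u k i\<bar>" by auto
  have i2: "\<bar>u k j\<bar> \<le> \<bar>u k i\<bar>" if "j \<in> I" for j
    unfolding i1(2)[symmetric] using I that by (intro Max_ge) auto
  note i = i1(1) i2
  have "u k i \<noteq> 0"
  proof
    assume "u k i = 0"
    then have "u k j = 0" if "j \<in> I" for j using i(2)[OF that] by simp
    then have "(\<Sum>j\<in>I. u k j * u k j) = 0" by simp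
    then show False using E k by (simp add: eigenbasis_def)
  qed
  moreover have "\<bar>\<mu> k\<bar> * \<bar>u k i\<bar> \<le> S * \<bar>u k i\<bar>"
  proof -
    have "\<bar>\<mu> k\<bar> * \<bar>u k i\<bar> = \<bar>\<Sum>j\<in>I. A i j * u k j\<bar>"
      using E k i by (simp add: eigenbasis_def abs_mult)
    also have "\<dots> \<le> (\<Sum>j\<in>I. \<bar>A i j\<bar> * \<bar>u k i\<bar>)"
      by (rule order_trans[OF sum_abs]) (auto intro!: sum_mono mult_left_mono i simp: abs_mult)
    also have "\<dots> \<le> S * \<bar>u k i\<bar>" unfolding sum_distrib_right[symmetric] using row[OF i(1)] by (rule mult_right_mono) simp
    finally show ?thesis .
  qed
  ultimately show ?thesis by simp
qed

text \<open>The right-hand side of the theorem for a real test function: the mean of half the trace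
  of \<open>\<phi>\<close> at the two by two matrix symbol with eigenvalues +-|f|.\<close>

definition radial_average :: "(real ^ 'd::finite \<Rightarrow> complex) \<Rightarrow> (real \<Rightarrow> real) \<Rightarrow> real" where
  "radial_average f \<phi> = (\<integral>\<theta>. (\<phi> (cmod (f \<theta>)) + \<phi> (- cmod (f \<theta>))) / 2 \<partial>box_measure) / (2 * pi) ^ CARD('d)"

text \<open>Left multiplication by the exchange matrix replaces the row i by n - 1 - i, which turns
  the Toeplitz difference i - j into this expression in i + j.\<close>

definition hankel :: "(('d::finite \<Rightarrow> int) \<Rightarrow> real) \<Rightarrow> ('d \<Rightarrow> nat) \<Rightarrow> ('d \<Rightarrow> nat) \<Rightarrow> ('d \<Rightarrow> nat) \<Rightarrow> real" where
  "hankel c n i j = c (\<lambda>l. int (n l) - 1 - int (i l) - int (j l))"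

lemma hankel_sym: "hankel c n i j = hankel c n j i"
  unfolding hankel_def by (rule arg_cong[where f = c]) auto

text \<open>The Fourier coefficients of the functions \<open>P 0 = 1\<close>, \<open>P (m + 1) = p * cnj (P m)\<close> where \<open>p\<close> has coefficients \<open>c\<close>.\<close>

fun moment_coeff :: "(('d::finite \<Rightarrow> int) \<Rightarrow> real) \<Rightarrow> nat \<Rightarrow> nat \<Rightarrow> ('d \<Rightarrow> int) \<Rightarrow> real" where
  "moment_coeff c R 0 w = (if w = (\<lambda>l. 0) then 1 else 0)"
| "moment_coeff c R (Suc m) w = (\<Sum>u\<in>ibox (m * R). moment_coeff c R m u * c (\<lambda>l. w l + u l))"

section \<open>Trigonometric polynomial symbols: moments and limit law\<close>

context
  fixes c :: "('d::finite \<Rightarrow> int) \<Rightarrow> real" and R :: nat and S :: real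
  assumes supp: "\<And>k. k \<notin> ibox R \<Longrightarrow> c k = 0"
  defines "S \<equiv> (\<Sum>k\<in>ibox R. \<bar>c k\<bar>)"
begin

lemma moment_coeff_support: "w \<notin> ibox (m * R) \<Longrightarrow> moment_coeff c R m w = 0"
proof (induction m arbitrary: w)
  case 0
  then show ?case by (auto simp: ibox_def)
next
  case (Suc m)
  have "c (\<lambda>l. w l + u l) = 0" if u: "u \<in> ibox (m * R)" for u
  proof (rule supp)
    show "(\<lambda>l. w l + u l) \<notin> ibox R"
    proof
      assume a: "(\<lambda>l. w l + u l) \<in> ibox R"
      have "\<bar>w l\<bar> \<le> int (Suc m * R)" for l
      proof -
        have "\<bar>w l + u l\<bar> \<le> int R" "\<bar>u l\<bar> \<le> int (m * R)" using a u by (auto simp: ibox_def)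
        then have "\<bar>w l\<bar> \<le> int R + int (m * R)" by linarith
        then show ?thesis by simp
      qed
      then show False using Suc.prems by (auto simp: ibox_def)
    qed
  qed
  then show ?case by simp
qed

text \<open>For fixed \<open>j\<close> different \<open>i\<close> meet different frequencies, so the
  sum is part of the l1 norm \<open>S\<close> of the coefficients. As \<open>S\<close> also bounds
  the symbol, eigenvalues and values of the symbol can share one interval.\<close>

lemma hankel_row_sum: "(\<Sum>i\<in>mindex n. \<bar>hankel c n i j\<bar>) \<le> S"
proof -
  define g where "g = (\<lambda>i :: 'd \<Rightarrow> nat. (\<lambda>l. int (n l) - 1 - int (i l) - int (j l)))"
  have inj: "inj_on g (mindex n)" by (auto simp: inj_on_def g_def fun_eq_iff)
  have "(\<Sum>i\<in>mindex n. \<bar>hankel c n i j\<bar>) = (\<Sum>k\<in>g ` mindex n. \<bar>c k\<bar>)"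
    by (subst sum.reindex[OF inj]) (simp add: hankel_def g_def)
  also have "\<dots> = (\<Sum>k\<in>g ` mindex n \<inter> ibox R. \<bar>c k\<bar>)"
    by (rule sum.mono_neutral_right) (auto simp: supp)
  also have "\<dots> \<le> S" unfolding S_def by (intro sum_mono2) auto
  finally show ?thesis .
qed

lemma coeff_sum_nonneg: "S \<ge> 0" by (simp add: S_def sum_nonneg)

lemma mpow_hankel_bound: "\<bar>mpow (mindex n) (hankel c n) m i j\<bar> \<le> S ^ m"
proof (induction m arbitrary: j)
  case (Suc m)
  have "\<bar>mpow (mindex n) (hankel c n) (Suc m) i j\<bar> \<le> (\<Sum>k\<in>mindex n. S ^ m * \<bar>hankel c n k j\<bar>)"
    unfolding mpow.simps by (rule order_trans[OF sum_abs]) (auto intro!: sum_mono mult_right_mono Suc simp: abs_mult)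
  also have "\<dots> \<le> S ^ m * S" unfolding sum_distrib_left[symmetric]
    by (intro mult_left_mono hankel_row_sum zero_le_power coeff_sum_nonneg)
  finally show ?case by (simp add: mult.commute)
qed simp

text \<open>Truncation to \<open>mindex n\<close> is invisible when the centre \<open>s\<close> is
  far enough from the faces: every frequency u in \<open>ibox r\<close> is then hit by exactly one
  index, k = s - u.\<close>

lemma sum_mindex_shift:
  fixes G :: "('d \<Rightarrow> int) \<Rightarrow> real"
  assumes s: "\<And>l. int r \<le> s l" "\<And>l. s l + int r < int (n l)" and G: "\<And>u. u \<notin> ibox r \<Longrightarrow> G u = 0"
  shows "(\<Sum>k\<in>mindex n. G (\<lambda>l. s l - int (k l))) = (\<Sum>u\<in>ibox r. G u)"
proof (rule sum.reindex_bij_witness_not_neutral[where S' = "{k\<in>mindex n. (\<lambda>l. s l - int (k l)) \<notin> ibox r}"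
      and T' = "{}" and j = "\<lambda>k l. s l - int (k l)" and i = "\<lambda>u l. nat (s l - u l)"])
  fix u :: "'d \<Rightarrow> int" assume "u \<in> ibox r - {}"
  then have u: "\<bar>u l\<bar> \<le> int r" for l by (auto simp: ibox_def)
  have nn: "s l - u l \<ge> 0" "s l - u l < int (n l)" for l using u[of l] s(1)[of l] s(2)[of l] by linarith+
  then show eq: "(\<lambda>l. s l - int (nat (s l - u l))) = u" by auto
  show "(\<lambda>l. nat (s l - u l)) \<in> mindex n - {k \<in> mindex n. (\<lambda>l. s l - int (k l)) \<notin> ibox r}"
    using nn eq u by (auto simp: mindex_def ibox_def nat_less_iff)
qed (auto simp: G)

text \<open>Multiplication by a Hankel matrix is a convolution combined with a reflection, so the
  pattern alternates between i - j and n - 1 - i - j. Each factor widens the band by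
  \<open>R\<close>, hence the distance \<open>m * R\<close> required of the row.\<close>

lemma mpow_hankel_deep:
  assumes "i \<in> deep (m * R) n"
  shows "mpow (mindex n) (hankel c n) m i j =
    moment_coeff c R m (\<lambda>l. (if even m then int (i l) else int (n l) - 1 - int (i l)) - int (j l))"
  using assms
proof (induction m arbitrary: j)
  case 0
  then show ?case by (auto simp: fun_eq_iff)
next
  case (Suc m)
  have i: "i \<in> deep (m * R) n" using Suc.prems by (auto simp: deep_def)
     (metis add_leE, metis add.assoc add.commute add_lessD1)
  \<comment> \<open>The centre of row \<open>i\<close> of the power \<open>m\<close>. With k = s - u
    the index of the next factor is (n - 1 - s - j) + u, which is the argument of \<open>c\<close>
    in the recursion for \<open>moment_coeff\<close>.\<close>
  define s where "s = (\<lambda>l. if even m then int (i l) else int (n l) - 1 - int (i l))"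
  have s: "int (m * R) \<le> s l" "s l + int (m * R) < int (n l)" for l
  proof -
    have "m * R \<le> i l" "i l + m * R < n l" using i by (auto simp: deep_def)
    then have "int (m * R) \<le> int (i l)" "int (i l) + int (m * R) < int (n l)" by linarith+
    then show "int (m * R) \<le> s l" "s l + int (m * R) < int (n l)" unfolding s_def by (cases "even m"; simp)+
  qed
  have eq: "(\<lambda>l. int (n l) - 1 - s l + (s l - int (k l)) - int (j l)) = (\<lambda>l. int (n l) - 1 - int (k l) - int (j l))"
    for k by auto
  have "mpow (mindex n) (hankel c n) (Suc m) i j = (\<Sum>k\<in>mindex n. moment_coeff c R m (\<lambda>l. s l - int (k l)) *
      c (\<lambda>l. int (n l) - 1 - s l + (s l - int (k l)) - int (j l)))"
    unfolding mpow.simps Suc.IH[OF i] hankel_def eq by (simp only: s_def)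
  also have "\<dots> = (\<Sum>u\<in>ibox (m * R). moment_coeff c R m u * c (\<lambda>l. int (n l) - 1 - s l + u l - int (j l)))"
    by (rule sum_mindex_shift[OF s, where G = "\<lambda>u. moment_coeff c R m u * c (\<lambda>l. int (n l) - 1 - s l + u l - int (j l))"])
       (simp add: moment_coeff_support)
  also have "\<dots> = moment_coeff c R (Suc m) (\<lambda>l. (if even (Suc m) then int (i l) else int (n l) - 1 - int (i l)) - int (j l))"
    by (cases "even m") (auto simp: s_def algebra_simps intro!: sum.cong arg_cong[where f = c])
  finally show ?case .
qed

text \<open>Deep rows of an even power share one diagonal entry, the coefficient at frequency 0. For
  an odd power the diagonal entry belongs to frequency n - 1 - 2 i, which leaves the support for all
  but boundedly many \<open>i\<close>. The rows near the faces form a vanishing proportion, and all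
  entries are bounded by \<open>S ^ m\<close>.\<close>

lemma trace_hankel_tendsto:
  "((\<lambda>n. (\<Sum>i\<in>mindex n. mpow (mindex n) (hankel c n) m i i) / real (\<Prod>l\<in>UNIV. n l))
     \<longlongrightarrow> (if even m then moment_coeff c R m (\<lambda>l. 0) else 0)) multi_at_top"
proof -
  define L where "L = (if even m then moment_coeff c R m (\<lambda>l. 0) else 0)"
  define C where "C = S ^ m + \<bar>L\<bar>"
  define b where "b = real (card (ibox (m * R) :: ('d \<Rightarrow> int) set))"
  let ?d = "\<lambda>n. real (\<Prod>l\<in>UNIV. n l)"
  let ?G = "\<lambda>n. real (card (deep (m * R) n))"
  let ?t = "\<lambda>n. \<Sum>i\<in>mindex n. mpow (mindex n) (hankel c n) m i i"
  have C: "C \<ge> 0" using coeff_sum_nonneg by (simp add: C_def)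
  have bound: "\<bar>?t n - ?d n * L\<bar> \<le> C * (b + (?d n - ?G n))" for n
  proof -
    \<comment> \<open>The exceptional deep rows of an odd power, where the anti-diagonal band
      crosses the diagonal. Since i -> n - 1 - 2 i is injective, their number is bounded
      independently of \<open>n\<close>.\<close>
    define E where "E = {i\<in>deep (m * R) n. odd m \<and> (\<lambda>l. int (n l) - 1 - int (i l) - int (i l)) \<in> ibox (m * R)}"
    have finD: "finite (deep (m * R) n)" using finite_subset[OF deep_subset finite_mindex] .
    have zero: "mpow (mindex n) (hankel c n) m i i - L = 0" if "i \<in> deep (m * R) n" "i \<notin> E" for i
      using that by (auto simp: mpow_hankel_deep L_def E_def moment_coeff_support)
    have cE: "card E \<le> card (ibox (m * R) :: ('d \<Rightarrow> int) set)"
      by (rule card_inj_on_le[of "\<lambda>i l. int (n l) - 1 - int (i l) - int (i l)"])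
         (auto simp: inj_on_def E_def fun_eq_iff)
    have "?t n - ?d n * L = (\<Sum>i\<in>mindex n. mpow (mindex n) (hankel c n) m i i - L)"
      by (simp add: sum_subtractf card_mindex)
    also have "\<dots> = (\<Sum>i\<in>(mindex n - deep (m * R) n) \<union> E. mpow (mindex n) (hankel c n) m i i - L)"
      using deep_subset[of "m * R" n] zero by (intro sum.mono_neutral_right) (auto simp: E_def)
    also have "\<bar>\<dots>\<bar> \<le> (\<Sum>i\<in>(mindex n - deep (m * R) n) \<union> E. C)"
    proof (rule order_trans[OF sum_abs], rule sum_mono)
      fix i
      show "\<bar>mpow (mindex n) (hankel c n) m i i - L\<bar> \<le> C"
        using mpow_hankel_bound[of n m i i] unfolding C_def by linarith
    qed
    also have "\<dots> = real (card ((mindex n - deep (m * R) n) \<union> E)) * C" by simp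
    also have "\<dots> \<le> (?d n - ?G n + b) * C"
    proof (rule mult_right_mono[OF _ C])
      have "card ((mindex n - deep (m * R) n) \<union> E) \<le> card (mindex n - deep (m * R) n) + card E" by (rule card_Un_le)
      also have "card (mindex n - deep (m * R) n) = card (mindex n) - card (deep (m * R) n)"
        by (rule card_Diff_subset[OF finD deep_subset])
      finally have "real (card ((mindex n - deep (m * R) n) \<union> E)) \<le> real (card (mindex n) - card (deep (m * R) n)) + real (card E)"
        by linarith
      also have "real (card (mindex n) - card (deep (m * R) n)) = ?d n - ?G n"
        using card_mono[OF finite_mindex deep_subset[of "m * R" n]] by (simp add: of_nat_diff card_mindex)
      finally show "real (card ((mindex n - deep (m * R) n) \<union> E)) \<le> ?d n - ?G n + b" using cE by (simp add: b_def)
    qed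
    finally show ?thesis by (simp add: algebra_simps)
  qed
  have lim: "((\<lambda>n. C * (b * (1 / ?d n) + (1 - ?G n / ?d n))) \<longlongrightarrow> C * (b * 0 + (1 - 1))) multi_at_top"
    by (intro tendsto_intros inverse_card_tendsto card_deep_tendsto)
  have ev: "eventually (\<lambda>n. norm (?t n / ?d n - L) \<le> C * (b * (1 / ?d n) + (1 - ?G n / ?d n))) multi_at_top"
    unfolding eventually_multi_at_top
  proof (intro exI[of _ 1] allI impI)
    fix n :: "'d \<Rightarrow> nat" assume "\<forall>l. 1 \<le> n l"
    then have "(\<Prod>l\<in>UNIV. n l) > 0" by (intro prod_pos) (auto simp: Suc_le_eq)
    then have d: "?d n > 0" by (simp only: of_nat_0_less_iff)
    have "?t n / ?d n - L = (?t n - ?d n * L) / ?d n"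
      using d by (simp add: diff_divide_distrib del: of_nat_prod)
    then have "norm (?t n / ?d n - L) = \<bar>?t n - ?d n * L\<bar> / ?d n"
      using d by (simp del: of_nat_prod)
    also have "\<dots> \<le> C * (b + (?d n - ?G n)) / ?d n" using bound d by (intro divide_right_mono) auto
    also have "\<dots> = C * (b * (1 / ?d n) + (1 - ?G n / ?d n))" using d by (simp add: field_simps del: of_nat_prod)
    finally show "norm (?t n / ?d n - L) \<le> C * (b * (1 / ?d n) + (1 - ?G n / ?d n))" .
  qed
  have "((\<lambda>n. ?t n / ?d n - L) \<longlongrightarrow> 0) multi_at_top"
    using Lim_null_comparison[OF ev] lim by simp
  then show ?thesis unfolding L_def[symmetric] by (simp add: LIM_zero_iff)
qed


definition symbol_power :: "nat \<Rightarrow> real ^ 'd \<Rightarrow> complex" where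
  "symbol_power m \<theta> = (\<Sum>u\<in>ibox (m * R). of_real (moment_coeff c R m u) * trig_exp u \<theta>)"

abbreviation "symbol \<theta> \<equiv> (\<Sum>k\<in>ibox R. of_real (c k) * trig_exp k \<theta>)"

lemma symbol_power_0: "symbol_power 0 \<theta> = 1"
proof -
  have "(ibox 0 :: ('d \<Rightarrow> int) set) = {\<lambda>l. 0}" by (auto simp: ibox_def)
  then show ?thesis by (simp add: symbol_power_def)
qed

text \<open>Real coefficients make conjugation a reflection of frequencies, so the product collects
  at frequency w the pairs with v - u = w, that is v = w + u, as in the recursion for
  \<open>moment_coeff\<close>.\<close>

lemma symbol_power_Suc: "symbol_power (Suc m) \<theta> = symbol \<theta> * cnj (symbol_power m \<theta>)"
proof -
  have shift: "(\<Sum>w\<in>ibox (Suc m * R). of_real (c (\<lambda>l. w l + u l)) * trig_exp w \<theta>) = symbol \<theta> * cnj (trig_exp u \<theta>)"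
    if u: "u \<in> ibox (m * R)" for u :: "'d \<Rightarrow> int"
  proof -
    have "(\<Sum>w\<in>ibox (Suc m * R). of_real (c (\<lambda>l. w l + u l)) * trig_exp w \<theta>)
       = (\<Sum>v\<in>ibox R. of_real (c v) * trig_exp (\<lambda>l. v l + - u l) \<theta>)"
    proof (rule sum.reindex_bij_witness_not_neutral[where S' = "{w\<in>ibox (Suc m * R). (\<lambda>l. w l + u l) \<notin> ibox R}"
          and T' = "{}" and j = "\<lambda>w l. w l + u l" and i = "\<lambda>v l. v l + - u l"])
      fix v :: "'d \<Rightarrow> int" assume v: "v \<in> ibox R - {}"
      have "\<bar>v l + - u l\<bar> \<le> int (Suc m * R)" for l
      proof -
        have "\<bar>v l\<bar> \<le> int R" "\<bar>u l\<bar> \<le> int (m * R)" using v u by (auto simp: ibox_def)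
        then have "\<bar>v l + - u l\<bar> \<le> int R + int (m * R)" by linarith
        then show ?thesis by simp
      qed
      then show "(\<lambda>l. v l + - u l) \<in> ibox (Suc m * R) - {w \<in> ibox (Suc m * R). (\<lambda>l. w l + u l) \<notin> ibox R}"
        using v by (auto simp: ibox_def)
    qed (auto simp: supp)
    then show ?thesis by (simp only: trig_exp_add trig_exp_uminus) (simp add: sum_distrib_right mult.assoc)
  qed
  have "symbol_power (Suc m) \<theta> = (\<Sum>w\<in>ibox (Suc m * R). \<Sum>u\<in>ibox (m * R).
      of_real (moment_coeff c R m u) * (of_real (c (\<lambda>l. w l + u l)) * trig_exp w \<theta>))"
    by (simp add: symbol_power_def sum_distrib_right mult.assoc)
  also have "\<dots> = (\<Sum>u\<in>ibox (m * R). of_real (moment_coeff c R m u) *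
      (\<Sum>w\<in>ibox (Suc m * R). of_real (c (\<lambda>l. w l + u l)) * trig_exp w \<theta>))"
    by (subst sum.swap) (simp only: sum_distrib_left)
  also have "\<dots> = (\<Sum>u\<in>ibox (m * R). of_real (moment_coeff c R m u) * (symbol \<theta> * cnj (trig_exp u \<theta>)))"
    by (intro sum.cong refl arg_cong2[where f = "(*)"] shift)
  also have "\<dots> = symbol \<theta> * cnj (symbol_power m \<theta>)"
    by (simp add: symbol_power_def sum_distrib_left mult_ac)
  finally show ?thesis .
qed

text \<open>Two steps of the recursion multiply by the squared modulus of the symbol.\<close>

lemma symbol_power_even: "symbol_power (2 * m) \<theta> = of_real (cmod (symbol \<theta>) ^ (2 * m))"
proof (induction m)
  case (Suc m)
  have "symbol_power (2 * Suc m) \<theta> = symbol \<theta> * cnj (symbol \<theta> * cnj (symbol_power (2 * m) \<theta>))"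
    by (simp only: mult_Suc_right numeral_2_eq_2 add_Suc add_0 symbol_power_Suc)
  also have "\<dots> = (symbol \<theta> * cnj (symbol \<theta>)) * symbol_power (2 * m) \<theta>"
    by (simp only: complex_cnj_mult complex_cnj_cnj mult.assoc)
  also have "symbol \<theta> * cnj (symbol \<theta>) = of_real ((cmod (symbol \<theta>))\<^sup>2)" by (rule complex_norm_square[symmetric])
  finally show ?case by (simp only: Suc.IH) (simp add: power_add[symmetric])
qed (simp add: symbol_power_0)

abbreviation "symbol_average \<equiv> radial_average (\<lambda>\<theta>. symbol \<theta>)"

text \<open>For even \<open>m\<close> this is the mean of \<open>symbol_power m\<close>, that is,
  its coefficient at frequency 0; for odd \<open>m\<close> the two signs cancel.\<close>

lemma symbol_average_power:
  "symbol_average (\<lambda>x. x ^ m) = (if even m then moment_coeff c R m (\<lambda>l. 0) else 0)"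
proof (cases "even m")
  case True
  then obtain h where h: "m = 2 * h" by blast
  have "(\<integral>\<theta>. symbol_power m \<theta> \<partial>box_measure) = (\<Sum>u\<in>ibox (m * R). of_real (moment_coeff c R m u) * (\<integral>\<theta>. trig_exp u \<theta> \<partial>box_measure))"
    unfolding symbol_power_def
    by (subst Bochner_Integration.integral_sum) (auto intro!: integrable_box_continuous continuous_intros)
  also have "\<dots> = (\<Sum>u::'d \<Rightarrow> int\<in>ibox (m * R). if u = (\<lambda>l. 0) then of_real (moment_coeff c R m (\<lambda>l. 0)) * of_real ((2 * pi) ^ CARD('d)) else 0)"
    by (intro sum.cong) (auto simp: integral_trig_exp)
  also have "\<dots> = of_real (moment_coeff c R m (\<lambda>l. 0) * (2 * pi) ^ CARD('d))"
    by (subst sum.delta[OF finite_ibox]) (simp add: ibox_def)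
  finally have "(\<integral>\<theta>. complex_of_real (cmod (symbol \<theta>) ^ m) \<partial>box_measure) = of_real (moment_coeff c R m (\<lambda>l. 0) * (2 * pi) ^ CARD('d))"
    unfolding h symbol_power_even .
  then have "(\<integral>\<theta>. cmod (symbol \<theta>) ^ m \<partial>box_measure) = moment_coeff c R m (\<lambda>l. 0) * (2 * pi) ^ CARD('d)"
    unfolding integral_complex_of_real by (simp only: of_real_eq_iff)
  then show ?thesis using True by (simp add: radial_average_def)
next
  case False
  then show ?thesis by (simp add: radial_average_def)
qed

lemma cmod_symbol_le: "cmod (symbol \<theta>) \<le> S"
  unfolding S_def by (rule order_trans[OF norm_sum]) (simp add: norm_mult)

lemma integrable_symbol:
  assumes "continuous_on UNIV \<phi>"
  shows "integrable box_measure (\<lambda>\<theta>. (\<phi> (cmod (symbol \<theta>)) + \<phi> (- cmod (symbol \<theta>))) / 2 :: real)"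
  by (intro integrable_box_continuous continuous_intros continuous_on_compose2[OF assms]) auto

theorem hankel_trig_poly_distribution:
  assumes \<phi>: "continuous_on UNIV \<phi>"
    and sums: "\<And>n. eigenbasis (mindex n) (hankel c n) (\<mu> n) (u n)"
  shows "((\<lambda>n. (\<Sum>k\<in>mindex n. \<phi> (\<mu> n k)) / real (\<Prod>l\<in>UNIV. n l)) \<longlongrightarrow> symbol_average \<phi>) multi_at_top"
proof (rule tendsto_uniform_approx)
  fix e :: real assume e: "e > 0"
  \<comment> \<open>The interval contains the eigenvalues for every \<open>n\<close> as well as plus
    and minus the modulus of the symbol, so one polynomial serves both sides of the limit.\<close>
  have contS: "continuous_on {-S..S} \<phi>" using \<phi> continuous_on_subset by blast
  obtain Q where Q: "real_polynomial_function Q" "\<And>x. x \<in> {-S..S} \<Longrightarrow> \<bar>\<phi> x - Q x\<bar> < e"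
    using Stone_Weierstrass_real_polynomial_function[OF _ contS e] by auto
  obtain b N where QN: "Q = (\<lambda>x. \<Sum>i\<le>N. b i * x ^ i)"
    using Q(1) real_polynomial_function_iff_sum by blast
  have Qc: "continuous_on UNIV Q" unfolding QN by (intro continuous_intros)
  have avgQ: "symbol_average Q = (\<Sum>i\<le>N. b i * symbol_average (\<lambda>x. x ^ i))"
  proof -
    define G where "G = (\<lambda>i \<theta>. (cmod (symbol \<theta>) ^ i + (- cmod (symbol \<theta>)) ^ i) / 2)"
    have i: "integrable box_measure (G i)" for i
      unfolding G_def by (rule integrable_symbol) (intro continuous_intros)
    have "(\<integral>\<theta>. (Q (cmod (symbol \<theta>)) + Q (- cmod (symbol \<theta>))) / 2 \<partial>box_measure)
        = (\<integral>\<theta>. (\<Sum>i\<le>N. b i * G i \<theta>) \<partial>box_measure)"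
      by (simp only: G_def QN sum.distrib[symmetric] sum_divide_distrib distrib_left times_divide_eq_right)
    also have "\<dots> = (\<Sum>i\<le>N. b i * (\<integral>\<theta>. G i \<theta> \<partial>box_measure))"
      using i by (subst Bochner_Integration.integral_sum) auto
    finally show ?thesis unfolding radial_average_def G_def by (simp only: sum_divide_distrib times_divide_eq_right)
  qed
  have tr: "(\<Sum>k\<in>mindex n. \<mu> n k ^ m) = (\<Sum>i\<in>mindex n. mpow (mindex n) (hankel c n) m i i)" for n m
    by (rule trace_mpow[OF sums hankel_sym, symmetric])
  have "((\<lambda>n. \<Sum>i\<le>N. b i * ((\<Sum>k\<in>mindex n. \<mu> n k ^ i) / real (\<Prod>l\<in>UNIV. n l))) \<longlongrightarrow> symbol_average Q) multi_at_top"
    unfolding avgQ tr symbol_average_power by (intro tendsto_intros trace_hankel_tendsto)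
  moreover have "(\<Sum>i\<le>N. b i * ((\<Sum>k\<in>mindex n. \<mu> n k ^ i) / d)) = (\<Sum>k\<in>mindex n. Q (\<mu> n k)) / d" for n d
    unfolding QN by (subst sum.swap) (simp add: sum_distrib_left sum_divide_distrib)
  ultimately have lim: "((\<lambda>n. (\<Sum>k\<in>mindex n. Q (\<mu> n k)) / real (\<Prod>l\<in>UNIV. n l)) \<longlongrightarrow> symbol_average Q) multi_at_top"
    by simp
  have close: "\<bar>(\<Sum>k\<in>mindex n. \<phi> (\<mu> n k)) / real (\<Prod>l\<in>UNIV. n l) - (\<Sum>k\<in>mindex n. Q (\<mu> n k)) / real (\<Prod>l\<in>UNIV. n l)\<bar> \<le> e" for n
  proof -
    have mu: "\<mu> n k \<in> {-S..S}" if "k \<in> mindex n" for k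
    proof -
      have "\<bar>\<mu> n k\<bar> \<le> S"
        by (rule eigenvalue_bound[OF sums _ that]) (subst hankel_sym, rule hankel_row_sum)
      then show ?thesis by auto
    qed
    have "\<bar>(\<Sum>k\<in>mindex n. \<phi> (\<mu> n k)) - (\<Sum>k\<in>mindex n. Q (\<mu> n k))\<bar> \<le> (\<Sum>k\<in>mindex n. e)"
      unfolding sum_subtractf[symmetric]
      by (rule order_trans[OF sum_abs]) (intro sum_mono less_imp_le Q(2) mu)
    also have "\<dots> = e * real (\<Prod>l\<in>UNIV. n l)" by (simp add: card_mindex mult.commute)
    finally have "\<bar>(\<Sum>k\<in>mindex n. \<phi> (\<mu> n k)) - (\<Sum>k\<in>mindex n. Q (\<mu> n k))\<bar> \<le> e * real (\<Prod>l\<in>UNIV. n l)" .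
    then show ?thesis using e
      by (simp add: diff_divide_distrib[symmetric] abs_divide divide_le_eq del: of_nat_prod)
  qed
  have "\<bar>symbol_average \<phi> - symbol_average Q\<bar> \<le> e"
  proof -
    interpret finite_measure "box_measure :: (real ^ 'd) measure" by (rule finite_measure_box)
    have aux: "\<bar>(a + b) / 2 - (a' + b') / 2\<bar> \<le> e" if "\<bar>a - a'\<bar> < e" "\<bar>b - b'\<bar> < e" for a b a' b' :: real
      using that by (auto simp: abs_le_iff abs_less_iff field_simps)
    note ints = integrable_symbol[OF \<phi>] integrable_symbol[OF Qc]
    let ?g = "\<lambda>\<psi> \<theta>. (\<psi> (cmod (symbol \<theta>)) + \<psi> (- cmod (symbol \<theta>))) / 2 :: real"
    have "\<bar>(\<integral>\<theta>. ?g \<phi> \<theta> \<partial>box_measure) - (\<integral>\<theta>. ?g Q \<theta> \<partial>box_measure)\<bar> = \<bar>\<integral>\<theta>. ?g \<phi> \<theta> - ?g Q \<theta> \<partial>box_measure\<bar>"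
      by (subst Bochner_Integration.integral_diff[OF ints]) simp
    also have "\<dots> \<le> (\<integral>\<theta>. \<bar>?g \<phi> \<theta> - ?g Q \<theta>\<bar> \<partial>box_measure)" by (rule integral_abs_bound)
    also have "\<dots> \<le> (\<integral>\<theta>. e \<partial>(box_measure :: (real ^ 'd) measure))"
    proof (rule integral_mono)
      fix \<theta> :: "real ^ 'd"
      have "cmod (symbol \<theta>) \<in> {-S..S}" "- cmod (symbol \<theta>) \<in> {-S..S}" using cmod_symbol_le[of \<theta>] coeff_sum_nonneg
        norm_ge_zero[of "symbol \<theta>"] unfolding atLeastAtMost_iff by linarith+
      from this[THEN Q(2)] show "\<bar>?g \<phi> \<theta> - ?g Q \<theta>\<bar> \<le> e" by (rule aux)
    qed (auto intro!: Bochner_Integration.integrable_abs Bochner_Integration.integrable_diff ints simp del: integrable_divide_zero)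
    also have "\<dots> = e * (2 * pi) ^ CARD('d)" by (simp add: measure_box_measure)
    finally show ?thesis unfolding radial_average_def
      by (simp add: diff_divide_distrib[symmetric] abs_divide divide_le_eq)
  qed
  with lim close show "\<exists>g L'. (g \<longlongrightarrow> L') multi_at_top \<and>
      eventually (\<lambda>n. \<bar>(\<Sum>k\<in>mindex n. \<phi> (\<mu> n k)) / real (\<Prod>l\<in>UNIV. n l) - g n\<bar> \<le> e) multi_at_top \<and> \<bar>symbol_average \<phi> - L'\<bar> \<le> e"
    by (intro exI[of _ "\<lambda>n. (\<Sum>k\<in>mindex n. Q (\<mu> n k)) / real (\<Prod>l\<in>UNIV. n l)"] exI[of _ "symbol_average Q"]) (simp del: of_nat_prod)
qed

end

section \<open>Integrable symbols\<close>

lemma charpoly_cong: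
  assumes "\<And>i j. i \<in> I \<Longrightarrow> j \<in> I \<Longrightarrow> M i j = M' i j"
  shows "charpoly I M = charpoly I M'"
  unfolding charpoly_def
proof (intro sum.cong refl arg_cong2[where f = "(*)"] prod.cong)
  fix p i assume "p \<in> {p. p permutes I}" "i \<in> I"
  then have "p i \<in> I" by (simp add: permutes_in_image)
  then show "(if p i = i then [:- M i i, 1:] else [:- M i (p i):]) = (if p i = i then [:- M' i i, 1:] else [:- M' i (p i):])"
    using assms \<open>i \<in> I\<close> by simp
qed

lemma eig_sum_cong:
  assumes "\<And>i j. i \<in> I \<Longrightarrow> j \<in> I \<Longrightarrow> M i j = M' i j"
  shows "eig_sum I M F = eig_sum I M' F"
proof -
  have "charpoly I M = charpoly I M'" by (rule charpoly_cong[OF assms])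
  then show ?thesis by (simp only: eig_sum_def)
qed

lemma toeplitz_entry:
  assumes i: "i \<in> mindex n" and j: "j \<in> mindex n"
  shows "toeplitz f n i j = fourier_coeff f (\<lambda>l. int (i l) - int (j l))"
proof -
  let ?K = "{k :: 'a \<Rightarrow> int. \<forall>l. \<bar>k l\<bar> < int (n l)}"
  \<comment> \<open>Finiteness matters because a sum over an infinite set is 0 by
    convention.\<close>
  have fin: "finite ?K"
  proof (rule finite_subset[OF _ finite_ibox])
    show "?K \<subseteq> ibox (\<Sum>l\<in>UNIV. n l)"
    proof
      fix k assume k: "k \<in> ?K"
      have "\<bar>k l\<bar> \<le> int (\<Sum>l\<in>UNIV. n l)" for l
      proof -
        have "n l \<le> (\<Sum>l\<in>UNIV. n l)" by (rule member_le_sum) auto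
        moreover have "\<bar>k l\<bar> < int (n l)" using k by auto
        ultimately show ?thesis by linarith
      qed
      then show "k \<in> ibox (\<Sum>l\<in>UNIV. n l)" unfolding ibox_def by blast
    qed
  qed
  have "toeplitz f n i j = (\<Sum>k\<in>?K. if k = (\<lambda>l. int (i l) - int (j l)) then fourier_coeff f k else 0)"
    unfolding toeplitz_def
  proof (intro sum.cong refl)
    fix k :: "'a \<Rightarrow> int"
    show "(\<Prod>l\<in>UNIV. if int (i l) - int (j l) = k l then 1 else 0) * fourier_coeff f k
        = (if k = (\<lambda>l. int (i l) - int (j l)) then fourier_coeff f k else 0)"
      by (cases "k = (\<lambda>l. int (i l) - int (j l))") (simp, auto simp: fun_eq_iff, metis)
  qed
  also have "\<dots> = fourier_coeff f (\<lambda>l. int (i l) - int (j l))"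
  proof -
    have "(\<lambda>l. int (i l) - int (j l)) \<in> ?K"
    proof -
      have "\<bar>int (i l) - int (j l)\<bar> < int (n l)" for l
      proof -
        have "i l < n l" "j l < n l" using i j by (auto simp: mindex_def)
        then show ?thesis by linarith
      qed
      then show ?thesis by simp
    qed
    then show ?thesis by (subst sum.delta[OF fin]) simp
  qed
  finally show ?thesis .
qed

lemma exchange_toeplitz_entry:
  assumes i: "i \<in> mindex n" and j: "j \<in> mindex n"
  shows "mmult (mindex n) (exchange n) (toeplitz f n) i j
    = fourier_coeff f (\<lambda>l. int (n l) - 1 - int (i l) - int (j l))"
proof -
  \<comment> \<open>The only column in which row \<open>i\<close> of the exchange matrix is nonzero;
    the natural number subtraction is exact because \<open>i l < n l\<close>.\<close>
  define r where "r = (\<lambda>l. n l - 1 - i l)"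
  have il: "i l < n l" for l using i by (auto simp: mindex_def)
  have "r l < n l" for l unfolding r_def using il[of l] by linarith
  then have r: "r \<in> mindex n" by (simp add: mindex_def)
  have "exchange n i k = (if k = r then 1 else 0)" for k
  proof (cases "k = r")
    case True
    have "i l + r l = n l - 1" for l using il[of l] by (simp add: r_def)
    then show ?thesis using True by (simp add: exchange_def)
  next
    case False
    then obtain l where "k l \<noteq> r l" by auto
    then have "i l + k l \<noteq> n l - 1" by (auto simp: r_def)
    then show ?thesis using False by (auto simp: exchange_def intro!: prod_zero)
  qed
  then have "mmult (mindex n) (exchange n) (toeplitz f n) i j = (\<Sum>k\<in>mindex n. if k = r then toeplitz f n k j else 0)"
    unfolding mmult_def by (intro sum.cong) auto
  also have "\<dots> = toeplitz f n r j" using r by simp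
  also have "\<dots> = fourier_coeff f (\<lambda>l. int (r l) - int (j l))" by (rule toeplitz_entry[OF r j])
  also have "(\<lambda>l. int (r l) - int (j l)) = (\<lambda>l. int (n l) - 1 - int (i l) - int (j l))"
  proof
    fix l
    show "int (r l) - int (j l) = int (n l) - 1 - int (i l) - int (j l)" using il[of l] by (simp add: r_def of_nat_diff)
  qed
  finally show ?thesis .
qed

text \<open>Every \<open>k\<close> occurs as i - j, with i and j the positive and negative parts of
  \<open>k\<close>, once level l has size |k l| + 1.\<close>

lemma fourier_coeff_real:
  assumes "\<And>n::'d::finite \<Rightarrow> nat. (\<forall>l. 0 < n l) \<Longrightarrow> \<forall>i\<in>mindex n. \<forall>j\<in>mindex n. toeplitz f n i j \<in> \<real>"
  shows "fourier_coeff f k \<in> \<real>"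
proof -
  define n where "n = (\<lambda>l. nat \<bar>k l\<bar> + 1)"
  define i where "i = (\<lambda>l. nat (k l))"
  define j where "j = (\<lambda>l. nat (- k l))"
  have ij: "i \<in> mindex n" "j \<in> mindex n" by (auto simp: mindex_def n_def i_def j_def)
  have "toeplitz f n i j = fourier_coeff f k"
    unfolding toeplitz_entry[OF ij] by (rule arg_cong[where f = "fourier_coeff f"]) (auto simp: i_def j_def)
  moreover have "toeplitz f n i j \<in> \<real>" using assms[of n] ij by (auto simp: n_def)
  ultimately show ?thesis by simp
qed

section \<open>From trigonometric polynomials to integrable symbols\<close>

lemma integrable_radial:
  fixes f :: "real ^ 'd::finite \<Rightarrow> complex" and \<phi> :: "real \<Rightarrow> real"
  assumes f: "integrable box_measure f" and \<phi>: "continuous_on UNIV \<phi>" and B: "\<And>x. \<bar>\<phi> x\<bar> \<le> B"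
  shows "integrable box_measure (\<lambda>\<theta>. (\<phi> (cmod (f \<theta>)) + \<phi> (- cmod (f \<theta>))) / 2)"
proof -
  interpret finite_measure "box_measure :: (real ^ 'd) measure" by (rule finite_measure_box)
  have m\<phi>: "\<phi> \<in> borel_measurable borel" by (rule borel_measurable_continuous_onI[OF \<phi>])
  have mf: "f \<in> borel_measurable box_measure" using f by simp
  have "AE \<theta> in box_measure. norm ((\<phi> (cmod (f \<theta>)) + \<phi> (- cmod (f \<theta>))) / 2) \<le> B"
  proof (intro AE_I2)
    fix \<theta>
    show "norm ((\<phi> (cmod (f \<theta>)) + \<phi> (- cmod (f \<theta>))) / 2) \<le> B"
      using B[of "cmod (f \<theta>)"] B[of "- cmod (f \<theta>)"] by (auto simp: abs_le_iff field_simps)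
  qed
  moreover have "(\<lambda>\<theta>. (\<phi> (cmod (f \<theta>)) + \<phi> (- cmod (f \<theta>))) / 2) \<in> borel_measurable box_measure"
    using mf m\<phi> by measurable
  ultimately show ?thesis by (intro integrable_const_bound)
qed

lemma radial_average_diff:
  fixes f g :: "real ^ 'd::finite \<Rightarrow> complex" and \<phi> \<psi> :: "real \<Rightarrow> real"
  assumes i: "integrable box_measure (\<lambda>\<theta>. (\<phi> (cmod (f \<theta>)) + \<phi> (- cmod (f \<theta>))) / 2)"
      "integrable box_measure (\<lambda>\<theta>. (\<psi> (cmod (g \<theta>)) + \<psi> (- cmod (g \<theta>))) / 2)"
    and h: "integrable box_measure h"
    and le: "\<And>\<theta>. \<bar>\<phi> (cmod (f \<theta>)) - \<psi> (cmod (g \<theta>))\<bar> \<le> h \<theta>" "\<And>\<theta>. \<bar>\<phi> (- cmod (f \<theta>)) - \<psi> (- cmod (g \<theta>))\<bar> \<le> h \<theta>"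
  shows "\<bar>radial_average f \<phi> - radial_average g \<psi>\<bar> \<le> (\<integral>\<theta>. h \<theta> \<partial>box_measure) / (2 * pi) ^ CARD('d)"
proof -
  let ?a = "\<lambda>\<theta>. (\<phi> (cmod (f \<theta>)) + \<phi> (- cmod (f \<theta>))) / 2"
  let ?b = "\<lambda>\<theta>. (\<psi> (cmod (g \<theta>)) + \<psi> (- cmod (g \<theta>))) / 2"
  have "\<bar>(\<integral>\<theta>. ?a \<theta> \<partial>box_measure) - (\<integral>\<theta>. ?b \<theta> \<partial>box_measure)\<bar> = \<bar>\<integral>\<theta>. ?a \<theta> - ?b \<theta> \<partial>box_measure\<bar>"
    by (subst Bochner_Integration.integral_diff[OF i]) simp
  also have "\<dots> \<le> (\<integral>\<theta>. \<bar>?a \<theta> - ?b \<theta>\<bar> \<partial>box_measure)" by (rule integral_abs_bound)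
  also have "\<dots> \<le> (\<integral>\<theta>. h \<theta> \<partial>box_measure)"
  proof (rule integral_mono[OF Bochner_Integration.integrable_abs[OF Bochner_Integration.integrable_diff[OF i]] h])
    fix \<theta>
    show "\<bar>?a \<theta> - ?b \<theta>\<bar> \<le> h \<theta>" using le[of \<theta>] by (auto simp: abs_le_iff field_simps)
  qed
  finally have "\<bar>(\<integral>\<theta>. ?a \<theta> \<partial>box_measure) - (\<integral>\<theta>. ?b \<theta> \<partial>box_measure)\<bar> / (2 * pi) ^ CARD('d)
      \<le> (\<integral>\<theta>. h \<theta> \<partial>box_measure) / (2 * pi) ^ CARD('d)"
    by (rule divide_right_mono) simp
  moreover have "\<bar>x / (2 * pi) ^ CARD('d) - y / (2 * pi) ^ CARD('d)\<bar> = \<bar>x - y\<bar> / (2 * pi) ^ CARD('d)" for x y :: real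
    by (simp add: diff_divide_distrib[symmetric] abs_divide)
  ultimately show ?thesis unfolding radial_average_def by (simp only:)
qed

text \<open>The frequency n - 1 - i - j is additive in i and j, so the exponential splits into
  unimodular factors \<open>e0 \<theta> * e \<theta> i * e \<theta> j\<close>. The pairing with
  \<open>C\<close> is thus the real part of a normalised integral of \<open>g\<close> against
  \<open>e0\<close> times the bilinear form of \<open>C\<close> at a unimodular vector, which
  \<open>\<kappa>\<close> bounds for each \<open>\<theta>\<close>.\<close>

lemma hankel_difference_trace:
  fixes g :: "real ^ 'd::finite \<Rightarrow> complex" and C :: "('d \<Rightarrow> nat) \<Rightarrow> ('d \<Rightarrow> nat) \<Rightarrow> real"
  assumes g: "integrable box_measure g"
    and \<kappa>: "\<And>z. (\<And>i. cmod (z i) = 1) \<Longrightarrow> cmod (\<Sum>i\<in>mindex n. \<Sum>j\<in>mindex n. of_real (C i j) * z i * z j) \<le> \<kappa>"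
  shows "\<bar>\<Sum>i\<in>mindex n. \<Sum>j\<in>mindex n. hankel (\<lambda>k. Re (fourier_coeff g k)) n i j * C i j\<bar>
    \<le> \<kappa> * ((\<integral>\<theta>. cmod (g \<theta>) \<partial>box_measure) / (2 * pi) ^ CARD('d))"
proof -
  let ?I = "mindex n"
  let ?V = "(2 * pi) ^ CARD('d)"
  define k where "k = (\<lambda>(i :: 'd \<Rightarrow> nat) (j :: 'd \<Rightarrow> nat) l. int (n l) - 1 - int (i l) - int (j l))"
  define e where "e = (\<lambda>\<theta> (i :: 'd \<Rightarrow> nat). trig_exp (\<lambda>l. int (i l)) \<theta>)"
  define e0 where "e0 = (\<lambda>\<theta>. trig_exp (\<lambda>l. 1 - int (n l)) \<theta>)"
  have ek: "trig_exp (\<lambda>l. - k i j l) \<theta> = e0 \<theta> * e \<theta> i * e \<theta> j" for i j \<theta>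
    unfolding e_def e0_def trig_exp_add[symmetric] k_def by (rule arg_cong[where f = "\<lambda>x. trig_exp x \<theta>"]) auto
  have ik: "integrable box_measure (\<lambda>\<theta>. g \<theta> * trig_exp m \<theta>)" for m
    by (intro integrable_box_mult_continuous g continuous_intros)
  have int: "integrable box_measure (\<lambda>\<theta>. of_real (C i j) * (g \<theta> * trig_exp (\<lambda>l. - k i j l) \<theta>))" for i j
    using ik by simp
  have "(\<Sum>i\<in>?I. \<Sum>j\<in>?I. hankel (\<lambda>k. Re (fourier_coeff g k)) n i j * C i j)
      = Re (\<Sum>i\<in>?I. \<Sum>j\<in>?I. of_real (C i j) * fourier_coeff g (k i j))"
    by (simp add: hankel_def k_def mult.commute)
  also have "(\<Sum>i\<in>?I. \<Sum>j\<in>?I. of_real (C i j) * fourier_coeff g (k i j))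
     = (\<Sum>i\<in>?I. \<Sum>j\<in>?I. (\<integral>\<theta>. of_real (C i j) * (g \<theta> * trig_exp (\<lambda>l. - k i j l) \<theta>) \<partial>box_measure) / of_real ?V)"
    by (simp add: fourier_coeff_lebesgue[OF g])
  also have "\<dots> = (\<integral>\<theta>. (\<Sum>i\<in>?I. \<Sum>j\<in>?I. of_real (C i j) * (g \<theta> * trig_exp (\<lambda>l. - k i j l) \<theta>)) \<partial>box_measure) / of_real ?V"
    unfolding sum_divide_distrib[symmetric]
    by (subst Bochner_Integration.integral_sum, intro Bochner_Integration.integrable_sum int,
        intro arg_cong2[where f = "(/)"] sum.cong refl, rule Bochner_Integration.integral_sum[symmetric], rule int)
  also have "(\<lambda>\<theta>. (\<Sum>i\<in>?I. \<Sum>j\<in>?I. of_real (C i j) * (g \<theta> * trig_exp (\<lambda>l. - k i j l) \<theta>)))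
     = (\<lambda>\<theta>. g \<theta> * (e0 \<theta> * (\<Sum>i\<in>?I. \<Sum>j\<in>?I. of_real (C i j) * e \<theta> i * e \<theta> j)))"
    by (simp add: ek sum_distrib_left mult_ac)
  finally have eq: "(\<Sum>i\<in>?I. \<Sum>j\<in>?I. hankel (\<lambda>k. Re (fourier_coeff g k)) n i j * C i j)
      = Re ((\<integral>\<theta>. g \<theta> * (e0 \<theta> * (\<Sum>i\<in>?I. \<Sum>j\<in>?I. of_real (C i j) * e \<theta> i * e \<theta> j)) \<partial>box_measure) / of_real ?V)" .
  have c: "continuous_on pibox (\<lambda>\<theta>. e0 \<theta> * (\<Sum>i\<in>?I. \<Sum>j\<in>?I. of_real (C i j) * e \<theta> i * e \<theta> j))"
    unfolding e0_def e_def by (intro continuous_intros)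
  have "\<bar>\<Sum>i\<in>?I. \<Sum>j\<in>?I. hankel (\<lambda>k. Re (fourier_coeff g k)) n i j * C i j\<bar>
     \<le> cmod (\<integral>\<theta>. g \<theta> * (e0 \<theta> * (\<Sum>i\<in>?I. \<Sum>j\<in>?I. of_real (C i j) * e \<theta> i * e \<theta> j)) \<partial>box_measure) / ?V"
    unfolding eq by (rule order_trans[OF abs_Re_le_cmod]) (simp add: norm_divide norm_power norm_mult)
  also have "\<dots> \<le> (\<integral>\<theta>. cmod (g \<theta>) * \<kappa> \<partial>box_measure) / ?V"
  proof (intro divide_right_mono order_trans[OF integral_norm_bound] integral_mono)
    show "integrable box_measure (\<lambda>\<theta>. cmod (g \<theta> * (e0 \<theta> * (\<Sum>i\<in>?I. \<Sum>j\<in>?I. of_real (C i j) * e \<theta> i * e \<theta> j))))"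
      by (intro integrable_norm integrable_box_mult_continuous g c)
    show "integrable box_measure (\<lambda>\<theta>. cmod (g \<theta>) * \<kappa>)" using g by simp
    fix \<theta>
    have "cmod (e0 \<theta> * (\<Sum>i\<in>?I. \<Sum>j\<in>?I. of_real (C i j) * e \<theta> i * e \<theta> j)) \<le> \<kappa>"
      unfolding norm_mult e0_def using \<kappa>[of "e \<theta>"] by (simp add: e_def)
    then show "cmod (g \<theta> * (e0 \<theta> * (\<Sum>i\<in>?I. \<Sum>j\<in>?I. of_real (C i j) * e \<theta> i * e \<theta> j))) \<le> cmod (g \<theta>) * \<kappa>"
      unfolding norm_mult[of "g \<theta>"] by (rule mult_left_mono) simp
  qed simp
  also have "\<dots> = \<kappa> * ((\<integral>\<theta>. cmod (g \<theta>) \<partial>box_measure) / ?V)" by simp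
  finally show ?thesis .
qed

lemma fourier_coeff_trig_poly:
  fixes c :: "('d::finite \<Rightarrow> int) \<Rightarrow> complex"
  assumes K: "finite K"
  shows "fourier_coeff (\<lambda>\<theta>. \<Sum>k\<in>K. c k * trig_exp k \<theta>) m = (if m \<in> K then c m else 0)"
proof -
  let ?V = "(2 * pi) ^ CARD('d)"
  have "(\<integral>\<theta>. (\<Sum>k\<in>K. c k * trig_exp k \<theta>) * trig_exp (\<lambda>l. - m l) \<theta> \<partial>box_measure)
      = (\<integral>\<theta>. (\<Sum>k\<in>K. c k * trig_exp (\<lambda>l. k l + - m l) \<theta>) \<partial>box_measure)"
    by (simp only: trig_exp_add sum_distrib_right mult.assoc)
  also have "\<dots> = (\<Sum>k\<in>K. c k * (\<integral>\<theta>. trig_exp (\<lambda>l. k l + - m l) \<theta> \<partial>box_measure))"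
    by (subst Bochner_Integration.integral_sum) (auto intro!: integrable_box_continuous continuous_intros)
  also have "\<dots> = (\<Sum>k\<in>K. if k = m then c m * of_real ?V else 0)"
  proof (intro sum.cong refl)
    fix k
    show "c k * (\<integral>\<theta>. trig_exp (\<lambda>l. k l + - m l) \<theta> \<partial>box_measure) = (if k = m then c m * of_real ?V else 0)"
    proof -
      have "(\<lambda>l. k l + - m l) = (\<lambda>l. 0) \<longleftrightarrow> k = m" by (auto simp: fun_eq_iff)
      then show ?thesis by (simp only: integral_trig_exp) simp
    qed
  qed
  also have "\<dots> = (if m \<in> K then c m * of_real ?V else 0)" using K by simp
  finally show ?thesis
    by (subst fourier_coeff_lebesgue) (auto intro!: integrable_box_continuous continuous_intros)
qed


lemma separable_quotient_distribution:
  fixes f :: "real ^ 'd::finite \<Rightarrow> complex" and \<phi> :: "real \<Rightarrow> real"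
  assumes f: "integrable box_measure f" and re: "\<And>k. fourier_coeff f k \<in> \<real>"
    and \<phi>: "separable_quotient \<phi>"
    and E: "\<And>n. eigenbasis (mindex n) (hankel (\<lambda>k. Re (fourier_coeff f k)) n) (\<mu> n) (u n)"
  shows "((\<lambda>n. (\<Sum>k\<in>mindex n. \<phi> (\<mu> n k)) / real (\<Prod>l\<in>UNIV. n l)) \<longlongrightarrow> radial_average f \<phi>) multi_at_top"
proof (rule tendsto_uniform_approx)
  fix e :: real assume e: "e > 0"
  let ?V = "(2 * pi) ^ CARD('d)"
  have V: "?V > 0" by simp
  obtain K where K: "K \<ge> 0" "\<And>x y. \<bar>\<phi> x - \<phi> y\<bar> \<le> K * \<bar>x - y\<bar>"
    "\<And>(I :: ('d \<Rightarrow> nat) set) A B \<mu> u \<nu> w \<delta>. \<lbrakk>eigenbasis I A \<mu> u; eigenbasis I B \<nu> w;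
        \<And>i j. i \<in> I \<Longrightarrow> j \<in> I \<Longrightarrow> A i j = A j i;
        \<And>C \<kappa>. (\<And>z. (\<And>i. cmod (z i) = 1) \<Longrightarrow> cmod (\<Sum>i\<in>I. \<Sum>j\<in>I. of_real (C i j) * z i * z j) \<le> \<kappa>) \<Longrightarrow>
           \<bar>\<Sum>i\<in>I. \<Sum>j\<in>I. (A i j - B i j) * C i j\<bar> \<le> \<kappa> * \<delta>\<rbrakk> \<Longrightarrow>
      \<bar>(\<Sum>k\<in>I. \<phi> (\<mu> k)) - (\<Sum>k\<in>I. \<phi> (\<nu> k))\<bar> \<le> K * real (card I) * \<delta>"
    using separable_quotient_perturbation[OF \<phi>, where 'i = "'d \<Rightarrow> nat"] by blast
  obtain B where B: "\<And>x. \<bar>\<phi> x\<bar> \<le> B" using \<phi> by (auto simp: separable_quotient_def)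
  have \<phi>c: "continuous_on UNIV \<phi>" by (rule separable_quotient_continuous[OF \<phi>])
  \<comment> \<open>\<open>K\<close> depends on \<open>\<phi>\<close> alone, so the approximating
    polynomial may be chosen after it. It serves twice, for the spectral sums and as Lipschitz
    constant for the radial averages; the \<open>+ 1\<close> covers \<open>K = 0\<close>.\<close>
  have "e * ?V / (K + 1) > 0" using e V K(1) by simp
  then obtain J and a :: "('d \<Rightarrow> int) \<Rightarrow> real" where J: "finite J"
    and Ja: "(\<integral>\<theta>. cmod (f \<theta> - (\<Sum>k\<in>J. of_real (a k) * trig_exp k \<theta>)) \<partial>box_measure) < e * ?V / (K + 1)"
    using real_trig_poly_L1_dense[OF f re] by blast
  define c where "c = (\<lambda>k. if k \<in> J then a k else 0)"
  \<comment> \<open>A crude common bound for all frequencies in \<open>J\<close>, which puts the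
    polynomial into the box form of the Hankel results.\<close>
  define R where "R = (\<Sum>k\<in>J. \<Sum>l\<in>UNIV. nat \<bar>k l\<bar>)"
  have J_sub: "J \<subseteq> ibox R"
  proof
    fix k assume k: "k \<in> J"
    have "\<bar>k l\<bar> \<le> int R" for l
    proof -
      have "nat \<bar>k l\<bar> \<le> (\<Sum>l\<in>UNIV. nat \<bar>k l\<bar>)" by (rule member_le_sum) auto
      also have "\<dots> \<le> R" unfolding R_def by (rule member_le_sum[OF k _ J]) auto
      finally show ?thesis by linarith
    qed
    then show "k \<in> ibox R" by (simp add: ibox_def)
  qed
  have supp: "c k = 0" if "k \<notin> ibox R" for k using that J_sub by (auto simp: c_def)
  define p where "p = (\<lambda>\<theta>. \<Sum>k\<in>ibox R. of_real (c k) * trig_exp k \<theta>)"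
  have p_J: "p \<theta> = (\<Sum>k\<in>J. of_real (a k) * trig_exp k \<theta>)" for \<theta>
    unfolding p_def using J_sub by (intro sum.mono_neutral_cong_right) (auto simp: c_def)
  have ip: "integrable box_measure p"
    unfolding p_def by (intro integrable_box_continuous continuous_intros)
  have ig: "integrable box_measure (\<lambda>\<theta>. f \<theta> - p \<theta>)" using f ip by simp
  define \<delta> where "\<delta> = (\<integral>\<theta>. cmod (f \<theta> - p \<theta>) \<partial>box_measure) / ?V"
  have \<delta>0: "\<delta> \<ge> 0" unfolding \<delta>_def using V by (intro divide_nonneg_pos integral_nonneg_AE) auto
  have "\<delta> < e / (K + 1)" using Ja V unfolding \<delta>_def p_J by (simp add: divide_less_eq mult.commute)
  then have "K * \<delta> + \<delta> < e" using K(1) by (simp add: pos_less_divide_eq algebra_simps)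
  then have K\<delta>: "K * \<delta> \<le> e" using \<delta>0 by linarith
  have cp: "fourier_coeff p k = of_real (c k)" for k
    unfolding p_def using fourier_coeff_trig_poly[OF finite_ibox, of "\<lambda>k. of_real (c k)" R k] by (auto simp: supp)
  have diff: "hankel (\<lambda>k. Re (fourier_coeff f k)) n i j - hankel c n i j
      = hankel (\<lambda>k. Re (fourier_coeff (\<lambda>\<theta>. f \<theta> - p \<theta>) k)) n i j" for n i j
  proof -
    have ik: "integrable box_measure (\<lambda>\<theta>. h \<theta> * trig_exp m \<theta>)" if "integrable box_measure h" for h :: "real ^ 'd \<Rightarrow> complex" and m
      by (intro integrable_box_mult_continuous that continuous_intros)
    have "fourier_coeff (\<lambda>\<theta>. f \<theta> - p \<theta>) k = fourier_coeff f k - fourier_coeff p k" for k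
      unfolding fourier_coeff_lebesgue[OF f] fourier_coeff_lebesgue[OF ip] fourier_coeff_lebesgue[OF ig]
      by (simp add: left_diff_distrib ik f ip diff_divide_distrib)
    then show ?thesis by (simp add: hankel_def cp)
  qed
  have "\<exists>\<nu> w. eigenbasis (mindex n) (hankel c n) \<nu> w" for n
    using real_symmetric_eigenbasis[of "mindex n" "hankel c n"] finite_mindex hankel_sym by metis
  then obtain \<nu> w where Ep: "\<And>n. eigenbasis (mindex n) (hankel c n) (\<nu> n) (w n)" by metis
  have lim: "((\<lambda>n. (\<Sum>k\<in>mindex n. \<phi> (\<nu> n k)) / real (\<Prod>l\<in>UNIV. n l)) \<longlongrightarrow> radial_average p \<phi>) multi_at_top"
    unfolding p_def by (rule hankel_trig_poly_distribution[OF supp \<phi>c Ep])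
  have close: "\<bar>(\<Sum>k\<in>mindex n. \<phi> (\<mu> n k)) / real (\<Prod>l\<in>UNIV. n l) - (\<Sum>k\<in>mindex n. \<phi> (\<nu> n k)) / real (\<Prod>l\<in>UNIV. n l)\<bar> \<le> e" for n
  proof -
    have "\<bar>(\<Sum>k\<in>mindex n. \<phi> (\<mu> n k)) - (\<Sum>k\<in>mindex n. \<phi> (\<nu> n k))\<bar> \<le> K * real (card (mindex n)) * \<delta>"
    proof (rule K(3)[OF E Ep hankel_sym])
      fix C \<kappa>
      assume "\<And>z. (\<And>i. cmod (z i) = 1) \<Longrightarrow> cmod (\<Sum>i\<in>mindex n. \<Sum>j\<in>mindex n. of_real (C i j) * z i * z j) \<le> \<kappa>"
      then show "\<bar>\<Sum>i\<in>mindex n. \<Sum>j\<in>mindex n. (hankel (\<lambda>k. Re (fourier_coeff f k)) n i j - hankel c n i j) * C i j\<bar> \<le> \<kappa> * \<delta>"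
        unfolding diff \<delta>_def by (rule hankel_difference_trace[OF ig])
    qed
    also have "\<dots> = K * \<delta> * real (\<Prod>l\<in>UNIV. n l)" by (simp add: card_mindex)
    also have "\<dots> \<le> e * real (\<Prod>l\<in>UNIV. n l)" by (intro mult_right_mono K\<delta> of_nat_0_le_iff)
    finally show ?thesis using e
      by (simp add: diff_divide_distrib[symmetric] abs_divide divide_le_eq del: of_nat_prod)
  qed
  have "\<bar>radial_average f \<phi> - radial_average p \<phi>\<bar> \<le> (\<integral>\<theta>. K * cmod (f \<theta> - p \<theta>) \<partial>box_measure) / ?V"
  proof (rule radial_average_diff[OF integrable_radial[OF f \<phi>c B] integrable_radial[OF ip \<phi>c B]])
    show "integrable box_measure (\<lambda>\<theta>. K * cmod (f \<theta> - p \<theta>))" using ig by simp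
    fix \<theta>
    have "K * \<bar>cmod (f \<theta>) - cmod (p \<theta>)\<bar> \<le> K * cmod (f \<theta> - p \<theta>)"
      by (intro mult_left_mono norm_triangle_ineq3 K(1))
    moreover have "\<bar>\<phi> (- cmod (f \<theta>)) - \<phi> (- cmod (p \<theta>))\<bar> \<le> K * \<bar>cmod (f \<theta>) - cmod (p \<theta>)\<bar>"
      using K(2)[of "- cmod (f \<theta>)" "- cmod (p \<theta>)"] by (simp add: abs_minus_commute)
    ultimately show "\<bar>\<phi> (cmod (f \<theta>)) - \<phi> (cmod (p \<theta>))\<bar> \<le> K * cmod (f \<theta> - p \<theta>)"
      "\<bar>\<phi> (- cmod (f \<theta>)) - \<phi> (- cmod (p \<theta>))\<bar> \<le> K * cmod (f \<theta> - p \<theta>)"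
      using K(2)[of "cmod (f \<theta>)" "cmod (p \<theta>)"] by linarith+
  qed
  also have "\<dots> = K * \<delta>" by (simp add: \<delta>_def)
  finally have "\<bar>radial_average f \<phi> - radial_average p \<phi>\<bar> \<le> e" using K\<delta> by linarith
  with lim close show "\<exists>g L'. (g \<longlongrightarrow> L') multi_at_top \<and>
      eventually (\<lambda>n. \<bar>(\<Sum>k\<in>mindex n. \<phi> (\<mu> n k)) / real (\<Prod>l\<in>UNIV. n l) - g n\<bar> \<le> e) multi_at_top \<and>
      \<bar>radial_average f \<phi> - L'\<bar> \<le> e"
    by (intro exI[of _ "\<lambda>n. (\<Sum>k\<in>mindex n. \<phi> (\<nu> n k)) / real (\<Prod>l\<in>UNIV. n l)"] exI[of _ "radial_average p \<phi>"]) (simp del: of_nat_prod)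
qed

lemma compact_support_distribution:
  fixes f :: "real ^ 'd::finite \<Rightarrow> complex" and \<phi> :: "real \<Rightarrow> real"
  assumes f: "integrable box_measure f" and re: "\<And>k. fourier_coeff f k \<in> \<real>"
    and \<phi>: "continuous_on UNIV \<phi>" and supp: "\<And>x. \<bar>x\<bar> > R \<Longrightarrow> \<phi> x = 0"
    and E: "\<And>n. eigenbasis (mindex n) (hankel (\<lambda>k. Re (fourier_coeff f k)) n) (\<mu> n) (u n)"
  shows "integrable box_measure (\<lambda>\<theta>. (\<phi> (cmod (f \<theta>)) + \<phi> (- cmod (f \<theta>))) / 2)"
    "((\<lambda>n. (\<Sum>k\<in>mindex n. \<phi> (\<mu> n k)) / real (\<Prod>l\<in>UNIV. n l)) \<longlongrightarrow> radial_average f \<phi>) multi_at_top"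
proof -
  \<comment> \<open>An approximation at unit distance, made to see that \<open>\<phi>\<close> is
    bounded and its radial function integrable.\<close>
  obtain g where g: "separable_quotient g" "\<And>x. \<bar>\<phi> x - g x\<bar> < 1"
    by (rule separable_quotient_dense[of \<phi> R 1]) (use \<phi> supp that in auto)
  obtain B where B: "\<And>x. \<bar>g x\<bar> \<le> B" using g(1) by (auto simp: separable_quotient_def)
  have "\<bar>\<phi> x\<bar> \<le> B + 1" for x using g(2)[of x] B[of x] by linarith
  from integrable_radial[OF f \<phi> this]
  show i\<phi>: "integrable box_measure (\<lambda>\<theta>. (\<phi> (cmod (f \<theta>)) + \<phi> (- cmod (f \<theta>))) / 2)" .
  interpret finite_measure "box_measure :: (real ^ 'd) measure" by (rule finite_measure_box)
  show "((\<lambda>n. (\<Sum>k\<in>mindex n. \<phi> (\<mu> n k)) / real (\<Prod>l\<in>UNIV. n l)) \<longlongrightarrow> radial_average f \<phi>) multi_at_top"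
  proof (rule tendsto_uniform_approx)
    fix e :: real assume e: "e > 0"
    obtain g where g: "separable_quotient g" "\<And>x. \<bar>\<phi> x - g x\<bar> < e"
      by (rule separable_quotient_dense[of \<phi> R e]) (use \<phi> supp e that in auto)
    obtain B where B: "\<And>x. \<bar>g x\<bar> \<le> B" using g(1) by (auto simp: separable_quotient_def)
    note lim = separable_quotient_distribution[OF f re g(1) E]
    have close: "\<bar>(\<Sum>k\<in>mindex n. \<phi> (\<mu> n k)) / real (\<Prod>l\<in>UNIV. n l) - (\<Sum>k\<in>mindex n. g (\<mu> n k)) / real (\<Prod>l\<in>UNIV. n l)\<bar> \<le> e" for n
    proof -
      have "\<bar>(\<Sum>k\<in>mindex n. \<phi> (\<mu> n k)) - (\<Sum>k\<in>mindex n. g (\<mu> n k))\<bar> \<le> (\<Sum>k\<in>mindex n. e)"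
        unfolding sum_subtractf[symmetric]
        by (rule order_trans[OF sum_abs]) (intro sum_mono less_imp_le g(2))
      also have "\<dots> = e * real (\<Prod>l\<in>UNIV. n l)" by (simp add: card_mindex mult.commute)
      finally show ?thesis using e
        by (simp add: diff_divide_distrib[symmetric] abs_divide divide_le_eq del: of_nat_prod)
    qed
    have "\<bar>radial_average f \<phi> - radial_average f g\<bar> \<le> (\<integral>\<theta>. e \<partial>(box_measure :: (real ^ 'd) measure)) / (2 * pi) ^ CARD('d)"
      by (rule radial_average_diff[OF i\<phi> integrable_radial[OF f separable_quotient_continuous[OF g(1)] B]])
         (use g(2) in \<open>auto intro: less_imp_le\<close>)
    also have "\<dots> = e" by (simp add: measure_box_measure)
    finally have "\<bar>radial_average f \<phi> - radial_average f g\<bar> \<le> e" .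
    with lim close show "\<exists>g L'. (g \<longlongrightarrow> L') multi_at_top \<and>
        eventually (\<lambda>n. \<bar>(\<Sum>k\<in>mindex n. \<phi> (\<mu> n k)) / real (\<Prod>l\<in>UNIV. n l) - g n\<bar> \<le> e) multi_at_top \<and>
        \<bar>radial_average f \<phi> - L'\<bar> \<le> e"
      by (intro exI[of _ "\<lambda>n. (\<Sum>k\<in>mindex n. g (\<mu> n k)) / real (\<Prod>l\<in>UNIV. n l)"] exI[of _ "radial_average f g"]) (simp del: of_nat_prod)
  qed
qed

theorem theorem3p5:
  fixes f :: "real ^ 'd::finite \<Rightarrow> complex"
  assumes f_L1: "f absolutely_integrable_on pibox"
    and real_T: "\<And>n::'d \<Rightarrow> nat. (\<forall>l. 0 < n l) \<Longrightarrow>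
        \<forall>i\<in>mindex n. \<forall>j\<in>mindex n. toeplitz f n i j \<in> \<real>"
    and F_cont: "continuous_on UNIV F"
    and F_supp: "compact (closure {z. F z \<noteq> 0})"
  shows "\<forall>\<epsilon>>0. \<exists>N. \<forall>n::'d \<Rightarrow> nat. (\<forall>l. N \<le> n l) \<longrightarrow>
     cmod (eig_sum (mindex n) (mmult (mindex n) (exchange n) (toeplitz f n)) F
             / of_nat (\<Prod>l\<in>UNIV. n l)
           - integral pibox (\<lambda>\<theta>. (F (of_real (cmod (f \<theta>))) + F (- of_real (cmod (f \<theta>)))) / 2)
             / complex_of_real ((2 * pi) ^ CARD('d))) < \<epsilon>"
proof -
  let ?V = "(2 * pi) ^ CARD('d)"
  let ?H = "\<lambda>n. hankel (\<lambda>k. Re (fourier_coeff f k)) n"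
  have f: "integrable box_measure f" by (rule absolutely_integrable_imp_integrable[OF f_L1 pibox_lebesgue])
  have re: "fourier_coeff f k \<in> \<real>" for k by (rule fourier_coeff_real[OF real_T])
  have "\<exists>\<mu> u. eigenbasis (mindex n) (?H n) \<mu> u \<and>
      (\<forall>F. eig_sum (mindex n) (\<lambda>i j. complex_of_real (?H n i j)) F = (\<Sum>k\<in>mindex n. F (complex_of_real (\<mu> k))))" for n
    using real_symmetric_eigenbasis[of "mindex n" "?H n"] finite_mindex hankel_sym by metis
  then obtain \<mu> u where E: "\<And>n. eigenbasis (mindex n) (?H n) (\<mu> n) (u n)"
    and eig: "\<And>n F. eig_sum (mindex n) (\<lambda>i j. complex_of_real (?H n i j)) F = (\<Sum>k\<in>mindex n. F (complex_of_real (\<mu> n k)))"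
    by metis
  have eig_sum: "eig_sum (mindex n) (mmult (mindex n) (exchange n) (toeplitz f n)) F = (\<Sum>k\<in>mindex n. F (complex_of_real (\<mu> n k)))" for n
    unfolding eig[symmetric]
    by (rule eig_sum_cong) (simp add: exchange_toeplitz_entry hankel_def re)
  \<comment> \<open>The eigenvalues and +-|f| are all real, so \<open>F\<close> enters through its
    restriction to the real line, split into real and imaginary parts because the limit law above is
    for real test functions.\<close>
  define \<phi> where "\<phi> = (\<lambda>x. Re (F (complex_of_real x)))"
  define \<psi> where "\<psi> = (\<lambda>x. Im (F (complex_of_real x)))"
  have cont: "continuous_on UNIV \<phi>" "continuous_on UNIV \<psi>"
    unfolding \<phi>_def \<psi>_def by (intro continuous_intros continuous_on_compose2[OF F_cont]; simp)+
  have "bounded {z. F z \<noteq> 0}" using F_supp compact_imp_bounded bounded_closure_image bounded_subset closure_subset by metis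
  then obtain R where R: "\<And>z. F z \<noteq> 0 \<Longrightarrow> cmod z \<le> R" by (auto simp: bounded_iff)
  have "F (complex_of_real x) = 0" if "\<bar>x\<bar> > R" for x using R[of "of_real x"] that by force
  then have supp: "\<phi> x = 0" "\<psi> x = 0" if "\<bar>x\<bar> > R" for x using that by (auto simp: \<phi>_def \<psi>_def)
  note lim\<phi> = compact_support_distribution[OF f re cont(1) supp(1) E]
  note lim\<psi> = compact_support_distribution[OF f re cont(2) supp(2) E]
  let ?G = "\<lambda>\<theta>. (F (of_real (cmod (f \<theta>))) + F (- of_real (cmod (f \<theta>)))) / 2"
  have G: "?G \<theta> = of_real ((\<phi> (cmod (f \<theta>)) + \<phi> (- cmod (f \<theta>))) / 2) + \<i> * of_real ((\<psi> (cmod (f \<theta>)) + \<psi> (- cmod (f \<theta>))) / 2)" for \<theta>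
    by (simp add: complex_eq_iff \<phi>_def \<psi>_def)
  have iG: "integrable box_measure ?G"
    unfolding G using lim\<phi>(1) lim\<psi>(1)
    by (intro Bochner_Integration.integrable_add integrable_mult_right integrable_of_real)
  have "integral pibox ?G = (\<integral>\<theta>. ?G \<theta> \<partial>box_measure)"
    using lebesgue_integral_eq_integral[OF iG] by simp
  also have "\<dots> = of_real (radial_average f \<phi> * ?V) + \<i> * of_real (radial_average f \<psi> * ?V)"
    unfolding G radial_average_def
    by (subst Bochner_Integration.integral_add)
       (use lim\<phi>(1) lim\<psi>(1) in \<open>auto intro!: integrable_mult_right integrable_of_real simp del: of_real_divide of_real_add integral_divide_zero integrable_divide_zero\<close>)
  finally have avg: "integral pibox ?G / of_real ?V = of_real (radial_average f \<phi>) + \<i> * of_real (radial_average f \<psi>)"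
    by (simp add: field_simps)
  have eq: "eig_sum (mindex n) (mmult (mindex n) (exchange n) (toeplitz f n)) F / of_nat (\<Prod>l\<in>UNIV. n l)
     = of_real ((\<Sum>k\<in>mindex n. \<phi> (\<mu> n k)) / real (\<Prod>l\<in>UNIV. n l)) + \<i> * of_real ((\<Sum>k\<in>mindex n. \<psi> (\<mu> n k)) / real (\<Prod>l\<in>UNIV. n l))" for n
  proof -
    have "F (complex_of_real x) = of_real (\<phi> x) + \<i> * of_real (\<psi> x)" for x by (simp add: complex_eq_iff \<phi>_def \<psi>_def)
    then show ?thesis unfolding eig_sum
      by (simp add: sum.distrib sum_distrib_left[symmetric] add_divide_distrib)
  qed
  have "((\<lambda>n. eig_sum (mindex n) (mmult (mindex n) (exchange n) (toeplitz f n)) F / of_nat (\<Prod>l\<in>UNIV. n l))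
      \<longlongrightarrow> integral pibox ?G / of_real ?V) multi_at_top"
    unfolding eq avg by (intro tendsto_intros tendsto_of_real lim\<phi>(2) lim\<psi>(2))
  then show ?thesis
    unfolding tendsto_iff eventually_multi_at_top dist_norm by blast
qed

end
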